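(* Let $f:\Lambda\to\Lambda\subset M$ be a $C^\infty$ hyperbolic diffeomorphism such that $\Lambda$ is a Cantor set, and fix $x_0\in\Lambda$ and a small $\delta>0$. For any $\alpha,\beta\in\mathbb{R}$, one can choose the roof function $r:\Lambda\to\mathbb{R}$ (the restriction to $\Lambda$ of a positive $C^\infty$ function on $M$) such that the temporal distance function $\mathcal{T}$ of the suspension flow of $f$ under $r$ satisfies $$\mathrm{range}(\mathcal{T})=\{0,\pm\alpha,\pm\beta\}.$$
   Context: $M$ is a compact smooth Riemannian manifold, and $\Lambda\subset M$ is a compact hyperbolic invariant set of the $C^\infty$ diffeomorphism $f$, with local product structure: nearby local stable and local unstable manifolds of points of $\Lambda$ meet in a single point, which lies in $\Lambda$. $W^s_f$ and $W^u_f$ denote the stable and unstable manifolds of $f$. For a positive $C^\infty$ function $r:M\to\mathbb{R}$, the suspension space is $\Lambda_r=\{(x,u):x\in\Lambda,\ 0\le u\le r(x)\}/\sim$ with $(x,r(x))\sim(f(x),0)$, and the suspension flow is $\phi_t(x,u)=(x,u+t)$ modulo $\sim$; it is a hyperbolic flow. Set $$\Delta^s(x,y)=\sum_{n=0}^\infty\big[r(f^n(y))-r(f^n(x))\big]\ (y\in W^s_f(x)),\qquad \Delta^u(x,y)=\sum_{n=1}^\infty\big[r(f^{-n}(x))-r(f^{-n}(y))\big]\ (y\in W^u_f(x)).$$ Let $B(x_0,\delta)$ be the ball of radius $\delta$ about $x_0$. For $x_1\in W^s_f(x_0)\cap B(x_0,\delta)\cap\Lambda$ and $x_2\in W^u_f(x_0)\cap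 B(x_0,\delta)\cap\Lambda$ (local stable, resp. unstable, manifold of $x_0$), let $x_3=W^u_f(x_1)\cap W^s_f(x_2)\cap B(x_0,\delta)$ (local manifolds), and $$\mathcal{H}(x_1,x_2)=\Delta^s(x_0,x_1)+\Delta^u(x_1,x_3)+\Delta^s(x_3,x_2)+\Delta^u(x_2,x_0).$$ For the suspension flow, the temporal distance of the corresponding points $(x_1,u_1)$, $(x_2,u_2)$ on the stable, resp. unstable, manifold of $(x_0,u_0)\in\Lambda_r$ equals $\mathcal{H}(x_1,x_2)$, so $$\mathrm{range}(\mathcal{T})=\{\mathcal{H}(x_1,x_2):x_1\in W^s_f(x_0)\cap B(x_0,\delta)\cap\Lambda,\ x_2\in W^u_f(x_0)\cap B(x_0,\delta)\cap\Lambda\}.$$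
   Formalization: The formal theorem also assumes that x_0 is an accumulation point of both its local stable and its local unstable manifold intersected with Λ; without this the range is {0} for all small δ and every r, so the claim fails unless α=β=0. *)

theory Defs
  imports "HOL-Analysis.Analysis"
begin

section \<open>Smooth manifolds and smooth maps\<close>

primrec Ck_on :: "nat \<Rightarrow> 'a::euclidean_space set \<Rightarrow> ('a \<Rightarrow> 'b::euclidean_space) \<Rightarrow> bool" where
  "Ck_on 0 S f \<longleftrightarrow> continuous_on S f"
| "Ck_on (Suc k) S f \<longleftrightarrow>
     (\<forall>x\<in>S. f differentiable (at x)) \<and>
     (\<forall>v. Ck_on k S (\<lambda>x. frechet_derivative f (at x) v))"

text \<open>Meant for open \<open>S\<close> only: derivatives are taken in the full space.\<close>

definition smooth_on :: "'a::euclidean_space set \<Rightarrow> ('a \<Rightarrow> 'b::euclidean_space) \<Rightarrow> bool" where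
  "smooth_on S f \<longleftrightarrow> (\<forall>k. Ck_on k S f)"

text \<open>
  The manifold is the whole type \<open>'m\<close>. A chart is a pair of its domain and its coordinate map,
  whose values outside the domain are irrelevant.
\<close>

type_synonym ('m, 'e) chart = "'m set \<times> ('m \<Rightarrow> 'e)"

abbreviation chart_inv :: "('m, 'e) chart \<Rightarrow> 'e \<Rightarrow> 'm" where
  "chart_inv c \<equiv> inv_into (fst c) (snd c)"

definition smooth_atlas ::
    "('m::{t2_space,second_countable_topology}, 'e::euclidean_space) chart set \<Rightarrow> bool" where
  "smooth_atlas \<A> \<longleftrightarrow>
     (\<Union>c\<in>\<A>. fst c) = UNIV \<and>
     (\<forall>c\<in>\<A>. open (fst c) \<and> open (snd c ` fst c) \<and>
        homeomorphism (fst c) (snd c ` fst c) (snd c) (chart_inv c)) \<and>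
     (\<forall>c\<in>\<A>. \<forall>d\<in>\<A>. smooth_on (snd c ` (fst c \<inter> fst d)) (snd d \<circ> chart_inv c))"

definition smooth_map ::
    "('m::{t2_space,second_countable_topology}, 'e::euclidean_space) chart set
      \<Rightarrow> ('m \<Rightarrow> 'm) \<Rightarrow> bool" where
  "smooth_map \<A> f \<longleftrightarrow> continuous_on UNIV f \<and>
     (\<forall>c\<in>\<A>. \<forall>d\<in>\<A>. smooth_on (snd c ` (fst c \<inter> f -` fst d)) (snd d \<circ> f \<circ> chart_inv c))"

definition smooth_function ::
    "('m::{t2_space,second_countable_topology}, 'e::euclidean_space) chart set
      \<Rightarrow> ('m \<Rightarrow> real) \<Rightarrow> bool" where
  "smooth_function \<A> g \<longleftrightarrow> (\<forall>c\<in>\<A>. smooth_on (snd c ` fst c) (g \<circ> chart_inv c))"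

definition smooth_diffeo ::
    "('m::{t2_space,second_countable_topology}, 'e::euclidean_space) chart set
      \<Rightarrow> ('m \<Rightarrow> 'm) \<Rightarrow> bool" where
  "smooth_diffeo \<A> f \<longleftrightarrow> bij f \<and> smooth_map \<A> f \<and> smooth_map \<A> (inv f)"


section \<open>Tangent vectors and Riemannian metrics\<close>

text \<open>
  A tangent vector at \<open>p\<close> is the family of its coordinate representations in all charts of the
  atlas around \<open>p\<close>; these are related by the derivatives of the transition maps. Entries at
  other charts are \<open>0\<close>, so that equality of families is equality of tangent vectors.
\<close>

type_synonym ('m, 'e) tvec = "('m, 'e) chart \<Rightarrow> 'e"

definition tangent_space ::
    "('m, 'e::euclidean_space) chart set \<Rightarrow> 'm \<Rightarrow> ('m, 'e) tvec set" where
  "tangent_space \<A> p = {V.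
     (\<forall>c\<in>\<A>. \<forall>d\<in>\<A>. p \<in> fst c \<inter> fst d \<longrightarrow>
        V d = frechet_derivative (snd d \<circ> chart_inv c) (at (snd c p)) (V c)) \<and>
     (\<forall>c. \<not> (c \<in> \<A> \<and> p \<in> fst c) \<longrightarrow> V c = 0)}"

text \<open>The tangent vector at \<open>p\<close> with coordinates \<open>v\<close> in the chart \<open>c\<close>.\<close>

definition coord_vec ::
    "('m, 'e::euclidean_space) chart set \<Rightarrow> ('m, 'e) chart \<Rightarrow> 'm \<Rightarrow> 'e \<Rightarrow> ('m, 'e) tvec" where
  "coord_vec \<A> c p v =
     (\<lambda>d. if d \<in> \<A> \<and> p \<in> fst d
          then frechet_derivative (snd d \<circ> chart_inv c) (at (snd c p)) v else 0)"

text \<open>The differential at \<open>p\<close>; it does not depend on the chart selected at \<open>p\<close>.\<close>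

definition tangent_map ::
    "('m, 'e::euclidean_space) chart set \<Rightarrow> ('m \<Rightarrow> 'm) \<Rightarrow> 'm
      \<Rightarrow> ('m, 'e) tvec \<Rightarrow> ('m, 'e) tvec" where
  "tangent_map \<A> f p V =
     (let c = (SOME c. c \<in> \<A> \<and> p \<in> fst c) in
      (\<lambda>d. if d \<in> \<A> \<and> f p \<in> fst d
           then frechet_derivative (snd d \<circ> f \<circ> chart_inv c) (at (snd c p)) (V c) else 0))"

type_synonym ('m, 'e) metric_tensor = "'m \<Rightarrow> ('m, 'e) tvec \<Rightarrow> ('m, 'e) tvec \<Rightarrow> real"

definition riemannian_metric ::
    "('m, 'e::euclidean_space) chart set \<Rightarrow> ('m, 'e) metric_tensor \<Rightarrow> bool" where
  "riemannian_metric \<A> G \<longleftrightarrow>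
     (\<forall>p. \<forall>U\<in>tangent_space \<A> p. \<forall>V\<in>tangent_space \<A> p. \<forall>W\<in>tangent_space \<A> p. \<forall>a b.
        G p (\<lambda>c. a *\<^sub>R U c + b *\<^sub>R V c) W = a * G p U W + b * G p V W) \<and>
     (\<forall>p. \<forall>U\<in>tangent_space \<A> p. \<forall>V\<in>tangent_space \<A> p. G p U V = G p V U) \<and>
     (\<forall>p. \<forall>V\<in>tangent_space \<A> p. V \<noteq> (\<lambda>c. 0) \<longrightarrow> 0 < G p V V) \<and>
     (\<forall>c\<in>\<A>. \<forall>v w. smooth_on (snd c ` fst c)
        (\<lambda>u. let p = chart_inv c u in G p (coord_vec \<A> c p v) (coord_vec \<A> c p w)))"

definition tangent_norm :: "('m, 'e) metric_tensor \<Rightarrow> 'm \<Rightarrow> ('m, 'e) tvec \<Rightarrow> real" where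
  "tangent_norm G p V = sqrt (G p V V)"

definition piecewise_C1_curve ::
    "('m::topological_space, 'e::euclidean_space) chart set \<Rightarrow> (real \<Rightarrow> 'm) \<Rightarrow> bool" where
  "piecewise_C1_curve \<A> \<gamma> \<longleftrightarrow> continuous_on {0..1} \<gamma> \<and>
     (\<exists>S. finite S \<and>
        (\<forall>c\<in>\<A>. (snd c \<circ> \<gamma>) C1_differentiable_on ({0..1} - S) \<inter> \<gamma> -` fst c))"

definition velocity ::
    "('m, 'e::euclidean_space) chart set \<Rightarrow> (real \<Rightarrow> 'm) \<Rightarrow> real \<Rightarrow> ('m, 'e) tvec" where
  "velocity \<A> \<gamma> t =
     (\<lambda>c. if c \<in> \<A> \<and> \<gamma> t \<in> fst c then vector_derivative (snd c \<circ> \<gamma>) (at t) else 0)"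

definition curve_length ::
    "('m, 'e::euclidean_space) chart set \<Rightarrow> ('m, 'e) metric_tensor \<Rightarrow> (real \<Rightarrow> 'm) \<Rightarrow> ennreal" where
  "curve_length \<A> G \<gamma> =
     (\<integral>\<^sup>+t\<in>{0..1}. ennreal (tangent_norm G (\<gamma> t) (velocity \<A> \<gamma> t)) \<partial>lborel)"

text \<open>Infinite between different connected components.\<close>

definition riemannian_dist ::
    "('m::topological_space, 'e::euclidean_space) chart set \<Rightarrow> ('m, 'e) metric_tensor
      \<Rightarrow> 'm \<Rightarrow> 'm \<Rightarrow> ennreal" where
  "riemannian_dist \<A> G x y =
     Inf {curve_length \<A> G \<gamma> |\<gamma>. piecewise_C1_curve \<A> \<gamma> \<and> \<gamma> 0 = x \<and> \<gamma> 1 = y}"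

definition riemannian_ball ::
    "('m::topological_space, 'e::euclidean_space) chart set \<Rightarrow> ('m, 'e) metric_tensor
      \<Rightarrow> 'm \<Rightarrow> real \<Rightarrow> 'm set" where
  "riemannian_ball \<A> G x \<delta> = {y. riemannian_dist \<A> G x y < ennreal \<delta>}"


section \<open>Hyperbolic sets\<close>

definition tangent_subspace ::
    "('m, 'e::euclidean_space) chart set \<Rightarrow> 'm \<Rightarrow> ('m, 'e) tvec set \<Rightarrow> bool" where
  "tangent_subspace \<A> p E \<longleftrightarrow> E \<subseteq> tangent_space \<A> p \<and> (\<lambda>c. 0) \<in> E \<and>
     (\<forall>U\<in>E. \<forall>V\<in>E. \<forall>a b. (\<lambda>c. a *\<^sub>R U c + b *\<^sub>R V c) \<in> E)"

definition hyperbolic_set ::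
    "('m::topological_space, 'e::euclidean_space) chart set \<Rightarrow> ('m, 'e) metric_tensor
      \<Rightarrow> ('m \<Rightarrow> 'm) \<Rightarrow> 'm set \<Rightarrow> bool" where
  "hyperbolic_set \<A> G f \<Lambda> \<longleftrightarrow> compact \<Lambda> \<and> f ` \<Lambda> = \<Lambda> \<and>
     (\<exists>Es Eu C \<kappa>. 0 < C \<and> 0 < \<kappa> \<and> \<kappa> < 1 \<and>
       (\<forall>x\<in>\<Lambda>.
          tangent_subspace \<A> x (Es x) \<and> tangent_subspace \<A> x (Eu x) \<and>
          Es x \<inter> Eu x = {\<lambda>c. 0} \<and>
          (\<forall>V\<in>tangent_space \<A> x. \<exists>U\<in>Es x. \<exists>W\<in>Eu x. V = (\<lambda>c. U c + W c)) \<and>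
          tangent_map \<A> f x ` Es x = Es (f x) \<and>
          tangent_map \<A> f x ` Eu x = Eu (f x) \<and>
          (\<forall>V\<in>Es x. \<forall>n. tangent_norm G ((f ^^ n) x) (tangent_map \<A> (f ^^ n) x V)
                          \<le> C * \<kappa> ^ n * tangent_norm G x V) \<and>
          (\<forall>V\<in>Eu x. \<forall>n. tangent_norm G ((inv f ^^ n) x) (tangent_map \<A> (inv f ^^ n) x V)
                          \<le> C * \<kappa> ^ n * tangent_norm G x V)))"

text \<open>Local stable and unstable manifolds of size \<open>\<epsilon>\<close>, in Bowen's form.\<close>

definition local_stable ::
    "('m::topological_space, 'e::euclidean_space) chart set \<Rightarrow> ('m, 'e) metric_tensor
      \<Rightarrow> ('m \<Rightarrow> 'm) \<Rightarrow> real \<Rightarrow> 'm \<Rightarrow> 'm set" where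
  "local_stable \<A> G f \<epsilon> x =
     {y. \<forall>n. riemannian_dist \<A> G ((f ^^ n) x) ((f ^^ n) y) \<le> ennreal \<epsilon>}"

definition local_unstable ::
    "('m::topological_space, 'e::euclidean_space) chart set \<Rightarrow> ('m, 'e) metric_tensor
      \<Rightarrow> ('m \<Rightarrow> 'm) \<Rightarrow> real \<Rightarrow> 'm \<Rightarrow> 'm set" where
  "local_unstable \<A> G f \<epsilon> x = local_stable \<A> G (inv f) \<epsilon> x"

definition local_product_structure ::
    "('m::topological_space, 'e::euclidean_space) chart set \<Rightarrow> ('m, 'e) metric_tensor
      \<Rightarrow> ('m \<Rightarrow> 'm) \<Rightarrow> 'm set \<Rightarrow> bool" where
  "local_product_structure \<A> G f \<Lambda> \<longleftrightarrow>
     (\<exists>\<epsilon>\<^sub>0>0. \<forall>\<epsilon>. 0 < \<epsilon> \<and> \<epsilon> < \<epsilon>\<^sub>0 \<longrightarrow>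
       (\<exists>\<eta>>0. \<forall>x\<in>\<Lambda>. \<forall>y\<in>\<Lambda>. riemannian_dist \<A> G x y < ennreal \<eta> \<longrightarrow>
          (\<exists>z\<in>\<Lambda>. local_stable \<A> G f \<epsilon> x \<inter> local_unstable \<A> G f \<epsilon> y = {z})))"

definition cantor_set :: "'m::topological_space set \<Rightarrow> bool" where
  "cantor_set \<Lambda> \<longleftrightarrow> \<Lambda> homeomorphic (UNIV :: (nat \<Rightarrow> bool) set)"


section \<open>Temporal distance of the suspension flow\<close>

definition Delta_s :: "('m \<Rightarrow> 'm) \<Rightarrow> ('m \<Rightarrow> real) \<Rightarrow> 'm \<Rightarrow> 'm \<Rightarrow> real" where
  "Delta_s f r x y = (\<Sum>n. r ((f ^^ n) y) - r ((f ^^ n) x))"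

text \<open>The sum starts at the first preimages, hence \<open>Suc n\<close>.\<close>

definition Delta_u :: "('m \<Rightarrow> 'm) \<Rightarrow> ('m \<Rightarrow> real) \<Rightarrow> 'm \<Rightarrow> 'm \<Rightarrow> real" where
  "Delta_u f r x y = (\<Sum>n. r ((inv f ^^ Suc n) x) - r ((inv f ^^ Suc n) y))"

text \<open>
  The set in which \<open>x\<^sub>3\<close> is sought; for small \<open>\<epsilon>\<close> and \<open>\<delta>\<close> it has at most one element.
\<close>

definition corner_set ::
    "('m::topological_space, 'e::euclidean_space) chart set \<Rightarrow> ('m, 'e) metric_tensor
      \<Rightarrow> ('m \<Rightarrow> 'm) \<Rightarrow> real \<Rightarrow> real \<Rightarrow> 'm \<Rightarrow> 'm \<Rightarrow> 'm \<Rightarrow> 'm set" where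
  "corner_set \<A> G f \<epsilon> \<delta> x0 x1 x2 =
     local_unstable \<A> G f \<epsilon> x1 \<inter> local_stable \<A> G f \<epsilon> x2 \<inter> riemannian_ball \<A> G x0 \<delta>"

text \<open>
  In the suspension flow of \<open>f\<close> under \<open>r\<close>, the temporal distance of the points over \<open>x\<^sub>1\<close> and
  \<open>x\<^sub>2\<close> on the stable and unstable manifold of \<open>(x\<^sub>0, u\<^sub>0)\<close> is the following alternating sum
  over the quadrilateral \<open>x\<^sub>0, x\<^sub>1, x\<^sub>3, x\<^sub>2\<close>; in particular it does not depend on \<open>u\<^sub>0\<close>.
\<close>

definition temporal_distance ::
    "('m::topological_space, 'e::euclidean_space) chart set \<Rightarrow> ('m, 'e) metric_tensor
      \<Rightarrow> ('m \<Rightarrow> 'm) \<Rightarrow> ('m \<Rightarrow> real) \<Rightarrow> real \<Rightarrow> real \<Rightarrow> 'm \<Rightarrow> 'm \<Rightarrow> 'm \<Rightarrow> real" where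
  "temporal_distance \<A> G f r \<epsilon> \<delta> x0 x1 x2 =
     (let x3 = (THE z. z \<in> corner_set \<A> G f \<epsilon> \<delta> x0 x1 x2) in
      Delta_s f r x0 x1 + Delta_u f r x1 x3 + Delta_s f r x3 x2 + Delta_u f r x2 x0)"

text \<open>
  The point \<open>x\<^sub>3\<close> can leave the ball when \<open>x\<^sub>1\<close> and \<open>x\<^sub>2\<close> are close to its boundary; the temporal
  distance is then undefined, so such pairs are not in its domain.
\<close>

definition temporal_domain ::
    "('m::topological_space, 'e::euclidean_space) chart set \<Rightarrow> ('m, 'e) metric_tensor
      \<Rightarrow> ('m \<Rightarrow> 'm) \<Rightarrow> 'm set \<Rightarrow> real \<Rightarrow> real \<Rightarrow> 'm \<Rightarrow> ('m \<times> 'm) set" where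
  "temporal_domain \<A> G f \<Lambda> \<epsilon> \<delta> x0 =
     {(x1, x2).
        x1 \<in> local_stable \<A> G f \<epsilon> x0 \<inter> riemannian_ball \<A> G x0 \<delta> \<inter> \<Lambda> \<and>
        x2 \<in> local_unstable \<A> G f \<epsilon> x0 \<inter> riemannian_ball \<A> G x0 \<delta> \<inter> \<Lambda> \<and>
        corner_set \<A> G f \<epsilon> \<delta> x0 x1 x2 \<noteq> {}}"

definition temporal_range ::
    "('m::topological_space, 'e::euclidean_space) chart set \<Rightarrow> ('m, 'e) metric_tensor
      \<Rightarrow> ('m \<Rightarrow> 'm) \<Rightarrow> 'm set \<Rightarrow> ('m \<Rightarrow> real) \<Rightarrow> real \<Rightarrow> real \<Rightarrow> 'm \<Rightarrow> real set" where
  "temporal_range \<A> G f \<Lambda> r \<epsilon> \<delta> x0 =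
     (\<lambda>(x1, x2). temporal_distance \<A> G f r \<epsilon> \<delta> x0 x1 x2) ` temporal_domain \<A> G f \<Lambda> \<epsilon> \<delta> x0"

end

theory Submission
  imports Defs
begin

text \<open>
The construction takes place in symbolic dynamics. A Cantor set has clopen partitions of
  arbitrarily small mesh. A partition finer than the expansivity scale that comes with the local
  product structure codes the points of \<open>\<Lambda>\<close> injectively by bi-infinite words: the letter at time \<open>i\<close>
  is the partition element of the \<open>i\<close>-th iterate. Points on a common local stable (unstable) manifold
  have the same letters at all times \<open>\<ge> 0\<close> (\<open>\<le> 0\<close>), and the product structure says that two codes that
  agree on a long window around \<open>0\<close> can be glued there, the past of one to the future of the other
  (\<open>cantor_basic_set_coding\<close>, locales \<open>coded_basic_set\<close> and \<open>glued_shift\<close>).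

  Choose words \<open>z t\<close>, values \<open>v t\<close> and a length \<open>L\<close>, and let \<open>r\<close> be, on \<open>\<Lambda>\<close>, a constant plus the sum of
  the \<open>v t\<close> for which the letters of the point at times \<open>-L\<close> to \<open>L\<close> spell \<open>z t\<close>. Then the temporal
  distance is a signed count, with weights \<open>v t\<close>, of the occurrences of the words in the codes of the
  four corners \<open>x\<^sub>0\<close>, \<open>x\<^sub>1\<close>, \<open>x\<^sub>3\<close>, \<open>x\<^sub>2\<close>. Occurrences that do not straddle the origin cancel in pairs, because
  neighbouring corners share their past or their future. So all is reduced to finding words that never
  straddle the origin in the codes of \<open>x\<^sub>0\<close>, \<open>x\<^sub>1\<close>, \<open>x\<^sub>2\<close>, and of which at most one does so, and only once, in
  the code of \<open>x\<^sub>3\<close> (\<open>isolating_words\<close>): the temporal distance is then \<open>0\<close> or one of the \<open>- v t\<close>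
  (\<open>alternating_word_count\<close>).

  Each word is cut out of the code of a corner \<open>x\<^sub>3\<close> whose past and whose future both leave the
  neighbourhood of \<open>x\<^sub>0\<close> for good and are not asymptotic to \<open>x\<^sub>0\<close>. For the future, \<open>escaping_points\<close>
  uses that \<open>x\<^sub>0\<close> is accumulated by its unstable manifold: some deviation from the itinerary of \<open>x\<^sub>0\<close> is
  possible at infinitely many times, and by the pigeonhole principle and a closing argument it can be
  continued periodically. A periodic tail stays away from \<open>x\<^sub>0\<close> unless \<open>x\<^sub>0\<close> is asymptotic to it; in that case
  \<open>x\<^sub>0\<close> itself is eventually periodic, and one closes up instead a loop that goes once around this period
  and then deviates, which is not periodic with the period of \<open>x\<^sub>0\<close>. The past is obtained by reversing
  time. Since such a corner visits the vicinity of \<open>x\<^sub>0\<close> only finitely often, only finitely many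
  positions are possible for an occurrence that straddles the origin, and each unwanted one is
  excluded by taking \<open>L\<close> large. All words have the same past, so that the earliest visit tells their
  translates apart.

  The passage between this combinatorics and the manifold needs two facts. The Riemannian distance
  induces the given topology, in the uniform form of \<open>riemannian_dist_small\<close> and
  \<open>riemannian_dist_separates\<close>; and disjoint compact sets are separated by smooth functions
  (\<open>smooth_urysohn\<close>), so that a locally constant function on \<open>\<Lambda>\<close> extends smoothly.
\<close>


section \<open>Shift spaces with gluing\<close>

text \<open>A shift space in which the past of one sequence and the future of another can be joined whenever
  they agree on a window of radius \<open>m\<close>: an abstract form of a shift of finite type. Closedness is
  closedness in the product topology.\<close>

locale glued_shift =
  fixes X :: "(int \<Rightarrow> 'a) set" and A :: "'a set" and m :: int
  assumes alphabet: "finite A" "\<And>s i. s \<in> X \<Longrightarrow> s i \<in> A"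
    and window: "0 \<le> m"
    and shift: "\<And>s n. s \<in> X \<Longrightarrow> (\<lambda>i. s (i + n)) \<in> X"
    and closed: "\<And>t. (\<And>n. \<exists>s\<in>X. \<forall>i. \<bar>i\<bar> \<le> n \<longrightarrow> s i = t i) \<Longrightarrow> t \<in> X"
    and glue: "\<And>s t. \<lbrakk>s \<in> X; t \<in> X; \<And>i. \<bar>i\<bar> \<le> m \<Longrightarrow> s i = t i\<rbrakk> \<Longrightarrow>
      \<exists>u\<in>X. (\<forall>i\<le>m. u i = s i) \<and> (\<forall>i\<ge>-m. u i = t i)"
begin

lemma glue_at:
  assumes "s \<in> X" "t \<in> X" and agree: "\<And>i. \<bar>i\<bar> \<le> m \<Longrightarrow> s (a + i) = t (b + i)"
  obtains u where "u \<in> X" "\<And>i. i \<le> a + m \<Longrightarrow> u i = s i" "\<And>i. a - m \<le> i \<Longrightarrow> u i = t (i - a + b)"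
proof -
  have "(\<lambda>i. s (i + a)) \<in> X" "(\<lambda>i. t (i + b)) \<in> X"
    using assms by (auto intro: shift)
  from glue[OF this] agree obtain u where u: "u \<in> X"
    and l: "\<And>i. i \<le> m \<Longrightarrow> u i = s (i + a)" and r: "\<And>i. -m \<le> i \<Longrightarrow> u i = t (i + b)"
    by (auto simp: add.commute)
  show thesis
  proof
    show "(\<lambda>i. u (i + (- a))) \<in> X" using u by (rule shift)
  qed (use l r in auto)
qed

text \<open>A block of radius \<open>m\<close> that occurs twice allows the segment between the two occurrences to be repeated
  for ever: gluing the sequence to itself \<open>n\<close> times gives the periodic tail up to a time that grows
  with \<open>n\<close>, and closedness gives the limit.\<close>

lemma closing:
  assumes s: "s \<in> X" and ab: "a < b" and agree: "\<And>i. \<bar>i\<bar> \<le> m \<Longrightarrow> s (a + i) = s (b + i)"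
  obtains u where "u \<in> X" "\<And>i. i \<le> b + m \<Longrightarrow> u i = s i"
    "\<And>i. a - m \<le> i \<Longrightarrow> u (i + (b - a)) = u i"
proof -
  define p where "p = b - a"
  have p: "p > 0" using ab by (simp add: p_def)
  \<comment> \<open>The period is read off the segment that ends at \<open>b + m\<close>, so that both clauses agree there.\<close>
  define t where "t i = (if i \<le> b + m then s i else s (a + m + 1 + (i - (a + m + 1)) mod p))" for i
  have t_left: "t i = s i" if "i \<le> b + m" for i using that by (simp add: t_def)
  have t_right: "t i = s (a + m + 1 + (i - (a + m + 1)) mod p)" if "a + m < i" for i
  proof (cases "i \<le> b + m")
    case True
    then have "(i - (a + m + 1)) mod p = i - (a + m + 1)"
      using that by (intro mod_pos_pos_trivial) (auto simp: p_def)
    then show ?thesis using True by (simp add: t_def)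
  qed (simp add: t_def)
  have t_per: "t (i + p) = t i" if "a - m \<le> i" for i
  proof (cases "i \<le> a + m")
    case True
    then have "s (a + (i - a)) = s (b + (i - a))" using that by (intro agree) auto
    then show ?thesis using True ab by (simp add: t_left p_def algebra_simps)
  next
    case False
    moreover have "i + p - (a + m + 1) = (i - (a + m + 1)) + p" by simp
    ultimately show ?thesis using p by (simp only: t_right mod_add_self2)
  qed
  have approx: "\<exists>u\<in>X. \<forall>i\<le>b + m + int n * p. u i = t i" for n
  proof (induction n)
    case 0
    then show ?case using s t_left by auto
  next
    case (Suc n)
    then obtain u where u: "u \<in> X" "\<And>i. i \<le> b + m + int n * p \<Longrightarrow> u i = t i" by blast
    have "s (b + i) = u (a + i)" if "\<bar>i\<bar> \<le> m" for i
    proof -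
      have "a + i \<le> b + m" using that ab by auto
      moreover have "0 \<le> int n * p" using p by simp
      ultimately have "u (a + i) = s (a + i)" using u(2) t_left by auto
      then show ?thesis using agree[OF that] by simp
    qed
    from glue_at[OF s u(1) this] obtain w where w: "w \<in> X" "\<And>i. i \<le> b + m \<Longrightarrow> w i = s i"
      "\<And>i. b - m \<le> i \<Longrightarrow> w i = u (i - b + a)" by blast
    have "w i = t i" if "i \<le> b + m + int (Suc n) * p" for i
    proof (cases "i \<le> b + m")
      case False
      then have "w i = u (i - p)" using w(3)[of i] window by (simp add: p_def algebra_simps)
      also have "\<dots> = t (i - p)" using that by (intro u(2)) (simp add: algebra_simps)
      also have "\<dots> = t i" using t_per[of "i - p"] False window by (simp add: p_def)
      finally show ?thesis .
    qed (simp add: w t_left)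
    then show ?case using w(1) by blast
  qed
  have "t \<in> X"
  proof (rule closed)
    fix n
    obtain u where u: "u \<in> X" "\<And>i. i \<le> b + m + int (nat (n - b - m)) * p \<Longrightarrow> u i = t i"
      using approx by blast
    have "n \<le> b + m + int (nat (n - b - m)) * p"
    proof -
      have "int (nat (n - b - m)) * 1 \<le> int (nat (n - b - m)) * p" 
        using p by (intro mult_left_mono) auto
      then show ?thesis by linarith
    qed
    then have "\<forall>i. \<bar>i\<bar> \<le> n \<longrightarrow> u i = t i" using u(2) by auto
    then show "\<exists>s\<in>X. \<forall>i. \<bar>i\<bar> \<le> n \<longrightarrow> s i = t i" using u(1) by blast
  qed
  then show thesis using that t_left t_per unfolding p_def by blast
qed

end

text \<open>Asymptotic to some translate: \<open>y\<close> lies on the stable set of the whole orbit of \<open>s\<close>.\<close>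

definition right_asymptotic :: "(int \<Rightarrow> 'a) \<Rightarrow> (int \<Rightarrow> 'a) \<Rightarrow> bool" where
  "right_asymptotic y s \<longleftrightarrow> (\<exists>n N. \<forall>i\<ge>N. y (i + n) = s i)"

text \<open>The sequences that agree with \<open>s\<close> on \<open>{-k..k}\<close> form a neighbourhood of \<open>s\<close>; from some time on the orbit
  of \<open>y\<close> is outside of it.\<close>

definition eventually_avoids :: "int \<Rightarrow> (int \<Rightarrow> 'a) \<Rightarrow> (int \<Rightarrow> 'a) \<Rightarrow> bool" where
  "eventually_avoids k s y \<longleftrightarrow> (\<exists>n. \<forall>j\<ge>n. \<exists>i. \<bar>i\<bar> \<le> k \<and> y (j + i) \<noteq> s i)"

text \<open>The orbit of a periodic tail accumulates only on a periodic orbit. If it came back to every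
  neighbourhood of \<open>s\<close>, then \<open>s\<close> would be on that periodic orbit.\<close>

lemma periodic_tail_avoids:
  fixes v s :: "int \<Rightarrow> 'a"
  assumes p: "0 < p" and per: "\<And>i. N \<le> i \<Longrightarrow> v (i + p) = v i" and na: "\<not> right_asymptotic v s"
  obtains k where "eventually_avoids k s v"
proof (rule ccontr)
  assume "\<not> thesis"
  then have "\<not> eventually_avoids k s v" for k using that by blast
  then have vis: "\<exists>j\<ge>n. \<forall>i. \<bar>i\<bar> \<le> k \<longrightarrow> v (j + i) = s i" for k n
    unfolding eventually_avoids_def by (metis (mono_tags))
  have s_per: "s (i + p) = s i" for i
  proof -
    obtain j where j: "N + \<bar>i\<bar> \<le> j" "\<And>l. \<bar>l\<bar> \<le> \<bar>i\<bar> + p \<Longrightarrow> v (j + l) = s l"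
      using vis[of "N + \<bar>i\<bar>" "\<bar>i\<bar> + p"] by blast
    have "s (i + p) = v (j + (i + p))" using p by (intro j(2)[symmetric]) auto
    also have "\<dots> = v (j + i)" using per[of "j + i"] j(1) by (simp add: add.assoc)
    also have "\<dots> = s i" using p by (intro j(2)) auto
    finally show ?thesis .
  qed
  obtain j where j: "N \<le> j" "\<And>l. \<bar>l\<bar> \<le> p \<Longrightarrow> v (j + l) = s l"
    using vis[of N p] by blast
  have "v (j + int l) = s (int l)" for l
  proof (induction l rule: less_induct)
    case (less l)
    show ?case
    proof (cases "int l \<le> p")
      case False
      define l' where "l' = l - nat p"
      have l': "l' < l" "int l = int l' + p" using False p by (auto simp: l'_def)
      have "v (j + int l) = v (j + int l' + p)" by (simp add: l' add.assoc)
      also have "\<dots> = v (j + int l')" using j(1) by (intro per) auto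
      also have "\<dots> = s (int l)" using less l' s_per by simp
      finally show ?thesis .
    qed (use j(2) p in auto)
  qed
  then have "\<forall>i\<ge>0. v (i + j) = s i" by (metis add.commute nonneg_int_cases)
  then show False using na unfolding right_asymptotic_def by blast
qed

context glued_shift begin

lemma finite_words: "finite ((\<lambda>k. map (u k) [c..d]) ` K)" if "\<And>k i. k \<in> K \<Longrightarrow> u k i \<in> A"
proof (rule finite_subset)
  show "(\<lambda>k. map (u k) [c..d]) ` K \<subseteq> {xs. set xs \<subseteq> A \<and> length xs = length [c..d]}"
    using that by auto
  show "finite \<dots>" using alphabet(1) by (rule finite_lists_length_eq)
qed

text \<open>If \<open>s\<close> can be left at arbitrarily late times, then by the pigeonhole principle infinitely many of these
  departures look the same: the same block of length \<open>2 m + 1\<close> before and the same deviating letter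
  afterwards. A single \<open>v\<close> therefore describes them all, the departure being placed at time \<open>0\<close>.\<close>

lemma recurrent_branch:
  assumes nonisol: "\<And>K. \<exists>y\<in>X. (\<forall>i\<le>K. y i = s i) \<and> y \<noteq> s"
  obtains v where "v \<in> X"
    "\<And>K. \<exists>b\<ge>K. (\<forall>i. -2 * m \<le> i \<and> i \<le> 0 \<longrightarrow> s (b + i) = v i) \<and> v 1 \<noteq> s (b + 1)"
proof -
  have "\<exists>y b. y \<in> X \<and> int K \<le> b \<and> (\<forall>i\<le>b. y i = s i) \<and> y (b + 1) \<noteq> s (b + 1)" for K
  proof -
    obtain y where y: "y \<in> X" "\<And>i. i \<le> int K \<Longrightarrow> y i = s i" "y \<noteq> s" using nonisol by blast
    then obtain i0 where i0: "y i0 \<noteq> s i0" by blast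
    define d where "d = (LEAST d. y (int K + 1 + int d) \<noteq> s (int K + 1 + int d))"
    have "i0 > int K" using y(2) i0 not_le by blast
    then have "y (int K + 1 + int (nat (i0 - int K - 1))) \<noteq> s (int K + 1 + int (nat (i0 - int K - 1)))"
      using i0 by simp
    then have d: "y (int K + 1 + int d) \<noteq> s (int K + 1 + int d)"
      unfolding d_def by (rule LeastI)
    have "y i = s i" if "i \<le> int K + int d" for i
    proof (cases "i \<le> int K")
      case False
      then have "nat (i - int K - 1) < d" using that by simp
      from not_less_Least[OF this[unfolded d_def]] show ?thesis using False by simp
    qed (use y in auto)
    then show ?thesis using y(1) d
      by (intro exI[of _ y] exI[of _ "int K + int d"]) (auto simp: algebra_simps)
  qed
  then obtain y b where yb: "\<And>K. y K \<in> X" "\<And>K. int K \<le> b K" "\<And>K i. i \<le> b K \<Longrightarrow> y K i = s i"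
    "\<And>K. y K (b K + 1) \<noteq> s (b K + 1)" by metis
  define F where "F K = map (\<lambda>i. y K (b K + i)) [-2 * m..1]" for K
  have "finite (range F)" unfolding F_def using yb(1) alphabet(2) by (intro finite_words) auto
  then obtain K0 where "infinite {K. F K = F K0}"
    using pigeonhole_infinite[of UNIV F] by auto
  then have inf: "\<exists>K\<ge>n. F K = F K0" for n
    by (metis (mono_tags, lifting) finite_nat_set_iff_bounded_le mem_Collect_eq nle_le)
  show thesis
  proof
    show "(\<lambda>i. y K0 (i + b K0)) \<in> X" using yb(1) by (rule shift)
    fix K
    obtain K' where K': "nat K \<le> K'" "F K' = F K0" using inf by blast
    have eq: "y K' (b K' + i) = y K0 (b K0 + i)" if "-2 * m \<le> i" "i \<le> 1" for i
      using K'(2) that unfolding F_def by (simp add: map_eq_conv)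
    have "K \<le> b K'" using K'(1) yb(2)[of K'] by linarith
    moreover have "\<forall>i. -2 * m \<le> i \<and> i \<le> 0 \<longrightarrow> s (b K' + i) = y K0 (i + b K0)"
    proof (intro allI impI)
      fix i assume i: "-2 * m \<le> i \<and> i \<le> 0"
      have "s (b K' + i) = y K' (b K' + i)" using i yb(3)[of "b K' + i" K'] by simp
      also have "\<dots> = y K0 (b K0 + i)" using i by (intro eq) auto
      finally show "s (b K' + i) = y K0 (i + b K0)" by (simp add: add.commute)
    qed
    moreover have "y K0 (1 + b K0) \<noteq> s (b K' + 1)"
      using eq[of 1] yb(4)[of K'] window by (simp add: add.commute)
    ultimately show "\<exists>b'\<ge>K. (\<forall>i. -2 * m \<le> i \<and> i \<le> 0 \<longrightarrow> s (b' + i) = y K0 (i + b K0)) \<and>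
        y K0 (1 + b K0) \<noteq> s (b' + 1)" by blast
  qed
qed

lemma periodic_continuation:
  assumes v: "v \<in> X"
  obtains u p N where "u \<in> X" "\<And>i. i \<le> n \<Longrightarrow> u i = v i" "0 < p" "\<And>i. N \<le> i \<Longrightarrow> u (i + p) = u i"
proof -
  define F where "F k = map (\<lambda>i. v (n + int k + i)) [-m..m]" for k
  have "finite (range F)" unfolding F_def using v alphabet(2) by (intro finite_words) auto
  then obtain k0 where "infinite {k. F k = F k0}"
    using pigeonhole_infinite[of UNIV F] by auto
  then obtain k1 where k1: "k1 > k0" "F k1 = F k0"
    by (metis (mono_tags, lifting) finite_nat_set_iff_bounded_le mem_Collect_eq not_le)
  have "v (n + int k0 + i) = v (n + int k1 + i)" if "\<bar>i\<bar> \<le> m" for i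
  proof -
    have "\<forall>i\<in>{-m..m}. v (n + int k1 + i) = v (n + int k0 + i)"
      using k1(2) unfolding F_def by (simp add: map_eq_conv)
    moreover have "i \<in> {-m..m}" using that by auto
    ultimately show ?thesis by (metis (no_types))
  qed
  from closing[OF v _ this] k1(1) obtain u where "u \<in> X" "\<And>i. i \<le> n + int k1 + m \<Longrightarrow> u i = v i"
    "\<And>i. n + int k0 - m \<le> i \<Longrightarrow> u (i + (n + int k1 - (n + int k0))) = u i" by auto
  then show thesis using window k1(1)
    by (intro that[of u "int k1 - int k0" "n + int k0 - m"]) auto
qed

text \<open>The deviation \<open>v0\<close>, continued periodically to \<open>v\<close>, serves unless \<open>v\<close> is asymptotic to \<open>s\<close>. In that case \<open>s\<close> is
  eventually periodic with the period \<open>p\<close> of \<open>v\<close>, and the orbit \<open>q\<close> that deviates from \<open>s\<close> at a late time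
  \<open>b\<close> returns to the periodic part of \<open>s\<close>. The loop of \<open>q\<close> that starts one period before \<open>b\<close> can be closed.
  The resulting tail is not eventually \<open>p\<close>-periodic, since in each round the letter at the departure
  differs from the one \<open>p\<close> steps earlier; hence it is not asymptotic to \<open>s\<close>.\<close>

lemma escaping_tail:
  assumes s: "s \<in> X" and nonisol: "\<And>K. \<exists>y\<in>X. (\<forall>i\<le>K. y i = s i) \<and> y \<noteq> s"
  obtains v p N where "v \<in> X" "0 < p" "\<And>i. N \<le> i \<Longrightarrow> v (i + p) = v i" "\<not> right_asymptotic v s"
    "\<And>K. \<exists>b\<ge>K. \<forall>i. -2 * m \<le> i \<and> i \<le> 0 \<longrightarrow> s (b + i) = v i"
proof -
  obtain v0 where v0: "v0 \<in> X"
    and b0: "\<And>K. \<exists>b\<ge>K. (\<forall>i. -2 * m \<le> i \<and> i \<le> 0 \<longrightarrow> s (b + i) = v0 i) \<and> v0 1 \<noteq> s (b + 1)"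
    using recurrent_branch[OF nonisol] by blast
  obtain v p N where v: "v \<in> X" "\<And>i. i \<le> 1 \<Longrightarrow> v i = v0 i" "0 < p"
    "\<And>i. N \<le> i \<Longrightarrow> v (i + p) = v i" by (rule periodic_continuation[OF v0, of 1]) blast
  have branch: "\<exists>b\<ge>K. (\<forall>i. -2 * m \<le> i \<and> i \<le> 0 \<longrightarrow> s (b + i) = v i) \<and> v 1 \<noteq> s (b + 1)" for K
    using b0[of K] v(2) by auto
  show thesis
  proof (cases "right_asymptotic v s")
    case False
    then show thesis using v branch by (intro that[of v p N]) blast+
  next
    case True
    then obtain n N' where as: "\<And>i. N' \<le> i \<Longrightarrow> v (i + n) = s i"
      unfolding right_asymptotic_def by blast
    define M where "M = max N' (N - n)"
    have s_per: "s (i + p) = s i" if "M \<le> i" for i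
      using as[of i] as[of "i + p"] v(3) v(4)[of "i + n"] that by (simp add: M_def algebra_simps)
    have s_per': "s (i + int t * p) = s i" if "M \<le> i" for i t
    proof (induction t)
      case (Suc t)
      have "s (i + int (Suc t) * p) = s (i + int t * p + p)" by (simp add: algebra_simps)
      also have "\<dots> = s (i + int t * p)" using that v(3) by (intro s_per) (simp add: add_increasing2)
      finally show ?case using Suc by simp
    qed simp
    obtain b where b: "M + 2 * m + p \<le> b" "\<And>i. -2 * m \<le> i \<Longrightarrow> i \<le> 0 \<Longrightarrow> s (b + i) = v i"
      "v 1 \<noteq> s (b + 1)" using branch[of "M + 2 * m + p"] by blast
    have "s (b - m + i) = v (-m + i)" if "\<bar>i\<bar> \<le> m" for i
      using b(2)[of "-m + i"] that by (simp add: algebra_simps)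
    from glue_at[OF s v(1) this] obtain q where q: "q \<in> X" "\<And>i. i \<le> b \<Longrightarrow> q i = s i"
      "\<And>i. b - 2 * m \<le> i \<Longrightarrow> q i = v (i - b)" by (auto simp: algebra_simps)
    \<comment> \<open>At time \<open>c\<close> the orbit \<open>q\<close> has returned to the periodic tail, in the phase that \<open>s\<close> has at
      time \<open>b - m\<close>; the summand \<open>T * p\<close> only makes \<open>c\<close> late enough.\<close>
    define T where "T = nat (\<bar>n\<bar> + \<bar>b\<bar> + \<bar>N'\<bar>) + 1"
    define a where "a = b - m - p"
    define c where "c = 2 * b + n - m + int T * p"
    have T: "int T = \<bar>n\<bar> + \<bar>b\<bar> + \<bar>N'\<bar> + 1" by (simp add: T_def)
    have Tp: "int T \<le> int T * p" using v(3) mult_left_mono[of 1 p "int T"] by simp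
    have ac: "a < c" unfolding a_def c_def using Tp T v(3) by linarith
    have qs: "q (c + i) = s (b - m + i)" if "\<bar>i\<bar> \<le> m" for i
    proof -
      have "q (c + i) = v (c + i - b)"
        using that Tp T unfolding c_def by (intro q(3)) linarith
      also have "\<dots> = v (b - m + i + int T * p + n)" by (simp add: c_def algebra_simps)
      also have "\<dots> = s (b - m + i + int T * p)"
        using that Tp T b(1) v(3) unfolding M_def by (intro as) linarith
      also have "\<dots> = s (b - m + i)" using that b(1) v(3) by (intro s_per') simp
      finally show ?thesis .
    qed
    have "q (a + i) = q (c + i)" if "\<bar>i\<bar> \<le> m" for i
    proof -
      have "q (a + i) = s (a + i)" using that v(3) by (intro q(2)) (simp add: a_def)
      also have "\<dots> = s (a + i + p)" using that b(1) by (intro s_per[symmetric]) (simp add: a_def)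
      also have "\<dots> = q (c + i)" using qs[OF that] by (simp add: a_def algebra_simps)
      finally show ?thesis .
    qed
    from closing[OF q(1) ac this] obtain u where u: "u \<in> X" "\<And>i. i \<le> c + m \<Longrightarrow> u i = q i"
      "\<And>i. a - m \<le> i \<Longrightarrow> u (i + (c - a)) = u i" by blast
    have bc: "b + 1 \<le> c + m" unfolding c_def using Tp T v(3) by linarith
    have ub: "u i = s i" if "i \<le> b" for i using u(2) q(2) bc that by simp
    have "u (b + 1) = q (b + 1)" using bc by (intro u(2))
    also have "\<dots> = v 1" using q(3)[of "b + 1"] window by simp
    also have "\<dots> \<noteq> s (b + 1)" by (rule b(3))
    also have "s (b + 1) = s (b + 1 - p)" using s_per[of "b + 1 - p"] b(1) window by simp
    also have "s (b + 1 - p) = u (b + 1 - p)" using ub[of "b + 1 - p"] v(3) by simp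
    finally have ne: "u (b + 1) \<noteq> u (b + 1 - p)" .
    have u_per: "u (i + int t * (c - a)) = u i" if "a - m \<le> i" for i t
    proof (induction t)
      case (Suc t)
      have "u (i + int (Suc t) * (c - a)) = u (i + int t * (c - a) + (c - a))" by (simp add: algebra_simps)
      also have "\<dots> = u (i + int t * (c - a))" using that ac by (intro u(3)) (simp add: add_increasing2)
      finally show ?case using Suc by simp
    qed simp
    have na: "\<not> right_asymptotic u s"
    proof
      assume "right_asymptotic u s"
      then obtain n2 N2 where as2: "\<And>i. N2 \<le> i \<Longrightarrow> u (i + n2) = s i"
        unfolding right_asymptotic_def by blast
      define t where "t = nat (\<bar>N2\<bar> + \<bar>n2\<bar> + \<bar>M\<bar> + \<bar>b\<bar> + p)"
      have tp: "int t \<le> int t * (c - a)" using ac mult_left_mono[of 1 "c - a" "int t"] by simp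
      have T': "int t = \<bar>N2\<bar> + \<bar>n2\<bar> + \<bar>M\<bar> + \<bar>b\<bar> + p" using v(3) by (simp add: t_def)
      define j where "j = b + 1 - p + int t * (c - a) - n2"
      have j: "N2 \<le> j" "M \<le> j" using tp T' v(3) unfolding j_def by linarith+
      have "u (b + 1) = u (b + 1 + int t * (c - a))"
        using window v(3) by (intro u_per[symmetric]) (simp add: a_def)
      also have "\<dots> = u (j + p + n2)" by (simp add: j_def algebra_simps)
      also have "\<dots> = s (j + p)" using j v(3) by (intro as2) simp
      also have "\<dots> = s j" using j by (intro s_per)
      also have "\<dots> = u (j + n2)" using j by (intro as2[symmetric])
      also have "\<dots> = u (b + 1 - p + int t * (c - a))" by (simp add: j_def)
      also have "\<dots> = u (b + 1 - p)" using window by (intro u_per) (simp add: a_def)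
      finally show False using ne by simp
    qed
    define w where "w i = u (i + b)" for i
    show thesis
    proof (rule that[of w "c - a" "a - m - b"])
      show "w \<in> X" unfolding w_def using u(1) by (rule shift)
      show "0 < c - a" using ac by simp
      show "w (i + (c - a)) = w i" if "a - m - b \<le> i" for i
        using u(3)[of "i + b"] that by (simp add: w_def algebra_simps)
      show "\<not> right_asymptotic w s"
        using na unfolding right_asymptotic_def w_def by (simp add: add.assoc)
      show "\<exists>b'\<ge>K. \<forall>i. -2 * m \<le> i \<and> i \<le> 0 \<longrightarrow> s (b' + i) = w i" for K
      proof -
        obtain b' where b': "K \<le> b'" "\<And>i. -2 * m \<le> i \<Longrightarrow> i \<le> 0 \<Longrightarrow> s (b' + i) = v i"
          using branch[of K] by blast
        have "s (b' + i) = w i" if "-2 * m \<le> i" "i \<le> 0" for i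
          using b'(2)[OF that] b(2)[OF that] ub[of "b + i"] that by (simp add: w_def add.commute)
        then show ?thesis using b'(1) by blast
      qed
    qed
  qed
qed

text \<open>The tail found before is attached to \<open>s\<close> at one of the infinitely many places where its initial block
  occurs. The number \<open>k\<close> depends on the tail alone, hence is the same for all \<open>K\<close>.\<close>

lemma escaping_points:
  assumes s: "s \<in> X" and nonisol: "\<And>K. \<exists>y\<in>X. (\<forall>i\<le>K. y i = s i) \<and> y \<noteq> s"
  obtains k where "\<And>K. \<exists>y\<in>X. (\<forall>i\<le>K. y i = s i) \<and> eventually_avoids k s y \<and> \<not> right_asymptotic y s"
proof -
  obtain v p N where v: "v \<in> X" "0 < p" "\<And>i. N \<le> i \<Longrightarrow> v (i + p) = v i" "\<not> right_asymptotic v s"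
    "\<And>K. \<exists>b\<ge>K. \<forall>i. -2 * m \<le> i \<and> i \<le> 0 \<longrightarrow> s (b + i) = v i"
    by (rule escaping_tail[OF s nonisol]) blast
  obtain k n where kn: "\<And>j. n \<le> j \<Longrightarrow> \<exists>i. \<bar>i\<bar> \<le> k \<and> v (j + i) \<noteq> s i"
    using periodic_tail_avoids[OF v(2,3,4)] unfolding eventually_avoids_def by metis
  show thesis
  proof (rule that[of k])
    fix K
    obtain b where b: "K \<le> b" "\<And>i. -2 * m \<le> i \<Longrightarrow> i \<le> 0 \<Longrightarrow> s (b + i) = v i" using v(5) by blast
    have "s (b - m + i) = v (-m + i)" if "\<bar>i\<bar> \<le> m" for i
      using b(2)[of "-m + i"] that by (simp add: algebra_simps)
    from glue_at[OF s v(1) this] obtain y where y: "y \<in> X" "\<And>i. i \<le> b \<Longrightarrow> y i = s i"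
      "\<And>i. b - 2 * m \<le> i \<Longrightarrow> y i = v (i - b)" by (auto simp: algebra_simps)
    have "eventually_avoids k s y" unfolding eventually_avoids_def
    proof (rule exI, intro allI impI)
      fix j assume j: "max (n + b) (b - 2 * m + k) \<le> j"
      then obtain i where i: "\<bar>i\<bar> \<le> k" "v (j - b + i) \<noteq> s i" using kn[of "j - b"] by auto
      have "y (j + i) = v (j + i - b)" using i j by (intro y(3)) linarith
      then have "y (j + i) \<noteq> s i" using i(2) by (simp add: algebra_simps)
      then show "\<exists>i. \<bar>i\<bar> \<le> k \<and> y (j + i) \<noteq> s i" using i(1) by blast
    qed
    moreover have "\<not> right_asymptotic y s"
    proof
      assume "right_asymptotic y s"
      then obtain n N where nN: "\<And>i. N \<le> i \<Longrightarrow> y (i + n) = s i" unfolding right_asymptotic_def by blast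
      have "v (i + (n - b)) = s i" if "max N (b - 2 * m - n) \<le> i" for i
        using nN[of i] y(3)[of "i + n"] that by (simp add: algebra_simps)
      then show False using v(4) unfolding right_asymptotic_def by blast
    qed
    ultimately show "\<exists>y\<in>X. (\<forall>i\<le>K. y i = s i) \<and> eventually_avoids k s y \<and> \<not> right_asymptotic y s"
      using y(1) y(2) b(1) order_trans by blast
  qed
qed

text \<open>The preceding lemma for the space of reversed sequences.\<close>

lemma escaping_points_left:
  assumes s: "s \<in> X" and nonisol: "\<And>K. \<exists>y\<in>X. (\<forall>i\<ge>-K. y i = s i) \<and> y \<noteq> s"
  obtains k where "\<And>K. \<exists>y\<in>X. (\<forall>i\<ge>-K. y i = s i) \<and>
    eventually_avoids k (\<lambda>i. s (- i)) (\<lambda>i. y (- i)) \<and>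
    \<not> right_asymptotic (\<lambda>i. y (- i)) (\<lambda>i. s (- i))"
proof -
  define R where "R s i = s (- i)" for s :: "int \<Rightarrow> 'a" and i
  have RR [simp]: "R (R s) = s" for s by (simp add: R_def fun_eq_iff)
  have mem: "x \<in> R ` X \<longleftrightarrow> R x \<in> X" for x by (metis RR image_iff)
  interpret rev: glued_shift "R ` X" A m
  proof
    show "(\<lambda>i. x (i + n)) \<in> R ` X" if "x \<in> R ` X" for x n
    proof -
      have "(\<lambda>i. (R x) (i + - n)) \<in> X" using that by (intro shift) (simp add: mem)
      moreover have "R (\<lambda>i. x (i + n)) = (\<lambda>i. (R x) (i + - n))" by (simp add: R_def fun_eq_iff)
      ultimately show ?thesis unfolding mem by simp
    qed
    show "t \<in> R ` X" if approx: "\<And>n. \<exists>x\<in>R ` X. \<forall>i. \<bar>i\<bar> \<le> n \<longrightarrow> x i = t i" for t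
      unfolding mem[of t]
    proof (rule closed)
      fix n
      obtain x where x: "x \<in> R ` X" "\<forall>i. \<bar>i\<bar> \<le> n \<longrightarrow> x i = t i" using approx[of n] by blast
      have "\<forall>i. \<bar>i\<bar> \<le> n \<longrightarrow> R x i = R t i" using x(2) by (simp add: R_def)
      then show "\<exists>x\<in>X. \<forall>i. \<bar>i\<bar> \<le> n \<longrightarrow> x i = R t i" using x(1)[unfolded mem[of x]] by blast
    qed
    show "\<exists>u\<in>R ` X. (\<forall>i\<le>m. u i = x i) \<and> (\<forall>i\<ge>-m. u i = t i)"
      if "x \<in> R ` X" "t \<in> R ` X" "\<And>i. \<bar>i\<bar> \<le> m \<Longrightarrow> x i = t i" for x t
    proof -
      have "\<exists>u\<in>X. (\<forall>i\<le>m. u i = R t i) \<and> (\<forall>i\<ge>-m. u i = R x i)"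
        using that by (intro glue) (simp_all add: mem, simp add: R_def)
      then obtain u where u: "u \<in> X" "\<And>i. i \<le> m \<Longrightarrow> u i = R t i" "\<And>i. -m \<le> i \<Longrightarrow> u i = R x i"
        by blast
      have "(\<forall>i\<le>m. R u i = x i) \<and> (\<forall>i\<ge>-m. R u i = t i)"
        using u(2)[of "- i" for i] u(3)[of "- i" for i] by (simp add: R_def)
      moreover have "R u \<in> R ` X" using u(1) by simp
      ultimately show ?thesis by blast
    qed
  qed (use alphabet window in \<open>auto simp: R_def\<close>)
  have "\<exists>y\<in>R ` X. (\<forall>i\<le>K. y i = R s i) \<and> y \<noteq> R s" for K
  proof -
    obtain y where y: "y \<in> X" "\<forall>i\<ge>-K. y i = s i" "y \<noteq> s" using nonisol by blast
    have "R y \<noteq> R s" using y(3) RR by metis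
    then show ?thesis using y(1,2) by (intro bexI[of _ "R y"]) (auto simp: R_def)
  qed
  then obtain k where k: "\<And>K. \<exists>y\<in>R ` X. (\<forall>i\<le>K. y i = R s i) \<and> eventually_avoids k (R s) y \<and>
    \<not> right_asymptotic y (R s)"
    using rev.escaping_points[of "R s"] s by (metis imageI)
  show thesis
  proof (rule that)
    fix K
    obtain y where y: "R y \<in> X" "\<And>i. i \<le> K \<Longrightarrow> y i = R s i" "eventually_avoids k (R s) y"
      "\<not> right_asymptotic y (R s)" using k[of K] unfolding mem[symmetric] by auto
    have "R y i = s i" if "-K \<le> i" for i using y(2)[of "- i"] that by (simp add: R_def)
    moreover have "(\<lambda>i. R y (- i)) = y" "(\<lambda>i. s (- i)) = R s" by (simp_all add: R_def fun_eq_iff)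
    ultimately show "\<exists>y\<in>X. (\<forall>i\<ge>-K. y i = s i) \<and>
      eventually_avoids k (\<lambda>i. s (- i)) (\<lambda>i. y (- i)) \<and>
      \<not> right_asymptotic (\<lambda>i. y (- i)) (\<lambda>i. s (- i))" using y by (intro bexI[of _ "R y"]) auto
  qed
qed

end

lemma eventually_avoids_mono: "eventually_avoids k s y \<Longrightarrow> k \<le> k' \<Longrightarrow> eventually_avoids k' s y"
  unfolding eventually_avoids_def by (meson order_trans)

text \<open>Sequences serve as words: only the letters of \<open>w\<close> at times \<open>-L\<close> to \<open>L\<close> matter, and the position of an
  occurrence is its centre.\<close>

definition occurs_at :: "int \<Rightarrow> (int \<Rightarrow> 'a) \<Rightarrow> (int \<Rightarrow> 'a) \<Rightarrow> int \<Rightarrow> bool" where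
  "occurs_at L w x n \<longleftrightarrow> (\<forall>i. \<bar>i\<bar> \<le> L \<longrightarrow> x (n + i) = w i)"

text \<open>No word occurs across the window of radius \<open>k\<close> in a sequence with the past or the future of \<open>s\<close>, and in
  any sequence through this window at most one word does, at one position. For \<open>\<bar>n\<bar> \<le> L - k\<close> an
  occurrence at \<open>n\<close> covers the window.\<close>

definition isolating :: "int \<Rightarrow> int \<Rightarrow> (int \<Rightarrow> 'a) \<Rightarrow> nat \<Rightarrow> (nat \<Rightarrow> int \<Rightarrow> 'a) \<Rightarrow> bool" where
  "isolating k L s N z \<longleftrightarrow>
    (\<forall>t<N. \<forall>x n. \<bar>n\<bar> \<le> L - k \<longrightarrow> (\<forall>i\<ge>-k. x i = s i) \<or> (\<forall>i\<le>k. x i = s i) \<longrightarrow>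
      \<not> occurs_at L (z t) x n) \<and>
    (\<forall>t<N. \<forall>t'<N. \<forall>x n n'. \<bar>n\<bar> \<le> L - k \<longrightarrow> \<bar>n'\<bar> \<le> L - k \<longrightarrow> (\<forall>i. \<bar>i\<bar> \<le> k \<longrightarrow> x i = s i) \<longrightarrow>
      occurs_at L (z t) x n \<longrightarrow> occurs_at L (z t') x n' \<longrightarrow> t = t' \<and> n = n')"

text \<open>Two sequences that differ somewhere differ within every sufficiently long window. The two centres
  account for words at different positions.\<close>

lemma eventually_window:
  fixes l :: int
  assumes "P l"
  shows "eventually (\<lambda>L. \<exists>l. P l \<and> \<bar>l - n\<bar> \<le> L \<and> \<bar>l - n'\<bar> \<le> L) at_top"
  using eventually_ge_at_top[of "\<bar>l - n\<bar> + \<bar>l - n'\<bar>"]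
  by eventually_elim (intro exI[of _ l], use assms in auto)

context glued_shift begin

text \<open>Each such \<open>y\<close> differs from \<open>s\<close> somewhere, and a further one can be found that agrees with \<open>s\<close> beyond the
  differences of any finite number of them.\<close>

lemma infinite_escaping:
  assumes s: "s \<in> X" 
    and k: "\<And>K. \<exists>y\<in>X. (\<forall>i\<le>K. y i = s i) \<and> eventually_avoids k s y \<and> \<not> right_asymptotic y s"
  shows "infinite {y\<in>X. (\<forall>i\<le>K. y i = s i) \<and> eventually_avoids k s y \<and> \<not> right_asymptotic y s}"
    (is "infinite ?Y")
proof
  assume fin: "finite ?Y"
  have "\<exists>d. y d \<noteq> s d" if "y \<in> ?Y" for y
  proof (rule ccontr)
    assume "\<not> ?thesis"
    then have "y (i + 0) = s i" for i by simp
    then have "right_asymptotic y s" unfolding right_asymptotic_def by blast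
    then show False using that by simp
  qed
  then have "\<forall>y\<in>?Y. \<exists>d. y d \<noteq> s d" by blast
  from bchoice[OF this] obtain d where d: "\<And>y. y \<in> ?Y \<Longrightarrow> y (d y) \<noteq> s (d y)" by blast
  define M where "M = Max (insert K (d ` ?Y))"
  have M: "K \<le> M" "\<And>y. y \<in> ?Y \<Longrightarrow> d y \<le> M" using fin by (auto simp: M_def)
  obtain y where y: "y \<in> X" "\<And>i. i \<le> M \<Longrightarrow> y i = s i" "eventually_avoids k s y" "\<not> right_asymptotic y s"
    using k[of M] by blast
  then have "y \<in> ?Y" using M(1) by auto
  then show False using y(2) d M(2) by blast
qed

end


context glued_shift begin

text \<open>The words are obtained by gluing one past \<open>p\<close> to different futures \<open>q\<close>, all of which escape from \<open>s\<close>. In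
  the application \<open>s\<close> is the code of \<open>x\<^sub>0\<close>, \<open>p\<close> that of \<open>x\<^sub>1\<close>, \<open>q\<close> that of \<open>x\<^sub>2\<close> and \<open>z t\<close> that of \<open>x\<^sub>3\<close>. As \<open>z t\<close>
  agrees with \<open>s\<close> on a window of radius \<open>k\<close> at finitely many times only, the position of an occurrence that
  covers such a window is bounded independently of \<open>L\<close>, and \<open>L\<close> can be chosen so large that each of the
  finitely many remaining coincidences is refuted.\<close>

lemma isolating_words:
  assumes s: "s \<in> X" 
    and right: "\<And>K. \<exists>y\<in>X. (\<forall>i\<le>K. y i = s i) \<and> y \<noteq> s"
    and left: "\<And>K. \<exists>y\<in>X. (\<forall>i\<ge>-K. y i = s i) \<and> y \<noteq> s"
  obtains k where "0 \<le> k"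
    "\<And>K N. k \<le> K \<Longrightarrow> \<exists>p\<in>X. \<exists>z L. (\<forall>i\<ge>-K. p i = s i) \<and> k \<le> L \<and>
      (\<forall>t<N::nat. z t \<in> X \<and> (\<forall>i\<le>K. z t i = p i) \<and>
        (\<exists>q\<in>X. (\<forall>i\<le>K. q i = s i) \<and> (\<forall>i\<ge>-K. z t i = q i))) \<and>
      isolating k L s N z"
proof -
  obtain k1 where k1: "\<And>K. \<exists>y\<in>X. (\<forall>i\<le>K. y i = s i) \<and> eventually_avoids k1 s y \<and> \<not> right_asymptotic y s"
    using escaping_points[OF s right] by blast
  obtain k2 where k2: "\<And>K. \<exists>y\<in>X. (\<forall>i\<ge>-K. y i = s i) \<and>
    eventually_avoids k2 (\<lambda>i. s (- i)) (\<lambda>i. y (- i)) \<and>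
    \<not> right_asymptotic (\<lambda>i. y (- i)) (\<lambda>i. s (- i))"
    using escaping_points_left[OF s left] by blast
  define k where "k = max m (max k1 k2)"
  have k: "m \<le> k" "k1 \<le> k" "k2 \<le> k" by (auto simp: k_def)
  have esc: "\<exists>y\<in>X. (\<forall>i\<le>K. y i = s i) \<and> eventually_avoids k s y \<and> \<not> right_asymptotic y s" for K
    using k1[of K] eventually_avoids_mono[OF _ k(2), of s] by meson
  have esc_left: "\<exists>y\<in>X. (\<forall>i\<ge>-K. y i = s i) \<and>
    eventually_avoids k (\<lambda>i. s (- i)) (\<lambda>i. y (- i)) \<and>
    \<not> right_asymptotic (\<lambda>i. y (- i)) (\<lambda>i. s (- i))" for K
    using k2[of K] eventually_avoids_mono[OF _ k(3), of "\<lambda>i. s (- i)"] by meson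
  show thesis
  proof (rule that[of k])
    show "0 \<le> k" using k window by simp
    fix K and N :: nat assume K: "k \<le> K"
    obtain p where p: "p \<in> X" "\<And>i. -K \<le> i \<Longrightarrow> p i = s i"
      "eventually_avoids k (\<lambda>i. s (- i)) (\<lambda>i. p (- i))"
      "\<not> right_asymptotic (\<lambda>i. p (- i)) (\<lambda>i. s (- i))"
      using esc_left[of K] by blast
    define Y where "Y = {y\<in>X. (\<forall>i\<le>K. y i = s i) \<and> eventually_avoids k s y \<and> \<not> right_asymptotic y s}"
    have "infinite Y" unfolding Y_def
      by (rule infinite_escaping[OF s esc])
    then obtain y :: "nat \<Rightarrow> int \<Rightarrow> 'a" where y: "inj y" "range y \<subseteq> Y"
      using infinite_countable_subset by blast
    have yX: "y t \<in> X" and y_left: "i \<le> K \<Longrightarrow> y t i = s i" and y_av: "eventually_avoids k s (y t)"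
      and y_na: "\<not> right_asymptotic (y t) s" for t i using y(2) by (auto simp: Y_def)
    have "\<exists>z\<in>X. (\<forall>i\<le>K. z i = p i) \<and> (\<forall>i\<ge>-K. z i = y t i)" for t
    proof -
      have py: "p i = y t i" if "\<bar>i\<bar> \<le> K" for i using that p(2) y_left by simp
      then have "\<And>i. \<bar>i\<bar> \<le> m \<Longrightarrow> p i = y t i" using K k by simp
      from glue[OF p(1) yX this] obtain z where z: "z \<in> X" "\<And>i. i \<le> m \<Longrightarrow> z i = p i"
        "\<And>i. -m \<le> i \<Longrightarrow> z i = y t i" by blast
      have "z i = p i" if "i \<le> K" for i
        using py[of i] z(2,3)[of i] that window K k(1) by (cases "i \<le> m") auto
      moreover have "z i = y t i" if "-K \<le> i" for i
        using py[of i] z(2,3)[of i] that window K k(1) by (cases "i \<le> m") auto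
      ultimately show ?thesis using z(1) by blast
    qed
    then obtain z where z: "\<And>t. z t \<in> X" "\<And>t i. i \<le> K \<Longrightarrow> z t i = p i"
      "\<And>t i. -K \<le> i \<Longrightarrow> z t i = y t i" by metis
    have kK: "0 \<le> k" "k \<le> K" using K k window by auto
    have z_s: "z t i = s i" if "\<bar>i\<bar> \<le> K" for t i using that z(2)[of i t] p(2)[of i] by auto

    have "\<exists>n. \<forall>j. n \<le> \<bar>j\<bar> \<longrightarrow> (\<exists>i. \<bar>i\<bar> \<le> k \<and> z t (j + i) \<noteq> s i)" for t
    proof -
      obtain n1 where n1: "\<And>j. n1 \<le> j \<Longrightarrow> \<exists>i. \<bar>i\<bar> \<le> k \<and> y t (j + i) \<noteq> s i"
        using y_av unfolding eventually_avoids_def by blast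
      obtain n2 where n2: "\<And>j. n2 \<le> j \<Longrightarrow> \<exists>i. \<bar>i\<bar> \<le> k \<and> p (- (j + i)) \<noteq> s (- i)"
        using p(3) unfolding eventually_avoids_def by blast
      show ?thesis
      proof (rule exI, intro allI impI)
        fix j assume j: "max 0 (max n1 n2) \<le> \<bar>j\<bar>"
        show "\<exists>i. \<bar>i\<bar> \<le> k \<and> z t (j + i) \<noteq> s i"
        proof (cases "0 \<le> j")
          case True
          then obtain i where i: "\<bar>i\<bar> \<le> k" "y t (j + i) \<noteq> s i" using n1[of j] j by auto
          moreover have "z t (j + i) = y t (j + i)" using i(1) True kK by (intro z(3)) linarith
          ultimately show ?thesis by auto
        next
          case False
          then obtain i where i: "\<bar>i\<bar> \<le> k" "p (- (- j + i)) \<noteq> s (- i)" using n2[of "-j"] j by auto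
          moreover have "z t (j + - i) = p (j + - i)" using i(1) False kK by (intro z(2)) linarith
          ultimately show ?thesis by (intro exI[of _ "-i"]) auto
        qed
      qed
    qed
    then obtain nn where nn: "\<And>t j. nn t \<le> \<bar>j\<bar> \<Longrightarrow> \<exists>i. \<bar>i\<bar> \<le> k \<and> z t (j + i) \<noteq> s i" by metis
    \<comment> \<open>The bound on the times at which some word is close to \<open>s\<close>.\<close>
    define n0 where "n0 = Max (insert 0 (nn ` {..<N}))"
    have visit: "\<bar>j\<bar> \<le> n0" if "t < N" "\<And>i. \<bar>i\<bar> \<le> k \<Longrightarrow> z t (j + i) = s i" for t j
    proof -
      have "nn t \<le> n0" unfolding n0_def using that(1) by (intro Max_ge) auto
      moreover have "\<not> nn t \<le> \<bar>j\<bar>" using nn that(2) by blast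
      ultimately show ?thesis by simp
    qed

    have sep_s1: "\<exists>l. -k \<le> l \<and> s l \<noteq> z t (l - n)" for t n
    proof -
      obtain i where "max (-k) (n - K) \<le> i" "y t (i + (- n)) \<noteq> s i"
        using y_na[of t] unfolding right_asymptotic_def by (metis (no_types, opaque_lifting))
      then show ?thesis using z(3)[of "i - n" t] by (intro exI[of _ i]) auto
    qed
    have sep_s2: "\<exists>l. l \<le> k \<and> s l \<noteq> z t (l - n)" for t n
    proof -
      obtain i where "max (-k) (-n - K) \<le> i" "p (- (i + n)) \<noteq> s (- i)"
        using p(4) unfolding right_asymptotic_def by (metis (no_types, opaque_lifting))
      then show ?thesis using z(2)[of "- i - n" t] by (intro exI[of _ "-i"]) auto
    qed
    have sep_z: "\<exists>l. z t (l - n) \<noteq> z t' (l - n')" if tt: "t < N" "t' < N" "(t, n) \<noteq> (t', n')" for t t' n n'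
    proof (rule ccontr)
      assume "\<not> ?thesis"
      then have eq: "z t (l - n) = z t' (l - n')" for l by blast
      define d where "d = n - n'"
      have eq': "z t l = z t' (l + d)" for l using eq[of "l + n"] by (simp add: d_def algebra_simps)
      \<comment> \<open>The earliest visit to the vicinity of \<open>s\<close> is at a time \<open>\<le> 0\<close>, where all words have the same letters. So it is
        the same for all words, and the translation by \<open>d\<close> has to fix it.\<close>
      define V where "V u = {j. \<forall>i. \<bar>i\<bar> \<le> k \<longrightarrow> z u (j + i) = s i}" for u
      have fin: "finite (V u)" if "u < N" for u
      proof (rule finite_subset)
        show "V u \<subseteq> {-n0..n0}" using visit[OF that] by (force simp: V_def abs_le_iff)
      qed simp
      have 0: "0 \<in> V u" for u using z_s kK by (simp add: V_def)
      have min0: "Min (V u) \<le> 0" if "u < N" for u using fin[OF that] 0 by simp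
      have same: "j \<in> V u'" if j: "j \<in> V u" "j \<le> 0" for u u' j
      proof -
        have "z u' (j + i) = s i" if "\<bar>i\<bar> \<le> k" for i
        proof -
          have "z u' (j + i) = p (j + i)" "z u (j + i) = p (j + i)"
            using that j(2) kK by (auto intro!: z(2))
          moreover have "z u (j + i) = s i" using j(1) that by (simp add: V_def)
          ultimately show ?thesis by simp
        qed
        then show ?thesis by (simp add: V_def)
      qed
      have Min_in: "Min (V u) \<in> V u" if "u < N" for u using fin[OF that] 0 by (intro Min_in) auto
      have "Min (V t) = Min (V t')"
        using tt fin by (intro order_antisym Min_le same[OF Min_in min0]) auto
      moreover have "V t' = (\<lambda>j. j + d) ` V t"
      proof -
        have "j \<in> V t' \<longleftrightarrow> j - d \<in> V t" for j
          unfolding V_def by (simp add: eq' algebra_simps)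
        note mem = this
        show ?thesis
        proof (intro set_eqI iffI)
          fix j assume "j \<in> V t'"
          then have "j - d + d \<in> (\<lambda>j. j + d) ` V t" unfolding mem[of j] by (rule imageI)
          then show "j \<in> (\<lambda>j. j + d) ` V t" by (simp only: diff_add_cancel)
        next
          fix j assume "j \<in> (\<lambda>j. j + d) ` V t"
          then obtain i where "i \<in> V t" "j = i + d" by (rule imageE)
          then show "j \<in> V t'" using mem[of j] by (simp only: add_diff_cancel_right')
        qed
      qed
      moreover have "Min ((\<lambda>j. j + d) ` V t) = Min (V t) + d"
        using fin[OF tt(1)] 0[of t] Min_add_commute[of "V t" "\<lambda>j. j" d] by auto
      ultimately have d: "d = 0" by (metis add_cancel_right_right)
      have "y t i = y t' i" for i
        using eq'[of i] d y_left[of i] z(3)[of i t] z(3)[of i t'] kK by (cases "i \<le> K") auto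
      then have "t = t'" using y(1) by (auto simp: inj_def fun_eq_iff)
      then show False using tt(3) d by (simp add: d_def)
    qed

    define I where "I = {..<N} \<times> {-n0..n0}"
    have fin_I: "finite I" by (simp add: I_def)
    have I: "(t, n) \<in> I" if "t < N" "\<bar>n\<bar> \<le> n0" for t n using that by (auto simp: I_def)
    have ev1: "eventually (\<lambda>L. \<forall>a\<in>I. \<exists>l. (-k \<le> l \<and> s l \<noteq> z (fst a) (l - snd a)) \<and>
        \<bar>l - snd a\<bar> \<le> L \<and> \<bar>l - snd a\<bar> \<le> L) at_top"
    proof (intro eventually_ball_finite fin_I ballI)
      fix a
      obtain l where "-k \<le> l \<and> s l \<noteq> z (fst a) (l - snd a)" using sep_s1 by blast
      from eventually_window[of "\<lambda>l. -k \<le> l \<and> s l \<noteq> z (fst a) (l - snd a)", OF this]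
      show "eventually (\<lambda>L. \<exists>l. (-k \<le> l \<and> s l \<noteq> z (fst a) (l - snd a)) \<and>
        \<bar>l - snd a\<bar> \<le> L \<and> \<bar>l - snd a\<bar> \<le> L) at_top" .
    qed
    have ev2: "eventually (\<lambda>L. \<forall>a\<in>I. \<exists>l. (l \<le> k \<and> s l \<noteq> z (fst a) (l - snd a)) \<and>
        \<bar>l - snd a\<bar> \<le> L \<and> \<bar>l - snd a\<bar> \<le> L) at_top"
    proof (intro eventually_ball_finite fin_I ballI)
      fix a
      obtain l where "l \<le> k \<and> s l \<noteq> z (fst a) (l - snd a)" using sep_s2 by blast
      from eventually_window[of "\<lambda>l. l \<le> k \<and> s l \<noteq> z (fst a) (l - snd a)", OF this]
      show "eventually (\<lambda>L. \<exists>l. (l \<le> k \<and> s l \<noteq> z (fst a) (l - snd a)) \<and>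
        \<bar>l - snd a\<bar> \<le> L \<and> \<bar>l - snd a\<bar> \<le> L) at_top" .
    qed
    have ev3: "eventually (\<lambda>L. \<forall>a\<in>I. \<forall>b\<in>I - {a}.
        \<exists>l. z (fst a) (l - snd a) \<noteq> z (fst b) (l - snd b) \<and>
        \<bar>l - snd a\<bar> \<le> L \<and> \<bar>l - snd b\<bar> \<le> L) at_top"
    proof (intro eventually_ball_finite finite_Diff fin_I ballI)
      fix a b assume "a \<in> I" "b \<in> I - {a}"
      then have "fst a < N" "fst b < N" "(fst a, snd a) \<noteq> (fst b, snd b)"
        by (auto simp: I_def)
      from sep_z[OF this] obtain l where "z (fst a) (l - snd a) \<noteq> z (fst b) (l - snd b)" by blast
      from eventually_window[of "\<lambda>l. z (fst a) (l - snd a) \<noteq> z (fst b) (l - snd b)", OF this]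
      show "eventually (\<lambda>L. \<exists>l. z (fst a) (l - snd a) \<noteq> z (fst b) (l - snd b) \<and>
        \<bar>l - snd a\<bar> \<le> L \<and> \<bar>l - snd b\<bar> \<le> L) at_top" .
    qed
    obtain L where L0: "k \<le> L"
      and L1: "\<forall>a\<in>I. \<exists>l. (-k \<le> l \<and> s l \<noteq> z (fst a) (l - snd a)) \<and>
        \<bar>l - snd a\<bar> \<le> L \<and> \<bar>l - snd a\<bar> \<le> L"
      and L2: "\<forall>a\<in>I. \<exists>l. (l \<le> k \<and> s l \<noteq> z (fst a) (l - snd a)) \<and>
        \<bar>l - snd a\<bar> \<le> L \<and> \<bar>l - snd a\<bar> \<le> L"
      and L3: "\<forall>a\<in>I. \<forall>b\<in>I - {a}. \<exists>l. z (fst a) (l - snd a) \<noteq> z (fst b) (l - snd b) \<and>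
        \<bar>l - snd a\<bar> \<le> L \<and> \<bar>l - snd b\<bar> \<le> L"
      using eventually_happens'[OF _ eventually_conj[OF eventually_ge_at_top[of k]
          eventually_conj[OF ev1 eventually_conj[OF ev2 ev3]]]]
      by auto
    have occ: "x l = z t (l - n)" if "occurs_at L (z t) x n" "\<bar>l - n\<bar> \<le> L" for t x n l
      using that unfolding occurs_at_def by (metis add.commute diff_add_cancel)
    have near: "\<bar>n\<bar> \<le> n0" if "t < N" "\<bar>n\<bar> \<le> L - k" "occurs_at L (z t) x n"
      "\<And>i. \<bar>i\<bar> \<le> k \<Longrightarrow> x i = s i" for t n x
    proof -
      have "z t (- n + i) = s i" if "\<bar>i\<bar> \<le> k" for i
        using occ[OF \<open>occurs_at L (z t) x n\<close>, of i] that \<open>\<bar>n\<bar> \<le> L - k\<close> \<open>\<And>i. \<bar>i\<bar> \<le> k \<Longrightarrow> x i = s i\<close>[OF that]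
        by simp
      then show ?thesis using visit[OF that(1), of "- n"] by simp
    qed
    have no: "\<not> occurs_at L (z t) x n" if "t < N" "\<bar>n\<bar> \<le> L - k" "(\<forall>i\<ge>-k. x i = s i) \<or> (\<forall>i\<le>k. x i = s i)"
      for t x n
    proof
      assume o: "occurs_at L (z t) x n"
      have n: "\<bar>n\<bar> \<le> n0" using that by (intro near[OF that(1,2) o]) auto
      have tn: "(t, n) \<in> I" using I[OF that(1) n] .
      obtain l1 where l1: "-k \<le> l1" "s l1 \<noteq> z t (l1 - n)" "\<bar>l1 - n\<bar> \<le> L"
        using bspec[OF L1 tn] by auto
      obtain l2 where l2: "l2 \<le> k" "s l2 \<noteq> z t (l2 - n)" "\<bar>l2 - n\<bar> \<le> L"
        using bspec[OF L2 tn] by auto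
      show False using that(3) l1 l2 occ[OF o l1(3)] occ[OF o l2(3)] by auto
    qed
    have unique: "t = t' \<and> n = n'" if "t < N" "t' < N" "\<bar>n\<bar> \<le> L - k" "\<bar>n'\<bar> \<le> L - k"
      "\<forall>i. \<bar>i\<bar> \<le> k \<longrightarrow> x i = s i" and o: "occurs_at L (z t) x n" "occurs_at L (z t') x n'" for t t' x n n'
    proof -
      have n: "\<bar>n\<bar> \<le> n0" "\<bar>n'\<bar> \<le> n0"
        using near[OF that(1,3) o(1)] near[OF that(2,4) o(2)] that(5) by auto
      show ?thesis
      proof (rule ccontr)
        assume "\<not> ?thesis"
        then have "(t', n') \<in> I - {(t, n)}" using I[OF that(2) n(2)] by auto
        from bspec[OF bspec[OF L3 I[OF that(1) n(1)]] this]
        obtain l where "z t (l - n) \<noteq> z t' (l - n')" "\<bar>l - n\<bar> \<le> L" "\<bar>l - n'\<bar> \<le> L" by auto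
        then show False using occ[OF o(1)] occ[OF o(2)] by metis
      qed
    qed
    show "\<exists>p\<in>X. \<exists>z L. (\<forall>i\<ge>-K. p i = s i) \<and> k \<le> L \<and>
      (\<forall>t<N::nat. z t \<in> X \<and> (\<forall>i\<le>K. z t i = p i) \<and>
        (\<exists>q\<in>X. (\<forall>i\<le>K. q i = s i) \<and> (\<forall>i\<ge>-K. z t i = q i))) \<and>
      isolating k L s N z"
    proof (intro bexI[of _ p] exI[of _ z] exI[of _ L] conjI)
      show "p \<in> X" "k \<le> L" by fact+
      show "\<forall>i\<ge>-K. p i = s i" using p(2) by blast
      show "\<forall>t<N. z t \<in> X \<and> (\<forall>i\<le>K. z t i = p i) \<and>
          (\<exists>q\<in>X. (\<forall>i\<le>K. q i = s i) \<and> (\<forall>i\<ge>-K. z t i = q i))"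
        using z yX y_left by blast
      show "isolating k L s N z" unfolding isolating_def
        using no unique by blast
    qed
  qed
qed

end


section \<open>Counting words along a quadrilateral\<close>

definition word_weight :: "int \<Rightarrow> (nat \<Rightarrow> int \<Rightarrow> 'a) \<Rightarrow> (nat \<Rightarrow> real) \<Rightarrow> nat \<Rightarrow> (int \<Rightarrow> 'a) \<Rightarrow> int \<Rightarrow> real" where
  "word_weight L z v N s n = (\<Sum>t<N. v t * of_bool (occurs_at L (z t) s n))"

lemma word_weight_cong:
  assumes "\<And>i. \<bar>i\<bar> \<le> L \<Longrightarrow> s (n + i) = s' (n + i)"
  shows "word_weight L z v N s n = word_weight L z v N s' n"
  using assms unfolding word_weight_def occurs_at_def by (intro sum.cong) auto

lemma word_weight_none:
  assumes "\<And>t. t < N \<Longrightarrow> \<not> occurs_at L (z t) s n"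
  shows "word_weight L z v N s n = 0"
  unfolding word_weight_def using assms by (intro sum.neutral) auto

text \<open>The four series are those of the temporal distance, with \<open>s0\<close>, \<open>s1\<close>, \<open>s2\<close>, \<open>s3\<close> the codes of the corners.
  In each of them the terms with \<open>\<bar>n\<bar> > L - k\<close> vanish because the two sequences agree on the word in
  question, and the other occurrences in \<open>s0\<close>, \<open>s1\<close>, \<open>s2\<close> are ruled out. What remains is the only
  occurrence in \<open>s3\<close>, and it is counted with a minus sign whether its position is negative or not.\<close>

lemma alternating_word_count:
  fixes s0 s1 s2 s3 :: "int \<Rightarrow> 'a" and L k :: int and z :: "nat \<Rightarrow> int \<Rightarrow> 'a" and v :: "nat \<Rightarrow> real" and N :: nat
  defines "g \<equiv> word_weight L z v N"
  assumes s10: "\<forall>i\<ge>-k. s1 i = s0 i" and s20: "\<forall>i\<le>k. s2 i = s0 i"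
    and s31': "\<forall>i\<le>k. s3 i = s1 i" and s32': "\<forall>i\<ge>-k. s3 i = s2 i"
    and iso: "isolating k L s0 N z"
  defines "S \<equiv> (\<Sum>n. g s1 (int n) - g s0 (int n)) + (\<Sum>n. g s1 (- int (Suc n)) - g s3 (- int (Suc n))) +
    (\<Sum>n. g s2 (int n) - g s3 (int n)) + (\<Sum>n. g s2 (- int (Suc n)) - g s0 (- int (Suc n)))"
  shows "\<forall>t<N. \<forall>n. \<bar>n\<bar> \<le> L - k \<longrightarrow> \<not> occurs_at L (z t) s3 n \<Longrightarrow> S = 0"
    and "\<lbrakk>t < N; \<bar>n\<bar> \<le> L - k; occurs_at L (z t) s3 n\<rbrakk> \<Longrightarrow> S = - v t"
proof -
  have s1: "\<And>i. -k \<le> i \<Longrightarrow> s1 i = s0 i" and s2: "\<And>i. i \<le> k \<Longrightarrow> s2 i = s0 i"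
    and s31: "\<And>i. i \<le> k \<Longrightarrow> s3 i = s1 i" and s32: "\<And>i. -k \<le> i \<Longrightarrow> s3 i = s2 i"
    using s10 s20 s31' s32' by blast+
  have no: "\<not> occurs_at L (z t) x n"
    if "t < N" "\<bar>n\<bar> \<le> L - k" "(\<forall>i\<ge>-k. x i = s0 i) \<or> (\<forall>i\<le>k. x i = s0 i)" for t x n
    using iso that unfolding isolating_def by blast
  have unique: "t = t' \<and> n = n'" if "t < N" "t' < N" "\<bar>n\<bar> \<le> L - k" "\<bar>n'\<bar> \<le> L - k"
    "\<forall>i. \<bar>i\<bar> \<le> k \<longrightarrow> x i = s0 i" "occurs_at L (z t) x n" "occurs_at L (z t') x n'" for t t' x n n'
    using iso that unfolding isolating_def by blast
  have zero: "g x n = 0" if "\<bar>n\<bar> \<le> L - k" "(\<forall>i\<ge>-k. x i = s0 i) \<or> (\<forall>i\<le>k. x i = s0 i)" for x n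
    unfolding g_def using no that by (intro word_weight_none) blast
  have z1: "g x n = 0" if "\<bar>n\<bar> \<le> L - k" "x \<in> {s0, s1, s2}" for x n
    using that s1 s2 by (intro zero) auto
  have right: "g x n = g y n" if "L - k < n" "\<And>i. -k \<le> i \<Longrightarrow> x i = y i" for x y n
    unfolding g_def using that by (intro word_weight_cong that(2)) linarith
  have left: "g x n = g y n" if "n < - (L - k)" "\<And>i. i \<le> k \<Longrightarrow> x i = y i" for x y n
    unfolding g_def using that by (intro word_weight_cong that(2)) linarith
  have A: "g s1 (int n) - g s0 (int n) = 0" for n
    using z1[of "int n" s1] z1[of "int n" s0] right[of "int n" s1 s0, OF _ s1] by (cases "int n \<le> L - k") auto
  have D: "g s2 (- int (Suc n)) - g s0 (- int (Suc n)) = 0" for n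
    using z1[of "- int (Suc n)" s2] z1[of "- int (Suc n)" s0] left[of "- int (Suc n)" s2 s0, OF _ s2]
    by (cases "int (Suc n) \<le> L - k") auto
  have B: "g s1 (- int (Suc n)) - g s3 (- int (Suc n)) =
      (if int (Suc n) \<le> L - k then - g s3 (- int (Suc n)) else 0)" for n
    using z1[of "- int (Suc n)" s1] left[of "- int (Suc n)" s3 s1, OF _ s31] by auto
  have C: "g s2 (int n) - g s3 (int n) = (if int n \<le> L - k then - g s3 (int n) else 0)" for n
    using z1[of "int n" s2] right[of "int n" s3 s2, OF _ s32] by auto
  have S: "S = (\<Sum>n. if int (Suc n) \<le> L - k then - g s3 (- int (Suc n)) else 0) +
      (\<Sum>n. if int n \<le> L - k then - g s3 (int n) else 0)"
    unfolding S_def A B C D by simp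
  show "S = 0" if none: "\<forall>t<N. \<forall>n. \<bar>n\<bar> \<le> L - k \<longrightarrow> \<not> occurs_at L (z t) s3 n"
  proof -
    have "g s3 n = 0" if "\<bar>n\<bar> \<le> L - k" for n
      unfolding g_def using none that by (intro word_weight_none) blast
    then have "(\<lambda>n. if int (Suc n) \<le> L - k then - g s3 (- int (Suc n)) else 0) = (\<lambda>n. 0)"
      "(\<lambda>n. if int n \<le> L - k then - g s3 (int n) else 0) = (\<lambda>n. 0)" by (auto simp: fun_eq_iff)
    then show ?thesis unfolding S by simp
  qed
  show "S = - v t" if t: "t < N" "\<bar>n\<bar> \<le> L - k" "occurs_at L (z t) s3 n"
  proof -
    have s30: "\<forall>i. \<bar>i\<bar> \<le> k \<longrightarrow> s3 i = s0 i" using s32 s2 by auto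
    have g3: "g s3 j = (if j = n then v t else 0)" if j: "\<bar>j\<bar> \<le> L - k" for j
    proof -
      have "v u * of_bool (occurs_at L (z u) s3 j) = (if u = t then (if j = n then v t else 0) else 0)"
        if "u < N" for u
      proof (cases "occurs_at L (z u) s3 j")
        case True
        from unique[OF that t(1) j t(2) s30 True t(3)] True show ?thesis by simp
      next
        case False
        then have "\<not> (u = t \<and> j = n)" using t(3) by blast
        then show ?thesis using False by simp
      qed
      then have "g s3 j = (\<Sum>u<N. if u = t then (if j = n then v t else 0) else 0)"
        unfolding g_def word_weight_def by (intro sum.cong) auto
      then show ?thesis using t(1) by (simp add: sum.delta)
    qed
    have 1: "(\<lambda>j. if int (Suc j) \<le> L - k then - g s3 (- int (Suc j)) else 0) =
        (\<lambda>j. if j = nat (- n - 1) then (if n < 0 then - v t else 0) else 0)"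
      using t(2) g3[of "- int (Suc j)" for j] by (auto simp: fun_eq_iff nat_eq_iff)
    have 2: "(\<lambda>j. if int j \<le> L - k then - g s3 (int j) else 0) =
        (\<lambda>j. if j = nat n then (if 0 \<le> n then - v t else 0) else 0)"
      using t(2) g3[of "int j" for j] by (auto simp: fun_eq_iff nat_eq_iff)
    have "(\<Sum>j. if j = nat (- n - 1) then (if n < 0 then - v t else 0) else 0) = (if n < 0 then - v t else 0)"
      by (rule sums_unique[symmetric]) (rule sums_single)
    moreover have "(\<Sum>j. if j = nat n then (if 0 \<le> n then - v t else 0) else 0) = (if 0 \<le> n then - v t else 0)"
      by (rule sums_unique[symmetric]) (rule sums_single)
    ultimately show ?thesis unfolding S 1 2 by simp
  qed
qed


section \<open>Functions of class \<open>C\<^sup>k\<close> on open subsets of Euclidean space\<close>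

lemma frechet_derivative_open_cong:
  assumes "open S" "x \<in> S" "\<And>y. y \<in> S \<Longrightarrow> f y = g y"
  shows "frechet_derivative f (at x) = frechet_derivative g (at x)"
    and "f differentiable at x \<longleftrightarrow> g differentiable at x"
proof -
  have iff: "(f has_derivative D) (at x) \<longleftrightarrow> (g has_derivative D) (at x)" for D
    using has_derivative_transform_within_open[of f D x UNIV S g]
      has_derivative_transform_within_open[of g D x UNIV S f] assms by auto
  show "frechet_derivative f (at x) = frechet_derivative g (at x)"
    unfolding frechet_derivative_def iff ..
  show "f differentiable at x \<longleftrightarrow> g differentiable at x"
    unfolding differentiable_def iff ..
qed

lemma Ck_on_cong:
  assumes "open S" "\<And>x. x \<in> S \<Longrightarrow> f x = g x"
  shows "Ck_on k S f \<longleftrightarrow> Ck_on k S g"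
  using assms(2)
proof (induction k arbitrary: f g)
  case 0
  then show ?case by (auto intro: continuous_on_cong)
next
  case (Suc k)
  have "Ck_on k S (\<lambda>x. frechet_derivative f (at x) v) \<longleftrightarrow> Ck_on k S (\<lambda>x. frechet_derivative g (at x) v)" for v
    using frechet_derivative_open_cong(1)[OF assms(1) _ Suc.prems] by (intro Suc.IH) auto
  then show ?case using frechet_derivative_open_cong(2)[OF assms(1) _ Suc.prems] by auto
qed

lemma Ck_on_Un:
  assumes "open S" "open T"
  shows "Ck_on k S f \<Longrightarrow> Ck_on k T f \<Longrightarrow> Ck_on k (S \<union> T) f"
  by (induction k arbitrary: f) (use assms in \<open>auto intro: continuous_on_open_Un\<close>)

text \<open>Any family of derivatives may be used in place of \<open>frechet_derivative\<close>.\<close>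

lemma Ck_on_SucI:
  assumes "open S" "\<And>x. x \<in> S \<Longrightarrow> (f has_derivative f' x) (at x)" "\<And>v. Ck_on k S (\<lambda>x. f' x v)"
  shows "Ck_on (Suc k) S f"
proof -
  have "frechet_derivative f (at x) = f' x" if "x \<in> S" for x
    using frechet_derivative_at[OF assms(2)[OF that]] by simp
  then have "Ck_on k S (\<lambda>x. frechet_derivative f (at x) v)" for v
    using Ck_on_cong[OF assms(1), of "\<lambda>x. frechet_derivative f (at x) v" "\<lambda>x. f' x v" k] assms(3) by simp
  then show ?thesis using assms(2) by (auto simp: differentiable_def)
qed

lemma Ck_on_SucD:
  assumes "Ck_on (Suc k) S f"
  shows "x \<in> S \<Longrightarrow> (f has_derivative frechet_derivative f (at x)) (at x)"
    and "Ck_on k S (\<lambda>x. frechet_derivative f (at x) v)"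
  using assms by (auto simp: frechet_derivative_works)

lemma Ck_on_Suc_imp_Ck_on: "Ck_on (Suc k) S f \<Longrightarrow> Ck_on k S f"
proof (induction k arbitrary: f)
  case 0
  then show ?case
    by (auto intro!: continuous_at_imp_continuous_on differentiable_imp_continuous_within)
next
  case (Suc k)
  then show ?case by (simp del: Ck_on.simps(2) add: Ck_on.simps(2)[of "Suc k"])
      (simp add: Ck_on.simps(2)[of k])
qed

lemma Ck_on_const: "open S \<Longrightarrow> Ck_on k S (\<lambda>x. c)"
proof (induction k arbitrary: c)
  case (Suc k)
  then show ?case by (intro Ck_on_SucI[where f' = "\<lambda>x v. 0"]) auto
qed simp

lemma Ck_on_bounded_linear:
  assumes "open S" "bounded_linear h"
  shows "Ck_on k S h"
proof (cases k)
  case 0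
  then show ?thesis using assms by (simp add: linear_continuous_on)
next
  case (Suc n)
  have "Ck_on (Suc n) S h"
    by (intro Ck_on_SucI[where f' = "\<lambda>x. h"] Ck_on_const assms bounded_linear_imp_has_derivative)
  then show ?thesis by (simp only: Suc)
qed

lemma Ck_on_add: "open S \<Longrightarrow> Ck_on k S f \<Longrightarrow> Ck_on k S g \<Longrightarrow> Ck_on k S (\<lambda>x. f x + g x)"
proof (induction k arbitrary: f g)
  case 0
  then show ?case by (auto intro: continuous_intros)
next
  case (Suc k)
  show ?case
    by (rule Ck_on_SucI[OF Suc.prems(1)
          has_derivative_add[OF Ck_on_SucD(1)[OF Suc.prems(2)] Ck_on_SucD(1)[OF Suc.prems(3)]]])
      (simp_all only:, intro Suc.IH Suc.prems(1) Ck_on_SucD(2)[OF Suc.prems(2)] Ck_on_SucD(2)[OF Suc.prems(3)])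
qed

lemma Ck_on_scaleR:
  fixes f :: "'a::euclidean_space \<Rightarrow> real"
  shows "open S \<Longrightarrow> Ck_on k S f \<Longrightarrow> Ck_on k S g \<Longrightarrow> Ck_on k S (\<lambda>x. f x *\<^sub>R g x)"
proof (induction k arbitrary: f g)
  case 0
  then show ?case by (auto intro: continuous_intros)
next
  case (Suc k)
  show ?case
    by (rule Ck_on_SucI[OF Suc.prems(1)
          has_derivative_scaleR[OF Ck_on_SucD(1)[OF Suc.prems(2)] Ck_on_SucD(1)[OF Suc.prems(3)]]])
      (simp_all only:, intro Ck_on_add Suc.IH Suc.prems(1) Ck_on_SucD(2)[OF Suc.prems(2)]
        Ck_on_SucD(2)[OF Suc.prems(3)] Ck_on_Suc_imp_Ck_on[OF Suc.prems(2)] Ck_on_Suc_imp_Ck_on[OF Suc.prems(3)])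
qed

lemma Ck_on_sum:
  assumes "open S" "\<And>i. i \<in> I \<Longrightarrow> Ck_on k S (f i)"
  shows "Ck_on k S (\<lambda>x. \<Sum>i\<in>I. f i x)"
  using assms(2) by (induction I rule: infinite_finite_induct) (auto intro: Ck_on_add Ck_on_const assms(1))

lemma Ck_on_inner_const:
  assumes "open S" "Ck_on k S f"
  shows "Ck_on k S (\<lambda>x. f x \<bullet> w)"
  using assms(2)
proof (induction k arbitrary: f)
  case 0
  then show ?case by (auto intro: continuous_intros)
next
  case (Suc k)
  show ?case
    by (rule Ck_on_SucI[OF assms(1) has_derivative_inner_left[OF Ck_on_SucD(1)[OF Suc.prems]]])
      (simp_all only:, intro Suc.IH Ck_on_SucD(2)[OF Suc.prems])
qed

text \<open>In the induction the chain rule has to be written as a sum over the basis, because the directional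
  derivatives of \<open>g\<close> are known to be of class \<open>C\<^sup>k\<close> for constant directions only.\<close>

lemma Ck_on_compose:
  fixes f :: "'a::euclidean_space \<Rightarrow> 'b::euclidean_space" and g :: "'b \<Rightarrow> 'c::euclidean_space"
  assumes "open S" "open T" "f ` S \<subseteq> T" "Ck_on k S f" "Ck_on k T g"
  shows "Ck_on k S (\<lambda>x. g (f x))"
  using assms(4,5)
proof (induction k arbitrary: g)
  case 0
  then show ?case using assms(3) by (auto intro: continuous_on_compose2)
next
  case (Suc k)
  let ?f' = "\<lambda>x. frechet_derivative f (at x)" and ?g' = "\<lambda>y. frechet_derivative g (at y)"
  show ?case
  proof (rule Ck_on_SucI[OF assms(1)])
    fix x assume x: "x \<in> S"
    then have "f x \<in> T" using assms(3) by auto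
    then have D: "(g has_derivative ?g' (f x)) (at (f x))" by (rule Ck_on_SucD[OF Suc.prems(2)])
    have "?g' (f x) (?f' x v) = (\<Sum>i\<in>Basis. (?f' x v \<bullet> i) *\<^sub>R ?g' (f x) i)" for v
      using linear_sum[OF has_derivative_linear[OF D], of "\<lambda>i. (?f' x v \<bullet> i) *\<^sub>R i" Basis]
      by (simp add: euclidean_representation linear_scale[OF has_derivative_linear[OF D]])
    then show "((\<lambda>x. g (f x)) has_derivative (\<lambda>v. \<Sum>i\<in>Basis. (?f' x v \<bullet> i) *\<^sub>R ?g' (f x) i)) (at x)"
      using has_derivative_compose[OF Ck_on_SucD(1)[OF Suc.prems(1) x] D] by simp
  next
    fix v
    show "Ck_on k S (\<lambda>x. \<Sum>i\<in>Basis. (?f' x v \<bullet> i) *\<^sub>R ?g' (f x) i)"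
      by (intro Ck_on_sum Ck_on_scaleR Ck_on_inner_const assms(1) Ck_on_SucD(2)[OF Suc.prems(1)]
          Suc.IH Ck_on_Suc_imp_Ck_on[OF Suc.prems(1)] Ck_on_SucD(2)[OF Suc.prems(2)])
  qed
qed

text \<open>The functions \<open>x\<^sup>-\<^sup>n exp (-1/x)\<close>, extended by \<open>0\<close>. Their span is closed under differentiation, which
  makes the induction over the order of differentiability possible.\<close>

definition flat_exp :: "nat \<Rightarrow> real \<Rightarrow> real" where
  "flat_exp n x = (if 0 < x then inverse x ^ n * exp (- inverse x) else 0)"

lemma flat_exp_quotient_tendsto_0: "((\<lambda>h. flat_exp n h / h) \<longlongrightarrow> 0) (at 0)"
proof -
  have "((\<lambda>x. inverse x ^ Suc n / exp (inverse x)) \<longlongrightarrow> 0) (at_right (0::real))"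
    by (rule filterlim_compose[OF tendsto_power_div_exp_0 filterlim_inverse_at_top_right])
  then have "((\<lambda>h. flat_exp n h / h) \<longlongrightarrow> 0) (at_right 0)"
  proof (rule Lim_transform_eventually)
    show "\<forall>\<^sub>F x in at_right 0. inverse x ^ Suc n / exp (inverse x) = flat_exp n x / x"
      using eventually_at_right_less[of "0::real"]
      by eventually_elim (simp add: flat_exp_def exp_minus field_simps)
  qed
  moreover have "((\<lambda>h. flat_exp n h / h) \<longlongrightarrow> 0) (at_left 0)"
  proof (rule Lim_transform_eventually[OF tendsto_const])
    show "\<forall>\<^sub>F x in at_left 0. 0 = flat_exp n x / x"
      unfolding eventually_at_left_field by (intro exI[of _ "-1"]) (auto simp: flat_exp_def)
  qed
  ultimately show ?thesis by (simp add: filterlim_split_at)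
qed

lemma flat_exp_has_derivative:
  "(flat_exp n has_derivative (\<lambda>h. (flat_exp (Suc (Suc n)) x + (- real n) *\<^sub>R flat_exp (Suc n) x) * h)) (at x)"
proof -
  consider "x < 0" | "x = 0" | "0 < x" by linarith
  then show ?thesis
  proof cases
    case 1
    have "((\<lambda>x. 0::real) has_derivative (\<lambda>h. 0)) (at x)" by simp
    then have "(flat_exp n has_derivative (\<lambda>h. 0)) (at x)"
      by (rule has_derivative_transform_within_open[of _ _ _ _ "{..<0}"]) (use 1 in \<open>auto simp: flat_exp_def\<close>)
    then show ?thesis using 1 by (simp add: flat_exp_def)
  next
    case 2
    have "(flat_exp n has_field_derivative 0) (at 0)"
      using flat_exp_quotient_tendsto_0[of n] by (simp add: DERIV_def flat_exp_def)
    then show ?thesis using 2 by (simp add: has_field_derivative_def flat_exp_def lambda_zero)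
  next
    case 3
    have "((\<lambda>x. inverse x ^ n * exp (- inverse x)) has_field_derivative
        inverse x ^ Suc (Suc n) * exp (- inverse x) - real n * (inverse x ^ Suc n * exp (- inverse x))) (at x)"
    proof (cases n)
      case 0
      then show ?thesis using 3
        by (auto intro!: derivative_eq_intros simp: power2_eq_square)
    next
      case (Suc l)
      have i: "(inverse has_field_derivative - (inverse x ^ Suc (Suc 0))) (at x)"
        using 3 by (intro DERIV_inverse) simp
      have e: "((\<lambda>x. exp (- inverse x)) has_field_derivative exp (- inverse x) * inverse x ^ Suc (Suc 0)) (at x)"
        using 3 by (auto intro!: derivative_eq_intros simp: power2_eq_square)
      from DERIV_mult[OF DERIV_power_Suc[OF i, of l] e] show ?thesis
        by (simp add: Suc algebra_simps)
    qed
    then have "(flat_exp n has_field_derivative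
        inverse x ^ Suc (Suc n) * exp (- inverse x) - real n * (inverse x ^ Suc n * exp (- inverse x))) (at x)"
      by (rule has_field_derivative_transform_within_open[of _ _ _ "{0<..}"]) (use 3 in \<open>auto simp: flat_exp_def\<close>)
    then show ?thesis using 3 by (simp add: has_field_derivative_def flat_exp_def)
  qed
qed

lemma Ck_on_flat_exp: "Ck_on k UNIV (flat_exp n)"
proof (induction k arbitrary: n)
  case 0
  show ?case
    by (auto intro!: continuous_at_imp_continuous_on has_derivative_continuous[OF flat_exp_has_derivative])
next
  case (Suc k)
  show ?case
  proof (rule Ck_on_SucI[OF open_UNIV flat_exp_has_derivative])
    fix v :: real
    have "Ck_on k UNIV (\<lambda>x. v *\<^sub>R (flat_exp (Suc (Suc n)) x + (- real n) *\<^sub>R flat_exp (Suc n) x))"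
      by (intro Ck_on_scaleR Ck_on_add Ck_on_const open_UNIV Suc)
    then show "Ck_on k UNIV (\<lambda>x. (flat_exp (Suc (Suc n)) x + (- real n) *\<^sub>R flat_exp (Suc n) x) * v)"
      by (simp add: mult.commute)
  qed
qed

lemma Ck_on_inverse_power: "Ck_on k (- {0::real}) (\<lambda>x. inverse x ^ n)"
proof (induction k arbitrary: n)
  case 0
  show ?case by (auto intro!: continuous_intros)
next
  case (Suc k)
  show ?case
  proof (rule Ck_on_SucI)
    show "open (- {0::real})" by auto
    show "((\<lambda>x. inverse x ^ n) has_derivative (\<lambda>v. (- real n * v) *\<^sub>R inverse x ^ Suc n)) (at x)"
      if "x \<in> - {0}" for x :: real
    proof -
      have "((\<lambda>x. inverse x ^ n) has_field_derivative - real n * inverse x ^ Suc n) (at x)"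
      proof (cases n)
        case (Suc l)
        have "(inverse has_field_derivative - (inverse x ^ Suc (Suc 0))) (at x)"
          using that by (intro DERIV_inverse) simp
        from DERIV_power_Suc[OF this, of l] show ?thesis by (simp add: Suc algebra_simps)
      qed simp
      then show ?thesis unfolding has_field_derivative_def
        by (rule has_derivative_eq_rhs) (simp add: fun_eq_iff)
    qed
    show "Ck_on k (- {0::real}) (\<lambda>x. (- real n * v) *\<^sub>R inverse x ^ Suc n)" for v
      by (intro Ck_on_scaleR Ck_on_const Suc) auto
  qed
qed

text \<open>The quotient \<open>e(x) / (e(x) + e(1 - x))\<close> with \<open>e(x) = exp (-1/x)\<close> for \<open>x > 0\<close> and \<open>e(x) = 0\<close> otherwise.\<close>

lemma smooth_step:
  obtains h :: "real \<Rightarrow> real" where "smooth_on UNIV h" "\<And>x. x \<le> 0 \<Longrightarrow> h x = 0" "\<And>x. 1 \<le> x \<Longrightarrow> h x = 1"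
    "\<And>x. 0 \<le> h x" "\<And>x. h x \<le> 1"
proof -
  define g where "g x = flat_exp 0 x + flat_exp 0 (1 + (-1) *\<^sub>R x)" for x :: real
  have nonneg: "0 \<le> flat_exp 0 x" for x by (simp add: flat_exp_def)
  have pos: "0 < flat_exp 0 x" if "0 < x" for x using that by (simp add: flat_exp_def)
  have g: "0 < g x" for x
    using pos[of x] pos[of "1 - x"] nonneg[of x] nonneg[of "1 - x"] unfolding g_def
    by (cases "0 < x") (auto intro: add_pos_nonneg add_nonneg_pos)
  define h where "h x = flat_exp 0 x *\<^sub>R inverse (g x) ^ 1" for x
  have "Ck_on k UNIV g" for k
  proof -
    have "Ck_on k UNIV (\<lambda>x. flat_exp 0 (1 + (-1) *\<^sub>R x))"
      by (rule Ck_on_compose[OF open_UNIV open_UNIV _ _ Ck_on_flat_exp])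
        (simp, rule Ck_on_add[OF open_UNIV Ck_on_const[OF open_UNIV]
            Ck_on_bounded_linear[OF open_UNIV bounded_linear_scaleR_right]])
    then show ?thesis unfolding g_def by (intro Ck_on_add Ck_on_flat_exp open_UNIV)
  qed
  then have "Ck_on k UNIV h" for k unfolding h_def
    by (intro Ck_on_scaleR Ck_on_flat_exp open_UNIV Ck_on_compose[OF _ _ _ _ Ck_on_inverse_power])
      (use g in \<open>auto simp: less_imp_neq[symmetric]\<close>)
  then have "smooth_on UNIV h" by (simp add: smooth_on_def)
  moreover have "h x = 0" if "x \<le> 0" for x using that by (simp add: h_def flat_exp_def)
  moreover have "h x = 1" if "1 \<le> x" for x
  proof -
    have "flat_exp 0 (1 + (-1) *\<^sub>R x) = 0" using that by (simp add: flat_exp_def)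
    then have "g x = flat_exp 0 x" by (simp add: g_def)
    then show ?thesis using g[of x] by (simp add: h_def)
  qed
  moreover have "0 \<le> h x" for x using g[of x] nonneg[of x] by (simp add: h_def)
  moreover have "h x \<le> 1" for x
  proof -
    have "flat_exp 0 x \<le> g x" using nonneg by (simp add: g_def)
    then show ?thesis using g[of x] by (simp add: h_def field_simps)
  qed
  ultimately show thesis using that by blast
qed


section \<open>Smooth functions on the manifold\<close>

lemma chart_facts:
  assumes "smooth_atlas \<A>" "c \<in> \<A>"
  shows "open (fst c)" "open (snd c ` fst c)" "continuous_on (fst c) (snd c)"
    "continuous_on (snd c ` fst c) (chart_inv c)" "inj_on (snd c) (fst c)"
    "\<And>x. x \<in> fst c \<Longrightarrow> chart_inv c (snd c x) = x"
    "\<And>u. u \<in> snd c ` fst c \<Longrightarrow> chart_inv c u \<in> fst c \<and> snd c (chart_inv c u) = u"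
proof -
  have *: "open (fst c) \<and> open (snd c ` fst c) \<and>
        homeomorphism (fst c) (snd c ` fst c) (snd c) (chart_inv c)"
    using assms unfolding smooth_atlas_def by blast
  then show "open (fst c)" "open (snd c ` fst c)" "continuous_on (fst c) (snd c)"
    "continuous_on (snd c ` fst c) (chart_inv c)" "\<And>x. x \<in> fst c \<Longrightarrow> chart_inv c (snd c x) = x"
    "\<And>u. u \<in> snd c ` fst c \<Longrightarrow> chart_inv c u \<in> fst c \<and> snd c (chart_inv c u) = u"
    by (auto simp: homeomorphism_def)
  then show "inj_on (snd c) (fst c)" by (metis inj_on_inverseI)
qed

lemma open_chart_image:
  assumes "smooth_atlas \<A>" "c \<in> \<A>" "open U"
  shows "open (snd c ` (fst c \<inter> U))"
proof -
  note c = chart_facts[OF assms(1,2)]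
  have "snd c ` (fst c \<inter> U) = snd c ` fst c \<inter> chart_inv c -` U"
    using c(6,7) by (auto simp: image_iff) 
  moreover have "open (chart_inv c -` U \<inter> snd c ` fst c)"
    using continuous_on_open_vimage[OF c(2)] c(4) assms(3) by blast
  ultimately show ?thesis by (metis Int_commute)
qed

lemma chart_cball:
  assumes "smooth_atlas \<A>" "c \<in> \<A>" "open U" "p \<in> U" "p \<in> fst c"
  obtains \<rho> where "0 < \<rho>" "cball (snd c p) \<rho> \<subseteq> snd c ` (fst c \<inter> U)"
  using open_contains_cball[of "snd c ` (fst c \<inter> U)"] open_chart_image[OF assms(1-3)] assms(4,5)
  by blast

lemma compact_chart_cball:
  assumes "smooth_atlas \<A>" "c \<in> \<A>" "cball u \<rho> \<subseteq> snd c ` fst c"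
  shows "compact (chart_inv c ` cball u \<rho>)"
  using chart_facts(4)[OF assms(1,2)] assms(3)
  by (intro compact_continuous_image compact_cball) (auto intro: continuous_on_subset)

lemma smooth_function_comp:
  assumes "smooth_atlas \<A>" "smooth_on UNIV h" "smooth_function \<A> g"
  shows "smooth_function \<A> (\<lambda>x. h (g x))"
  unfolding smooth_function_def smooth_on_def
proof (intro ballI allI)
  fix c k assume c: "c \<in> \<A>"
  have g: "Ck_on k (snd c ` fst c) (g \<circ> chart_inv c)" and h: "Ck_on k UNIV h"
    using assms(2,3) c unfolding smooth_function_def smooth_on_def by blast+
  from Ck_on_compose[OF chart_facts(2)[OF assms(1) c] open_UNIV subset_UNIV g h]
  show "Ck_on k (snd c ` fst c) ((\<lambda>x. h (g x)) \<circ> chart_inv c)" by (simp only: o_def)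
qed

lemma smooth_function_add:
  assumes "smooth_atlas \<A>" "smooth_function \<A> f" "smooth_function \<A> g"
  shows "smooth_function \<A> (\<lambda>x. f x + g x)"
  unfolding smooth_function_def smooth_on_def
proof (intro ballI allI)
  fix c k assume c: "c \<in> \<A>"
  have f: "Ck_on k (snd c ` fst c) (f \<circ> chart_inv c)" and g: "Ck_on k (snd c ` fst c) (g \<circ> chart_inv c)"
    using assms(2,3) c unfolding smooth_function_def smooth_on_def by blast+
  from Ck_on_add[OF chart_facts(2)[OF assms(1) c] f g]
  show "Ck_on k (snd c ` fst c) ((\<lambda>x. f x + g x) \<circ> chart_inv c)" by (simp only: o_def)
qed

lemma smooth_function_const:
  assumes "smooth_atlas \<A>"
  shows "smooth_function \<A> (\<lambda>x. a)"
  unfolding smooth_function_def smooth_on_def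
proof (intro ballI allI)
  fix c k assume "c \<in> \<A>"
  from Ck_on_const[OF chart_facts(2)[OF assms this]]
  show "Ck_on k (snd c ` fst c) ((\<lambda>x. a) \<circ> chart_inv c)" by (simp only: o_def)
qed

lemma smooth_function_scale:
  assumes "smooth_atlas \<A>" "smooth_function \<A> f"
  shows "smooth_function \<A> (\<lambda>x. a * f x)"
proof (rule smooth_function_comp[OF assms(1) _ assms(2)])
  show "smooth_on UNIV ((*) a)"
    unfolding smooth_on_def by (intro allI Ck_on_bounded_linear bounded_linear_mult_right open_UNIV)
qed

lemma smooth_function_sum:
  assumes "smooth_atlas \<A>" "\<And>i. i \<in> I \<Longrightarrow> smooth_function \<A> (f i)"
  shows "smooth_function \<A> (\<lambda>x. \<Sum>i\<in>I. f i x)"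
  using assms(2)
proof (induction I rule: infinite_finite_induct)
  case (insert i I)
  then show ?case
    using smooth_function_add[OF assms(1), of "f i" "\<lambda>x. \<Sum>i\<in>I. f i x"] by simp
qed (simp_all add: smooth_function_const[OF assms(1)])

text \<open>A radial bump in a chart around \<open>p\<close>, extended by \<open>0\<close>. Its support is compact, hence closed in the
  manifold, so that every other chart is covered by two open sets on which the function is smooth: the
  overlap with the first chart and the complement of the support.\<close>

lemma smooth_local_bump:
  fixes \<A> :: "('m::{t2_space,second_countable_topology}, 'e::euclidean_space) chart set"
  assumes atlas: "smooth_atlas \<A>" and U: "open U" "p \<in> U"
  obtains \<psi> where "smooth_function \<A> \<psi>" "\<And>x. 0 \<le> \<psi> x" "0 < \<psi> p" "\<And>x. x \<notin> U \<Longrightarrow> \<psi> x = 0"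
    "continuous_on UNIV \<psi>"
proof -
  obtain c where c: "c \<in> \<A>" "p \<in> fst c" using atlas unfolding smooth_atlas_def by blast
  note cf = chart_facts[OF atlas c(1)]
  define u0 where "u0 = snd c p"
  obtain \<rho> where \<rho>: "0 < \<rho>" "cball u0 \<rho> \<subseteq> snd c ` (fst c \<inter> U)"
    using chart_cball[OF atlas c(1) U c(2)] by (auto simp: u0_def)
  define h where "h u = flat_exp 0 (\<rho>\<^sup>2 + (-1) *\<^sub>R ((u + - u0) \<bullet> (u + - u0)))" for u
  define \<psi> where "\<psi> x = (if x \<in> fst c then h (snd c x) else 0)" for x
  define K where "K = chart_inv c ` cball u0 \<rho>"
  have K: "closed K" unfolding K_def
    using \<rho>(2) by (intro compact_imp_closed compact_chart_cball[OF atlas c(1)]) auto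
  have K_sub: "K \<subseteq> fst c \<inter> U"
    using \<rho>(2) cf(6) by (auto simp: K_def)
  have outside: "\<psi> x = 0" if "x \<notin> K" for x
  proof (cases "x \<in> fst c")
    case True
    then have "snd c x \<notin> cball u0 \<rho>" using that cf(6)[OF True] unfolding K_def by (metis imageI)
    then have "\<rho> < norm (snd c x - u0)" by (simp add: dist_norm norm_minus_commute)
    then have "\<rho>\<^sup>2 < norm (snd c x - u0) ^ 2" using \<rho>(1) by (intro power_strict_mono) auto
    then show ?thesis by (simp add: \<psi>_def h_def flat_exp_def power2_norm_eq_inner)
  qed (simp add: \<psi>_def)
  have h: "Ck_on k UNIV h" for k
  proof -
    have shift: "Ck_on k UNIV (\<lambda>u. u + - u0)" for k
      by (intro Ck_on_add Ck_on_const Ck_on_bounded_linear bounded_linear_ident open_UNIV)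
    have "Ck_on (Suc k) UNIV (\<lambda>u. (u + - u0) \<bullet> (u + - u0))"
    proof (rule Ck_on_SucI[OF open_UNIV])
      show "((\<lambda>u. (u + - u0) \<bullet> (u + - u0)) has_derivative
          (\<lambda>v. (2::real) *\<^sub>R ((u + - u0) \<bullet> v))) (at u)" for u
        by (auto intro!: derivative_eq_intros simp: inner_commute algebra_simps)
      show "Ck_on k UNIV (\<lambda>u. (2::real) *\<^sub>R ((u + - u0) \<bullet> v))" for v
        by (intro Ck_on_scaleR Ck_on_const Ck_on_inner_const shift open_UNIV)
    qed
    from Ck_on_Suc_imp_Ck_on[OF this]
    have "Ck_on k UNIV (\<lambda>u. \<rho>\<^sup>2 + (-1) *\<^sub>R ((u + - u0) \<bullet> (u + - u0)))"
      by (intro Ck_on_add Ck_on_scaleR Ck_on_const open_UNIV)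
    then show ?thesis unfolding h_def
      by (rule Ck_on_compose[OF open_UNIV open_UNIV _ _ Ck_on_flat_exp, rotated]) simp
  qed
  have smooth: "smooth_function \<A> \<psi>" unfolding smooth_function_def smooth_on_def
  proof (intro ballI allI)
    fix d k assume d: "d \<in> \<A>"
    note df = chart_facts[OF atlas d]
    note W = open_chart_image[OF atlas d cf(1)]
    have "Ck_on k (snd d ` (fst d \<inter> fst c)) (snd c \<circ> chart_inv d)"
      using atlas c(1) d unfolding smooth_atlas_def smooth_on_def by blast
    from Ck_on_compose[OF W open_UNIV subset_UNIV this h]
    have "Ck_on k (snd d ` (fst d \<inter> fst c)) (\<lambda>u. h ((snd c \<circ> chart_inv d) u))" .
    moreover have "(\<psi> \<circ> chart_inv d) u = h ((snd c \<circ> chart_inv d) u)"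
      if "u \<in> snd d ` (fst d \<inter> fst c)" for u
      using that by (auto simp: \<psi>_def df(6))
    ultimately have 1: "Ck_on k (snd d ` (fst d \<inter> fst c)) (\<psi> \<circ> chart_inv d)"
      by (simp only: Ck_on_cong[OF W, of "\<psi> \<circ> chart_inv d" "\<lambda>u. h ((snd c \<circ> chart_inv d) u)"])
    have o: "open (snd d ` (fst d \<inter> - K))" using K by (intro open_chart_image[OF atlas d]) auto
    have 2: "Ck_on k (snd d ` (fst d \<inter> - K)) (\<psi> \<circ> chart_inv d)"
    proof -
      have "(\<psi> \<circ> chart_inv d) u = 0" if "u \<in> snd d ` (fst d \<inter> - K)" for u
        using that outside by (auto simp: df(6))
      then show ?thesis
        using Ck_on_const[OF o, of k "0::real"]
        by (simp only: Ck_on_cong[OF o, of "\<psi> \<circ> chart_inv d" "\<lambda>u. 0"])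
    qed
    have "snd d ` fst d = snd d ` (fst d \<inter> fst c) \<union> snd d ` (fst d \<inter> - K)"
      using K_sub by auto
    then show "Ck_on k (snd d ` fst d) (\<psi> \<circ> chart_inv d)"
      using Ck_on_Un[OF W o 1 2] by simp
  qed
  have "continuous_on (fst c \<union> - K) \<psi>"
  proof (rule continuous_on_open_Un[OF cf(1)])
    have "continuous_on (fst c) (h \<circ> snd c)"
      using h[of 0] cf(3) by (intro continuous_on_compose) (auto intro: continuous_on_subset)
    then show "continuous_on (fst c) \<psi>"
      by (rule continuous_on_eq) (simp add: \<psi>_def)
    show "continuous_on (- K) \<psi>" using outside by (intro continuous_on_eq[OF continuous_on_const]) auto
  qed (use K in auto)
  moreover have "fst c \<union> - K = UNIV" using K_sub by auto
  moreover have "0 < \<psi> p" using c(2) \<rho>(1) by (simp add: \<psi>_def h_def u0_def flat_exp_def)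
  moreover have "0 \<le> \<psi> x" for x by (simp add: \<psi>_def h_def flat_exp_def)
  moreover have "\<psi> x = 0" if "x \<notin> U" for x using outside K_sub that by blast
  ultimately show thesis using that smooth by simp
qed

text \<open>A finite sum of bumps is bounded below on \<open>K\<close> by some \<open>\<mu> > 0\<close> and vanishes outside \<open>U\<close>; a smooth step
  function turns all values \<open>\<ge> \<mu>\<close> into \<open>1\<close>.\<close>

lemma smooth_urysohn:
  fixes \<A> :: "('m::{t2_space,second_countable_topology}, 'e::euclidean_space) chart set"
  assumes atlas: "smooth_atlas \<A>" and K: "compact K" and U: "open U" "K \<subseteq> U"
  obtains \<eta> where "smooth_function \<A> \<eta>" "\<And>x. 0 \<le> \<eta> x" "\<And>x. \<eta> x \<le> 1"
    "\<And>x. x \<in> K \<Longrightarrow> \<eta> x = 1" "\<And>x. x \<notin> U \<Longrightarrow> \<eta> x = 0"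
proof -
  have "\<exists>\<psi>. smooth_function \<A> \<psi> \<and> (\<forall>x. 0 \<le> \<psi> x) \<and> 0 < \<psi> p \<and> (\<forall>x. x \<notin> U \<longrightarrow> \<psi> x = 0) \<and>
    continuous_on UNIV \<psi>" if "p \<in> K" for p
    using smooth_local_bump[OF atlas U(1)] U(2) that by (metis subsetD)
  then have "\<forall>p\<in>K. \<exists>\<psi>. smooth_function \<A> \<psi> \<and> (\<forall>x. 0 \<le> \<psi> x) \<and> 0 < \<psi> p \<and>
    (\<forall>x. x \<notin> U \<longrightarrow> \<psi> x = 0) \<and> continuous_on UNIV \<psi>" by blast
  from bchoice[OF this] obtain \<psi> where "\<forall>p\<in>K. smooth_function \<A> (\<psi> p) \<and> (\<forall>x. 0 \<le> \<psi> p x) \<and>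
    0 < \<psi> p p \<and> (\<forall>x. x \<notin> U \<longrightarrow> \<psi> p x = 0) \<and> continuous_on UNIV (\<psi> p)" ..
  then have \<psi>: "\<And>p. p \<in> K \<Longrightarrow> smooth_function \<A> (\<psi> p)" "\<And>p x. p \<in> K \<Longrightarrow> 0 \<le> \<psi> p x"
    "\<And>p. p \<in> K \<Longrightarrow> 0 < \<psi> p p" "\<And>p x. p \<in> K \<Longrightarrow> x \<notin> U \<Longrightarrow> \<psi> p x = 0"
    "\<And>p. p \<in> K \<Longrightarrow> continuous_on UNIV (\<psi> p)" by blast+
  define V where "V p = {x. 0 < \<psi> p x}" for p
  have "open (V p)" if "p \<in> K" for p unfolding V_def
    using \<psi>(5)[OF that] by (intro open_Collect_less continuous_on_const)
  moreover have "K \<subseteq> (\<Union>p\<in>K. V p)" using \<psi>(3) by (auto simp: V_def)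
  ultimately obtain F where F: "F \<subseteq> K" "finite F" "K \<subseteq> (\<Union>p\<in>F. V p)"
    using compactE_image[OF K] by metis
  define g where "g x = (\<Sum>p\<in>F. \<psi> p x)" for x
  have g_pos: "0 < g x" if x: "x \<in> K" for x
  proof -
    obtain p where "p \<in> F" "0 < \<psi> p x" using F(3) x by (auto simp: V_def)
    then show ?thesis unfolding g_def using F(1,2) \<psi>(2) by (intro sum_pos2) auto
  qed
  have "continuous_on K g" unfolding g_def
    using F(1) by (intro continuous_on_sum continuous_on_subset[OF \<psi>(5) subset_UNIV]) auto
  then obtain \<mu> where \<mu>: "0 < \<mu>" "\<And>x. x \<in> K \<Longrightarrow> \<mu> \<le> g x"
  proof (cases "K = {}")
    case False
    then obtain x where "x \<in> K" "\<And>y. y \<in> K \<Longrightarrow> g x \<le> g y"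
      using continuous_attains_inf[OF K False \<open>continuous_on K g\<close>] by blast
    then show thesis using g_pos that by blast
  qed (use that[of 1] in auto)
  obtain h :: "real \<Rightarrow> real" where h: "smooth_on UNIV h" "\<And>x. x \<le> 0 \<Longrightarrow> h x = 0" "\<And>x. 1 \<le> x \<Longrightarrow> h x = 1"
    "\<And>x. 0 \<le> h x" "\<And>x. h x \<le> 1" using smooth_step by blast
  show thesis
  proof (rule that[of "\<lambda>x. h (inverse \<mu> * g x)"])
    show "smooth_function \<A> (\<lambda>x. h (inverse \<mu> * g x))"
      unfolding g_def using F(1) \<psi>(1)
      by (intro smooth_function_comp[OF atlas h(1)] smooth_function_scale smooth_function_sum atlas) auto
    show "h (inverse \<mu> * g x) = 1" if "x \<in> K" for x
      using \<mu>(1) \<mu>(2)[OF that] by (intro h(3)) (simp add: field_simps)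
    show "h (inverse \<mu> * g x) = 0" if "x \<notin> U" for x
    proof -
      have "g x = 0" unfolding g_def using F(1) \<psi>(4) that by (intro sum.neutral) auto
      then show ?thesis using h(2) by simp
    qed
  qed (use h in auto)
qed


section \<open>The topology of the Riemannian distance\<close>

lemma transition_smooth:
  assumes "smooth_atlas \<A>" "c \<in> \<A>" "d \<in> \<A>"
  shows "Ck_on k (snd c ` (fst c \<inter> fst d)) (snd d \<circ> chart_inv c)"
  using assms unfolding smooth_atlas_def smooth_on_def by blast

lemma transition_has_derivative:
  assumes "smooth_atlas \<A>" "c \<in> \<A>" "d \<in> \<A>" "p \<in> fst c" "p \<in> fst d"
  shows "((snd d \<circ> chart_inv c) has_derivative frechet_derivative (snd d \<circ> chart_inv c) (at (snd c p)))
    (at (snd c p))"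
  by (rule Ck_on_SucD(1)[OF transition_smooth[OF assms(1-3), of "Suc 0"]]) (use assms(4,5) in blast)

lemma coord_vec_self:
  assumes "smooth_atlas \<A>" "c \<in> \<A>" "p \<in> fst c"
  shows "coord_vec \<A> c p v c = v"
proof -
  note cf = chart_facts[OF assms(1,2)]
  have "((\<lambda>u. u) has_derivative (\<lambda>v. v)) (at (snd c p))" by simp
  then have "((snd c \<circ> chart_inv c) has_derivative (\<lambda>v. v)) (at (snd c p))"
    by (rule has_derivative_transform_within_open[OF _ cf(2)]) (use assms(3) cf(7) in auto)
  from fun_cong[OF frechet_derivative_at[OF this], of v] show ?thesis
    using assms(2,3) by (simp add: coord_vec_def)
qed

lemma coord_vec_linear:
  assumes "smooth_atlas \<A>" "c \<in> \<A>" "p \<in> fst c"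
  shows "coord_vec \<A> c p (a *\<^sub>R v + b *\<^sub>R w) = (\<lambda>d. a *\<^sub>R coord_vec \<A> c p v d + b *\<^sub>R coord_vec \<A> c p w d)"
proof
  fix d
  show "coord_vec \<A> c p (a *\<^sub>R v + b *\<^sub>R w) d = a *\<^sub>R coord_vec \<A> c p v d + b *\<^sub>R coord_vec \<A> c p w d"
  proof (cases "d \<in> \<A> \<and> p \<in> fst d")
    case True
    then have "linear (frechet_derivative (snd d \<circ> chart_inv c) (at (snd c p)))"
      using transition_has_derivative[OF assms(1,2) _ assms(3)] has_derivative_linear by blast
    then show ?thesis using True by (simp add: coord_vec_def linear_add linear_scale)
  next
    case False
    then have "coord_vec \<A> c p v' d = 0" for v' by (auto simp: coord_vec_def)
    then show ?thesis by simp
  qed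
qed

lemma coord_vec_in_tangent_space:
  assumes "smooth_atlas \<A>" "c \<in> \<A>" "p \<in> fst c"
  shows "coord_vec \<A> c p v \<in> tangent_space \<A> p"
  unfolding tangent_space_def
proof (intro CollectI conjI ballI impI allI)
  fix d e assume d: "d \<in> \<A>" and e: "e \<in> \<A>" and p: "p \<in> fst d \<inter> fst e"
  let ?D = "\<lambda>c d. frechet_derivative (snd d \<circ> chart_inv c) (at (snd c p))"
  have 1: "((snd d \<circ> chart_inv c) has_derivative ?D c d) (at (snd c p))"
    using p by (intro transition_has_derivative[OF assms(1,2) d assms(3)]) simp
  have eq: "(snd d \<circ> chart_inv c) (snd c p) = snd d p" using chart_facts(6)[OF assms] by simp
  have 2: "((snd e \<circ> chart_inv d) has_derivative ?D d e) (at ((snd d \<circ> chart_inv c) (snd c p)))"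
    unfolding eq using p by (intro transition_has_derivative[OF assms(1) d e]) auto
  have comp: "(((snd e \<circ> chart_inv d) \<circ> (snd d \<circ> chart_inv c)) has_derivative ?D d e \<circ> ?D c d) (at (snd c p))"
    by (rule diff_chain_at[OF 1 2])
  have W: "open (snd c ` (fst c \<inter> fst d))"
    by (rule open_chart_image[OF assms(1,2) chart_facts(1)[OF assms(1) d]])
  have "((snd e \<circ> chart_inv c) has_derivative ?D d e \<circ> ?D c d) (at (snd c p))"
  proof (rule has_derivative_transform_within_open[OF comp W])
    show "snd c p \<in> snd c ` (fst c \<inter> fst d)" using p assms(3) by blast
    fix u assume "u \<in> snd c ` (fst c \<inter> fst d)"
    then obtain x where "x \<in> fst c" "x \<in> fst d" "u = snd c x" by blast
    then show "((snd e \<circ> chart_inv d) \<circ> (snd d \<circ> chart_inv c)) u = (snd e \<circ> chart_inv c) u"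
      using chart_facts(6)[OF assms(1,2)] chart_facts(6)[OF assms(1) d] by simp
  qed
  from fun_cong[OF frechet_derivative_at[OF this], of v]
  show "coord_vec \<A> c p v e = ?D d e (coord_vec \<A> c p v d)"
    using d e p by (simp add: coord_vec_def)
qed (auto simp: coord_vec_def)

definition metric_coord ::
    "('m, 'e::euclidean_space) chart set \<Rightarrow> ('m, 'e) metric_tensor \<Rightarrow> ('m, 'e) chart
      \<Rightarrow> 'e \<Rightarrow> 'e \<Rightarrow> 'e \<Rightarrow> real" where
  "metric_coord \<A> G c u v w =
     G (chart_inv c u) (coord_vec \<A> c (chart_inv c u) v) (coord_vec \<A> c (chart_inv c u) w)"

lemma metric_coord_expand:
  assumes atlas: "smooth_atlas \<A>" and G: "riemannian_metric \<A> G" and c: "c \<in> \<A>" and u: "u \<in> snd c ` fst c"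
  shows "metric_coord \<A> G c u w w =
    (\<Sum>i\<in>Basis. \<Sum>j\<in>Basis. (w \<bullet> i) * ((w \<bullet> j) * metric_coord \<A> G c u j i))"
proof -
  let ?p = "chart_inv c u" and ?g = "metric_coord \<A> G c u"
  have p: "?p \<in> fst c" using chart_facts(7)[OF atlas c u] ..
  note T = coord_vec_in_tangent_space[OF atlas c p]
  have lin: "G ?p (\<lambda>c. a *\<^sub>R U c + b *\<^sub>R V c) W = a * G ?p U W + b * G ?p V W"
    if "U \<in> tangent_space \<A> ?p" "V \<in> tangent_space \<A> ?p" "W \<in> tangent_space \<A> ?p" for U V W a b
    using G that unfolding riemannian_metric_def by blast
  have sym: "?g v w = ?g w v" for v w
    using G T unfolding riemannian_metric_def metric_coord_def by blast
  have "?g (a *\<^sub>R v + b *\<^sub>R v') w = a * ?g v w + b * ?g v' w" for a b v v' w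
    unfolding metric_coord_def coord_vec_linear[OF atlas c p] by (rule lin[OF T T T])
  from this[of 1 _ 1] this[of _ _ 0 0] have L: "linear (\<lambda>v. ?g v w)" for w
    by (intro linearI) auto
  have half: "?g v w = (\<Sum>i\<in>Basis. (v \<bullet> i) * ?g i w)" for v w
  proof -
    have "?g v w = ?g (\<Sum>i\<in>Basis. (v \<bullet> i) *\<^sub>R i) w" by (simp add: euclidean_representation)
    also have "\<dots> = (\<Sum>i\<in>Basis. (v \<bullet> i) * ?g i w)"
      by (simp add: linear_sum[OF L] linear_scale[OF L])
    finally show ?thesis .
  qed
  have "?g i w = (\<Sum>j\<in>Basis. (w \<bullet> j) * ?g j i)" for i
    by (subst sym) (rule half)
  then show ?thesis by (subst half) (simp add: sum_distrib_left)
qed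

lemma metric_coord_pos:
  assumes "smooth_atlas \<A>" "riemannian_metric \<A> G" "c \<in> \<A>" "u \<in> snd c ` fst c" "w \<noteq> 0"
  shows "0 < metric_coord \<A> G c u w w"
proof -
  have p: "chart_inv c u \<in> fst c" using chart_facts(7)[OF assms(1,3,4)] ..
  have "coord_vec \<A> c (chart_inv c u) w \<noteq> (\<lambda>c. 0)"
    using coord_vec_self[OF assms(1,3) p, of w] assms(5) by (metis (no_types))
  then show ?thesis
    using assms(2) coord_vec_in_tangent_space[OF assms(1,3) p, of w]
    unfolding riemannian_metric_def metric_coord_def by blast
qed

lemma continuous_on_metric_coord:
  assumes "riemannian_metric \<A> G" "c \<in> \<A>"
  shows "continuous_on (snd c ` fst c) (\<lambda>u. metric_coord \<A> G c u v w)"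
proof -
  have "smooth_on (snd c ` fst c)
        (\<lambda>u. let p = chart_inv c u in G p (coord_vec \<A> c p v) (coord_vec \<A> c p w))"
    using assms unfolding riemannian_metric_def by blast
  then have "Ck_on 0 (snd c ` fst c) (\<lambda>u. metric_coord \<A> G c u v w)"
    unfolding smooth_on_def metric_coord_def Let_def by blast
  then show ?thesis by simp
qed

text \<open>In coordinates the metric is a quadratic form that depends continuously on the base point, so it is
  bounded above and below by positive constants on the product of \<open>K\<close> and the unit sphere.\<close>

lemma tangent_norm_bounds:
  fixes \<A> :: "('m::{t2_space,second_countable_topology}, 'e::euclidean_space) chart set"
  assumes atlas: "smooth_atlas \<A>" and G: "riemannian_metric \<A> G" and c: "c \<in> \<A>"
    and K: "compact K" "K \<subseteq> snd c ` fst c"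
  obtains a b where "0 < a" "0 < b"
    "\<And>p w. p \<in> fst c \<Longrightarrow> snd c p \<in> K \<Longrightarrow> a * norm w \<le> tangent_norm G p (coord_vec \<A> c p w)"
    "\<And>p w. p \<in> fst c \<Longrightarrow> snd c p \<in> K \<Longrightarrow> tangent_norm G p (coord_vec \<A> c p w) \<le> b * norm w"
proof (cases "K = {}")
  case True
  then show thesis using that[of 1 1] by simp
next
  case False
  let ?g = "metric_coord \<A> G c"
  define q where "q z = (\<Sum>i\<in>Basis. \<Sum>j\<in>Basis. (snd z \<bullet> i) * ((snd z \<bullet> j) * ?g (fst z) j i))" for z :: "'e \<times> 'e"
  have q: "?g u w w = q (u, w)" if "u \<in> K" for u w
    using metric_coord_expand[OF atlas G c subsetD[OF K(2) that]] by (simp add: q_def)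
  obtain i0 :: 'e where "i0 \<in> Basis" by (meson nonempty_Basis ex_in_conv)
  then have ne: "K \<times> sphere 0 1 \<noteq> ({} :: ('e \<times> 'e) set)" using False by (auto simp: norm_Basis)
  have comp: "compact (K \<times> sphere 0 1 :: ('e \<times> 'e) set)" using K(1) by (intro compact_Times) auto
  have cont: "continuous_on (K \<times> sphere 0 1) q" unfolding q_def
    by (intro continuous_intros continuous_on_compose2[OF continuous_on_metric_coord[OF G c]])
      (use K(2) in auto)
  obtain z1 where z1: "z1 \<in> K \<times> sphere 0 1" "\<And>z. z \<in> K \<times> sphere 0 1 \<Longrightarrow> q z1 \<le> q z"
    using continuous_attains_inf[OF comp ne cont] by blast
  obtain z2 where z2: "z2 \<in> K \<times> sphere 0 1" "\<And>z. z \<in> K \<times> sphere 0 1 \<Longrightarrow> q z \<le> q z2"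
    using continuous_attains_sup[OF comp ne cont] by blast
  obtain u1 w1 where uw: "z1 = (u1, w1)" "u1 \<in> K" "norm w1 = 1" using z1(1) by auto
  have "w1 \<noteq> 0" using uw(3) by auto
  then have pos: "0 < q z1"
    using metric_coord_pos[OF atlas G c subsetD[OF K(2) uw(2)]] q[OF uw(2)] uw(1) by simp
  have hom: "q (u, w) = (norm w)\<^sup>2 * q (u, w /\<^sub>R norm w)" if "w \<noteq> 0" for u w
    using that unfolding q_def by (simp add: sum_distrib_left power2_eq_square field_simps)
  have bnds: "q z1 * (norm w)\<^sup>2 \<le> q (u, w) \<and> q (u, w) \<le> q z2 * (norm w)\<^sup>2" if "u \<in> K" for u w
  proof (cases "w = 0")
    case False
    then have "(u, w /\<^sub>R norm w) \<in> K \<times> sphere 0 1" using that by simp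
    from z1(2)[OF this] z2(2)[OF this] show ?thesis
      using hom[OF False, of u] by (simp add: mult.commute[of _ "(norm w)\<^sup>2"] mult_left_mono)
  qed (simp add: q_def)
  have tn: "tangent_norm G p (coord_vec \<A> c p w) = sqrt (q (snd c p, w))" if "p \<in> fst c" "snd c p \<in> K" for p w
    using q[OF that(2), of w, symmetric] chart_facts(6)[OF atlas c that(1)]
    by (simp add: tangent_norm_def metric_coord_def)
  show thesis
  proof (rule that[of "sqrt (q z1)" "sqrt (q z2)"])
    show "0 < sqrt (q z1)" using pos by simp
    show "0 < sqrt (q z2)" using pos z1(2)[OF z2(1)] by simp
    show "sqrt (q z1) * norm w \<le> tangent_norm G p (coord_vec \<A> c p w)" if "p \<in> fst c" "snd c p \<in> K" for p w
      using bnds[OF that(2), of w] real_sqrt_le_mono[of "q z1 * (norm w)\<^sup>2"]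
      by (simp add: tn[OF that] real_sqrt_mult)
    show "tangent_norm G p (coord_vec \<A> c p w) \<le> sqrt (q z2) * norm w" if "p \<in> fst c" "snd c p \<in> K" for p w
      using bnds[OF that(2), of w] real_sqrt_le_mono[of _ "q z2 * (norm w)\<^sup>2"]
      by (simp add: tn[OF that] real_sqrt_mult)
  qed
qed

text \<open>One chart around \<open>\<gamma> t\<close> determines the velocity in all others, by the chain rule for transition maps.\<close>

lemma velocity_eq_coord_vec:
  assumes atlas: "smooth_atlas \<A>" and c: "c \<in> \<A>"
    and T: "open T" "t \<in> T" "\<And>s. s \<in> T \<Longrightarrow> \<gamma> s \<in> fst c"
    and D: "((snd c \<circ> \<gamma>) has_vector_derivative D) (at t)"
  shows "d \<in> \<A> \<Longrightarrow> \<gamma> t \<in> fst d \<Longrightarrow>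
      ((snd d \<circ> \<gamma>) has_vector_derivative frechet_derivative (snd d \<circ> chart_inv c) (at (snd c (\<gamma> t))) D) (at t)"
    and "velocity \<A> \<gamma> t = coord_vec \<A> c (\<gamma> t) D"
proof -
  show *: "((snd d \<circ> \<gamma>) has_vector_derivative frechet_derivative (snd d \<circ> chart_inv c) (at (snd c (\<gamma> t))) D) (at t)"
    if d: "d \<in> \<A>" "\<gamma> t \<in> fst d" for d
  proof -
    have "((snd d \<circ> chart_inv c) has_derivative
        frechet_derivative (snd d \<circ> chart_inv c) (at (snd c (\<gamma> t)))) (at (snd c (\<gamma> t)))"
      by (rule transition_has_derivative[OF atlas c d(1) T(3)[OF T(2)] d(2)])
    then have "((snd d \<circ> chart_inv c) has_derivative
        frechet_derivative (snd d \<circ> chart_inv c) (at (snd c (\<gamma> t)))) (at ((snd c \<circ> \<gamma>) t) within range (snd c \<circ> \<gamma>))"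
      by (simp add: has_derivative_at_withinI)
    from vector_derivative_diff_chain_within[OF D this]
    show ?thesis
      by (rule has_vector_derivative_transform_within_open[OF _ T(1,2)])
        (simp add: chart_facts(6)[OF atlas c T(3)])
  qed
  show "velocity \<A> \<gamma> t = coord_vec \<A> c (\<gamma> t) D"
  proof
    fix d
    show "velocity \<A> \<gamma> t d = coord_vec \<A> c (\<gamma> t) D d"
      using vector_derivative_at[OF *[of d]] by (simp add: velocity_def coord_vec_def)
  qed
qed

text \<open>The segment between two points in the coordinates of one chart is a curve whose length is at most a
  constant multiple of its Euclidean length.\<close>

lemma riemannian_dist_small:
  fixes \<A> :: "('m::{t2_space,second_countable_topology}, 'e::euclidean_space) chart set"
  assumes atlas: "smooth_atlas \<A>" and G: "riemannian_metric \<A> G" and e: "0 < e"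
  obtains U where "open U" "p \<in> U" "\<And>x y. x \<in> U \<Longrightarrow> y \<in> U \<Longrightarrow> riemannian_dist \<A> G x y < ennreal e"
proof -
  have "p \<in> (\<Union>c\<in>\<A>. fst c)" using atlas unfolding smooth_atlas_def by simp
  then obtain c where c: "c \<in> \<A>" "p \<in> fst c" by blast
  note cf = chart_facts[OF atlas c(1)]
  define u0 where "u0 = snd c p"
  obtain \<rho> where \<rho>: "0 < \<rho>" "cball u0 \<rho> \<subseteq> snd c ` fst c"
    using chart_cball[OF atlas c(1) open_UNIV UNIV_I c(2)] unfolding u0_def by (metis inf_top_right)
  obtain a b where b: "0 < a" "0 < b"
    "\<And>p w. p \<in> fst c \<Longrightarrow> snd c p \<in> cball u0 \<rho> \<Longrightarrow> a * norm w \<le> tangent_norm G p (coord_vec \<A> c p w)"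
    "\<And>p w. p \<in> fst c \<Longrightarrow> snd c p \<in> cball u0 \<rho> \<Longrightarrow> tangent_norm G p (coord_vec \<A> c p w) \<le> b * norm w"
    by (rule tangent_norm_bounds[OF atlas G c(1) compact_cball \<rho>(2)], rule that) assumption+
  \<comment> \<open>Two points of the ball of radius \<open>r\<close> are joined by a curve of length at most
    \<open>b * (2 * r) \<le> e / 2\<close>.\<close>
  define r where "r = min \<rho> (e / (4 * b))"
  have r: "0 < r" "r \<le> \<rho>" "b * (2 * r) < e" using \<rho>(1) e b(2)
    by (auto simp: r_def min_def field_simps)
  define U where "U = snd c -` ball u0 r \<inter> fst c"
  have "open U" unfolding U_def
    using continuous_on_open_vimage[OF cf(1)] cf(3) by blast
  moreover have "p \<in> U" using c(2) r(1) by (simp add: U_def u0_def)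
  moreover have "riemannian_dist \<A> G x y < ennreal e" if x: "x \<in> U" and y: "y \<in> U" for x y
  proof -
    define v where "v = snd c y - snd c x"
    define l where "l t = snd c x + t *\<^sub>R v" for t
    define \<gamma> where "\<gamma> t = chart_inv c (l t)" for t
    have "norm v \<le> dist (snd c y) u0 + dist u0 (snd c x)"
      unfolding v_def dist_norm[symmetric] by (rule dist_triangle)
    then have nv: "norm v \<le> 2 * r" using x y by (auto simp: U_def dist_commute)
    have l_ball: "l t \<in> ball u0 r" if "t \<in> {0..1}" for t
    proof -
      have "l t = (1 - t) *\<^sub>R snd c x + t *\<^sub>R snd c y"
        by (simp add: l_def v_def algebra_simps)
      then show ?thesis
        using convexD_alt[OF convex_ball, of "snd c x" u0 r "snd c y" t] x y that by (simp add: U_def)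
    qed
    then have l_dom: "l t \<in> snd c ` fst c" if "t \<in> {0..1}" for t
      using \<rho>(2) r(2) that by (meson ball_subset_cball subset_ball subset_iff)
    have l_cont: "continuous_on S l" for S unfolding l_def by (intro continuous_intros)
    define T where "T = l -` (snd c ` fst c)"
    have T: "open T" unfolding T_def
      using continuous_on_open_vimage[OF open_UNIV, of l] l_cont cf(2) by (metis Int_UNIV_right)
    have T01: "t \<in> T" if "t \<in> {0..1}" for t using l_dom[OF that] by (simp add: T_def)
    have \<gamma>T: "\<gamma> t \<in> fst c" "snd c (\<gamma> t) = l t" if "t \<in> T" for t
      using cf(7)[of "l t"] that by (auto simp: T_def \<gamma>_def)
    have dl: "(l has_vector_derivative v) (at t)" for t
      unfolding l_def by (auto intro!: derivative_eq_intros)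
    have D: "((snd c \<circ> \<gamma>) has_vector_derivative v) (at t)" if "t \<in> T" for t
      by (rule has_vector_derivative_transform_within_open[OF dl T that]) (simp add: \<gamma>T)
    have V1: "((snd d \<circ> \<gamma>) has_vector_derivative
        frechet_derivative (snd d \<circ> chart_inv c) (at (snd c (\<gamma> t))) v) (at t)"
      if "t \<in> T" "d \<in> \<A>" "\<gamma> t \<in> fst d" for t d
      by (rule velocity_eq_coord_vec(1)[OF atlas c(1) T that(1) \<gamma>T(1) D[OF that(1)] that(2,3)])
    have V2: "velocity \<A> \<gamma> t = coord_vec \<A> c (\<gamma> t) v" if "t \<in> T" for t
      by (rule velocity_eq_coord_vec(2)[OF atlas c(1) T that \<gamma>T(1) D[OF that]])
    have "piecewise_C1_curve \<A> \<gamma>" unfolding piecewise_C1_curve_def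
    proof (intro conjI exI[of _ "{}"] ballI)
      show "continuous_on {0..1} \<gamma>" unfolding \<gamma>_def
        by (rule continuous_on_compose2[OF cf(4) l_cont]) (use l_dom in blast)
      fix d assume d: "d \<in> \<A>"
      let ?S = "({0..1} - {}) \<inter> \<gamma> -` fst d"
      let ?D = "\<lambda>t. frechet_derivative (snd d \<circ> chart_inv c) (at (snd c (\<gamma> t))) v"
      have "continuous_on (snd c ` (fst c \<inter> fst d)) (\<lambda>u. frechet_derivative (snd d \<circ> chart_inv c) (at u) v)"
        using Ck_on_SucD(2)[OF transition_smooth[OF atlas c(1) d, of "Suc 0"]] by simp
      then have "continuous_on ?S (\<lambda>t. frechet_derivative (snd d \<circ> chart_inv c) (at (l t)) v)"
        by (rule continuous_on_compose2[OF _ l_cont]) (use \<gamma>T T01 in \<open>force simp: image_iff\<close>)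
      then have "continuous_on ?S ?D"
        by (rule continuous_on_eq) (simp add: \<gamma>T(2) T01)
      moreover have "((snd d \<circ> \<gamma>) has_vector_derivative ?D t) (at t)" if "t \<in> ?S" for t
        using that by (intro V1 d T01) auto
      ultimately have "(\<forall>t\<in>?S. ((snd d \<circ> \<gamma>) has_vector_derivative ?D t) (at t)) \<and> continuous_on ?S ?D"
        by simp
      then show "(snd d \<circ> \<gamma>) C1_differentiable_on ?S"
        unfolding C1_differentiable_on_def by (rule exI[where x = "?D"])
    qed simp
    moreover have "\<gamma> 0 = x" "\<gamma> 1 = y" using x y cf(6) by (auto simp: \<gamma>_def l_def v_def U_def)
    ultimately have "riemannian_dist \<A> G x y \<le> curve_length \<A> G \<gamma>"
      unfolding riemannian_dist_def by (intro Inf_lower) blast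
    also have "\<dots> \<le> (\<integral>\<^sup>+t. ennreal (b * (2 * r)) * indicator {0..1::real} t \<partial>lborel)"
      unfolding curve_length_def
    proof (rule nn_integral_mono)
      fix t :: real
      show "ennreal (tangent_norm G (\<gamma> t) (velocity \<A> \<gamma> t)) * indicator {0..1} t
        \<le> ennreal (b * (2 * r)) * indicator {0..1} t"
      proof (cases "t \<in> {0..1}")
        case True
        have "snd c (\<gamma> t) \<in> cball u0 \<rho>"
          using l_ball[OF True] r(2) \<gamma>T(2)[OF T01[OF True]] by auto
        then have "tangent_norm G (\<gamma> t) (velocity \<A> \<gamma> t) \<le> b * norm v"
          unfolding V2[OF T01[OF True]] by (intro b(4) \<gamma>T T01 True)
        also have "\<dots> \<le> b * (2 * r)" using nv b(2) by (intro mult_left_mono) auto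
        finally show ?thesis by (intro mult_right_mono ennreal_leI) auto
      qed simp
    qed
    also have "\<dots> = ennreal (b * (2 * r))" by (simp add: nn_integral_cmult_indicator)
    also have "\<dots> < ennreal e" using r(3) e by (intro ennreal_lessI)
    finally show ?thesis .
  qed
  ultimately show thesis by (rule that)
qed


text \<open>The derivative need not be integrable near the exceptional points. If the integral on the right is
  infinite there is nothing to show; otherwise the derivative is Lebesgue integrable, and the
  fundamental theorem for the gauge integral, which tolerates the exceptional points, applies.\<close>

lemma norm_increment_le_nn_integral:
  fixes \<sigma> :: "real \<Rightarrow> 'e::euclidean_space"
  assumes ab: "a \<le> b" and S: "finite S" and cont: "continuous_on {a..b} \<sigma>"
    and D: "\<And>t. t \<in> {a<..<b} - S \<Longrightarrow> (\<sigma> has_vector_derivative D t) (at t)"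
    and contD: "continuous_on ({a<..<b} - S) D"
  shows "ennreal (norm (\<sigma> b - \<sigma> a)) \<le> (\<integral>\<^sup>+t. ennreal (norm (indicator ({a<..<b} - S) t *\<^sub>R D t)) \<partial>lborel)"
    and "(\<lambda>t. indicator ({a<..<b} - S) t *\<^sub>R D t) \<in> borel_measurable borel"
proof -
  define g where "g t = indicator ({a<..<b} - S) t *\<^sub>R D t" for t
  have "open ({a<..<b} - S)" using S by (intro open_Diff finite_imp_closed) auto
  then have meas: "g \<in> borel_measurable borel" unfolding g_def
    using contD by (intro borel_measurable_continuous_on_indicator) auto
  then show "(\<lambda>t. indicator ({a<..<b} - S) t *\<^sub>R D t) \<in> borel_measurable borel"
    by (simp add: g_def[abs_def])
  have "ennreal (norm (\<sigma> b - \<sigma> a)) \<le> (\<integral>\<^sup>+t. ennreal (norm (g t)) \<partial>lborel)"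
  proof (cases "(\<integral>\<^sup>+t. ennreal (norm (g t)) \<partial>lborel) < \<infinity>")
    case True
    then have int: "integrable lborel g" using meas by (intro integrableI_bounded) auto
    have "(D has_integral (\<sigma> b - \<sigma> a)) {a..b}"
      by (rule fundamental_theorem_of_calculus_interior_strong[OF S ab D cont])
    then have "(g has_integral (\<sigma> b - \<sigma> a)) {a..b}"
      by (rule has_integral_spike_finite[of "insert a (insert b S)", rotated 2])
        (use S in \<open>auto simp: g_def\<close>)
    then have "(g has_integral (\<sigma> b - \<sigma> a)) UNIV"
      by (rule has_integral_on_superset) (auto simp: g_def)
    then have "\<sigma> b - \<sigma> a = integral\<^sup>L lborel g"
      using has_integral_integral_lborel[OF int] has_integral_unique by blast
    then show ?thesis using integral_norm_bound_ennreal[OF int] by simp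
  qed (simp add: not_less top_unique)
  then show "ennreal (norm (\<sigma> b - \<sigma> a)) \<le>
      (\<integral>\<^sup>+t. ennreal (norm (indicator ({a<..<b} - S) t *\<^sub>R D t)) \<partial>lborel)"
    by (simp add: g_def)
qed

text \<open>The integrand that defines the length need not be measurable; it is enough that it dominates a
  measurable function, and this is how \<open>norm_increment_le_nn_integral\<close> is used.\<close>

lemma curve_length_lower_bound:
  fixes \<A> :: "('m::{t2_space,second_countable_topology}, 'e::euclidean_space) chart set"
  assumes atlas: "smooth_atlas \<A>" and c: "c \<in> \<A>" and \<gamma>: "piecewise_C1_curve \<A> \<gamma>"
    and b: "0 \<le> b" "b \<le> 1" and dom: "\<And>t. t \<in> {0..b} \<Longrightarrow> \<gamma> t \<in> fst c"
    and a: "0 < a" "\<And>t w. t \<in> {0..b} \<Longrightarrow> a * norm w \<le> tangent_norm G (\<gamma> t) (coord_vec \<A> c (\<gamma> t) w)"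
  shows "ennreal (a * dist (snd c (\<gamma> 0)) (snd c (\<gamma> b))) \<le> curve_length \<A> G \<gamma>"
proof -
  note cf = chart_facts[OF atlas c]
  have \<gamma>_cont: "continuous_on {0..1} \<gamma>" using \<gamma> unfolding piecewise_C1_curve_def by blast
  obtain S where S: "finite S" "(snd c \<circ> \<gamma>) C1_differentiable_on ({0..1} - S) \<inter> \<gamma> -` fst c"
    using \<gamma> c unfolding piecewise_C1_curve_def by blast
  then obtain D where D: "\<And>t. t \<in> ({0..1} - S) \<inter> \<gamma> -` fst c \<Longrightarrow>
      ((snd c \<circ> \<gamma>) has_vector_derivative D t) (at t)"
    "continuous_on (({0..1} - S) \<inter> \<gamma> -` fst c) D" unfolding C1_differentiable_on_def by blast
  let ?I = "{0<..<b} - S"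
  have sub: "?I \<subseteq> ({0..1} - S) \<inter> \<gamma> -` fst c" using dom b by auto
  have cont: "continuous_on {0..b} (snd c \<circ> \<gamma>)"
  proof (rule continuous_on_compose)
    show "continuous_on {0..b} \<gamma>" using b by (intro continuous_on_subset[OF \<gamma>_cont]) auto
    show "continuous_on (\<gamma> ` {0..b}) (snd c)" using dom by (intro continuous_on_subset[OF cf(3)]) auto
  qed
  have DI: "((snd c \<circ> \<gamma>) has_vector_derivative D t) (at t)" if "t \<in> ?I" for t
    using D(1) sub that by blast
  have contD: "continuous_on ?I D" by (rule continuous_on_subset[OF D(2) sub])
  have N1: "ennreal (norm ((snd c \<circ> \<gamma>) b - (snd c \<circ> \<gamma>) 0)) \<le>
      (\<integral>\<^sup>+t. ennreal (norm (indicator ?I t *\<^sub>R D t)) \<partial>lborel)"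
    by (rule norm_increment_le_nn_integral(1)[OF b(1) S(1) cont DI contD])
  have N2: "(\<lambda>t. indicator ?I t *\<^sub>R D t) \<in> borel_measurable borel"
    by (rule norm_increment_le_nn_integral(2)[OF b(1) S(1) cont DI contD])
  have "ennreal (a * dist (snd c (\<gamma> 0)) (snd c (\<gamma> b))) =
      ennreal a * ennreal (norm ((snd c \<circ> \<gamma>) b - (snd c \<circ> \<gamma>) 0))"
    using a(1) by (simp add: dist_norm norm_minus_commute ennreal_mult)
  also have "\<dots> \<le> ennreal a * (\<integral>\<^sup>+t. ennreal (norm (indicator ?I t *\<^sub>R D t)) \<partial>lborel)"
    by (intro mult_left_mono N1) auto
  also have "\<dots> = (\<integral>\<^sup>+t. ennreal a * ennreal (norm (indicator ?I t *\<^sub>R D t)) \<partial>lborel)"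
    using measurable_compose[OF N2 borel_measurable_norm]
    by (intro nn_integral_cmult[symmetric]) (simp del: norm_scaleR)
  also have "\<dots> \<le> curve_length \<A> G \<gamma>" unfolding curve_length_def
  proof (rule nn_integral_mono)
    fix t
    show "ennreal a * ennreal (norm (indicator ?I t *\<^sub>R D t)) \<le>
      ennreal (tangent_norm G (\<gamma> t) (velocity \<A> \<gamma> t)) * indicator {0..1} t"
    proof (cases "t \<in> ?I")
      case True
      have "velocity \<A> \<gamma> t = coord_vec \<A> c (\<gamma> t) (D t)"
        by (rule velocity_eq_coord_vec(2)[OF atlas c, of "{0<..<b}"])
          (use True dom sub D(1) in auto)
      then have "a * norm (D t) \<le> tangent_norm G (\<gamma> t) (velocity \<A> \<gamma> t)"
        using a(2)[of t "D t"] True by simp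
      then show ?thesis using True a(1) b
        by (simp add: ennreal_mult[symmetric] ennreal_leI)
    qed simp
  qed
  finally show ?thesis .
qed

text \<open>A curve from the smaller ball \<open>V\<close> to the outside of \<open>U\<close> has to cross the spherical shell around \<open>V\<close> in
  some chart, and the metric is bounded below on that shell. Together with \<open>riemannian_dist_small\<close> this
  expresses that the distance induces the topology, uniformly in the base point.\<close>

lemma riemannian_dist_separates:
  fixes \<A> :: "('m::{t2_space,second_countable_topology}, 'e::euclidean_space) chart set"
  assumes atlas: "smooth_atlas \<A>" and G: "riemannian_metric \<A> G" and U: "open U" "p \<in> U"
  obtains V e where "open V" "p \<in> V" "0 < e"
    "\<And>x y. x \<in> V \<Longrightarrow> riemannian_dist \<A> G x y < ennreal e \<Longrightarrow> y \<in> U"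
proof -
  have "p \<in> (\<Union>c\<in>\<A>. fst c)" using atlas unfolding smooth_atlas_def by simp
  then obtain c where c: "c \<in> \<A>" "p \<in> fst c" by blast
  note cf = chart_facts[OF atlas c(1)]
  define u0 where "u0 = snd c p"
  obtain \<rho> where \<rho>: "0 < \<rho>" "cball u0 \<rho> \<subseteq> snd c ` (fst c \<inter> U)"
    using chart_cball[OF atlas c(1) U c(2)] unfolding u0_def by blast
  then have \<rho>': "cball u0 \<rho> \<subseteq> snd c ` fst c" by blast
  obtain a b where ab: "0 < a" "0 < b"
    "\<And>p w. p \<in> fst c \<Longrightarrow> snd c p \<in> cball u0 \<rho> \<Longrightarrow> a * norm w \<le> tangent_norm G p (coord_vec \<A> c p w)"
    "\<And>p w. p \<in> fst c \<Longrightarrow> snd c p \<in> cball u0 \<rho> \<Longrightarrow> tangent_norm G p (coord_vec \<A> c p w) \<le> b * norm w"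
    by (rule tangent_norm_bounds[OF atlas G c(1) compact_cball \<rho>'], rule that) assumption+
  have op: "open (snd c -` ball u0 r \<inter> fst c)" for r
    using continuous_on_open_vimage[OF cf(1)] cf(3) by blast
  define K where "K = chart_inv c ` cball u0 \<rho>"
  have K: "closed K" unfolding K_def
    by (intro compact_imp_closed compact_chart_cball[OF atlas c(1) \<rho>'])
  have K_dom: "x \<in> fst c" "snd c x \<in> cball u0 \<rho>" if "x \<in> K" for x
    using that cf(7) \<rho>' by (auto simp: K_def)
  define V where "V = snd c -` ball u0 (\<rho> / 2) \<inter> fst c"
  have V: "open V" "p \<in> V" unfolding V_def using op c(2) \<rho>(1) by (auto simp: u0_def)
  have "y \<in> U" if x: "x \<in> V" and lt: "riemannian_dist \<A> G x y < ennreal (a * (\<rho> / 2))" for x y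
  proof (rule ccontr)
    assume y: "y \<notin> U"
    obtain \<gamma> where \<gamma>: "piecewise_C1_curve \<A> \<gamma>" "\<gamma> 0 = x" "\<gamma> 1 = y"
      "curve_length \<A> G \<gamma> < ennreal (a * (\<rho> / 2))"
      using lt unfolding riemannian_dist_def Inf_less_iff by blast
    have cont: "continuous_on {0..1} \<gamma>" using \<gamma>(1) unfolding piecewise_C1_curve_def by blast
    define W where "W = snd c -` ball u0 \<rho> \<inter> fst c"
    have W: "open W" "x \<in> W" unfolding W_def using op x \<rho>(1) by (auto simp: V_def)
    have WK: "W \<subseteq> K" 
    proof
      fix z assume "z \<in> W"
      then have "snd c z \<in> cball u0 \<rho>" "chart_inv c (snd c z) = z" using cf(6) by (auto simp: W_def)
      then show "z \<in> K" unfolding K_def by (metis imageI)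
    qed
    have "W \<subseteq> U"
    proof
      fix z assume z: "z \<in> W"
      then have "snd c z \<in> snd c ` (fst c \<inter> U)" using \<rho>(2) by (auto simp: W_def)
      then show "z \<in> U" using z inj_onD[OF cf(5)] by (auto simp: W_def)
    qed
    then have "y \<notin> W" using y by blast
    define E where "E = {0..1} \<inter> \<gamma> -` (- W)"
    have "closed E" unfolding E_def using W(1)
      by (intro continuous_closed_preimage[OF cont]) auto
    moreover have "1 \<in> E" using \<gamma>(3) \<open>y \<notin> W\<close> by (simp add: E_def)
    moreover have bdd: "bdd_below E" by (auto simp: E_def bdd_below_def)
    ultimately have inf: "Inf E \<in> E" using closed_contains_Inf by blast
    \<comment> \<open>The first time at which the curve leaves \<open>W\<close>. Up to and including this time it stays in the
      compact set \<open>K\<close>, hence in the chart.\<close>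
    define t1 where "t1 = Inf E"
    have t1: "0 \<le> t1" "t1 \<le> 1" "\<gamma> t1 \<notin> W" using inf by (auto simp: E_def t1_def)
    have "t1 \<noteq> 0" using t1(3) W(2) \<gamma>(2) by metis
    have before: "\<gamma> t \<in> W" if "0 \<le> t" "t < t1" for t
      using cInf_lower[OF _ bdd, of t] that t1(2) by (force simp: E_def t1_def)
    have "\<gamma> ` closure {0..<t1} \<subseteq> K"
    proof (rule image_closure_subset[OF _ K])
      show "continuous_on (closure {0..<t1}) \<gamma>"
        using t1 \<open>t1 \<noteq> 0\<close> by (intro continuous_on_subset[OF cont]) auto
      show "\<gamma> ` {0..<t1} \<subseteq> K" using before WK by auto
    qed
    then have inK: "\<gamma> t \<in> K" if "t \<in> {0..t1}" for t
      using that t1(1) \<open>t1 \<noteq> 0\<close> by auto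
    have "ennreal (a * dist (snd c (\<gamma> 0)) (snd c (\<gamma> t1))) \<le> curve_length \<A> G \<gamma>"
      by (rule curve_length_lower_bound[OF atlas c(1) \<gamma>(1) t1(1,2) K_dom(1)[OF inK] ab(1)
            ab(3)[OF K_dom(1)[OF inK] K_dom(2)[OF inK]]])
    moreover have "a * (\<rho> / 2) \<le> a * dist (snd c (\<gamma> 0)) (snd c (\<gamma> t1))"
    proof (rule mult_left_mono)
      have "\<rho> \<le> dist u0 (snd c (\<gamma> t1))"
        using t1 K_dom(1)[OF inK[of t1]] by (auto simp: W_def not_less)
      moreover have "dist u0 (snd c (\<gamma> 0)) < \<rho> / 2" using x \<gamma>(2) by (simp add: V_def)
      moreover have "dist u0 (snd c (\<gamma> t1)) \<le> dist u0 (snd c (\<gamma> 0)) + dist (snd c (\<gamma> 0)) (snd c (\<gamma> t1))"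
        by (rule dist_triangle)
      ultimately show "\<rho> / 2 \<le> dist (snd c (\<gamma> 0)) (snd c (\<gamma> t1))" by simp
    qed (use ab(1) in simp)
    ultimately have "ennreal (a * (\<rho> / 2)) \<le> curve_length \<A> G \<gamma>"
      using ennreal_leI order_trans by blast
    then show False using \<gamma>(4) by simp
  qed
  note main = this
  show thesis
  proof (rule that[OF V])
    show "0 < a * (\<rho> / 2)" using ab(1) \<rho>(1) by simp
    show "y \<in> U" if "x \<in> V" "riemannian_dist \<A> G x y < ennreal (a * (\<rho> / 2))" for x y
      by (rule main[OF that])
  qed
qed


section \<open>Locally constant functions on compact sets\<close>

definition locally_constant_on :: "'m::topological_space set \<Rightarrow> ('m \<Rightarrow> 'b) \<Rightarrow> bool" where
  "locally_constant_on \<Lambda> g \<longleftrightarrow> (\<forall>x\<in>\<Lambda>. \<exists>U. open U \<and> x \<in> U \<and> (\<forall>y\<in>U \<inter> \<Lambda>. g y = g x))"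

lemma locally_constant_onD:
  assumes "locally_constant_on \<Lambda> g" "x \<in> \<Lambda>"
  shows "\<exists>U. open U \<and> x \<in> U \<and> (\<forall>y\<in>U \<inter> \<Lambda>. g y = g x)"
  using assms unfolding locally_constant_on_def by blast

lemma locally_constant_on_tuple:
  assumes "finite I" "\<And>i. i \<in> I \<Longrightarrow> locally_constant_on \<Lambda> (g i)" "x \<in> \<Lambda>"
  shows "\<exists>U. open U \<and> x \<in> U \<and> (\<forall>i\<in>I. \<forall>y\<in>U \<inter> \<Lambda>. g i y = g i x)"
proof -
  have "\<forall>i\<in>I. \<exists>U. open U \<and> x \<in> U \<and> (\<forall>y\<in>U \<inter> \<Lambda>. g i y = g i x)"
    using assms(2,3) unfolding locally_constant_on_def by blast
  from bchoice[OF this] obtain U where U: "\<forall>i\<in>I. open (U i) \<and> x \<in> U i \<and> (\<forall>y\<in>U i \<inter> \<Lambda>. g i y = g i x)" ..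
  have "open (\<Inter>i\<in>I. U i)" using assms(1) U by (intro open_INT) auto
  moreover have "x \<in> (\<Inter>i\<in>I. U i)" "\<forall>i\<in>I. \<forall>y\<in>(\<Inter>i\<in>I. U i) \<inter> \<Lambda>. g i y = g i x" using U by auto
  ultimately show ?thesis by blast
qed

lemma locally_constant_on_compose:
  assumes g: "locally_constant_on \<Lambda> g" and h: "continuous_on UNIV h" "h ` \<Lambda> \<subseteq> \<Lambda>"
  shows "locally_constant_on \<Lambda> (\<lambda>x. g (h x))"
  unfolding locally_constant_on_def
proof
  fix x assume x: "x \<in> \<Lambda>"
  then have "h x \<in> \<Lambda>" using h(2) by auto
  from locally_constant_onD[OF g this]
  obtain U where U: "open U" "h x \<in> U" "\<And>y. y \<in> U \<Longrightarrow> y \<in> \<Lambda> \<Longrightarrow> g y = g (h x)" by blast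
  have "open (h -` U)" using h(1) U(1) by (simp add: continuous_on_open_vimage[OF open_UNIV])
  then show "\<exists>U. open U \<and> x \<in> U \<and> (\<forall>y\<in>U \<inter> \<Lambda>. g (h y) = g (h x))"
    using U(2,3) h(2) by (intro exI[of _ "h -` U"]) auto
qed

lemma compact_locally_constant_Collect:
  assumes \<Lambda>: "compact (\<Lambda> :: 'm::t2_space set)" and P: "locally_constant_on \<Lambda> P"
  shows "compact {x \<in> \<Lambda>. P x}"
proof -
  have "\<forall>x\<in>{x \<in> \<Lambda>. \<not> P x}. \<exists>U. open U \<and> x \<in> U \<and> (\<forall>y\<in>U \<inter> \<Lambda>. \<not> P y)"
    using P unfolding locally_constant_on_def by (metis (mono_tags, lifting) mem_Collect_eq)
  from bchoice[OF this] obtain U where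
    U: "\<forall>x\<in>{x \<in> \<Lambda>. \<not> P x}. open (U x) \<and> x \<in> U x \<and> (\<forall>y\<in>U x \<inter> \<Lambda>. \<not> P y)" ..
  let ?W = "\<Union>x\<in>{x \<in> \<Lambda>. \<not> P x}. U x"
  have "open ?W" using U by (intro open_UN) auto
  then have "closed (- ?W)" by (rule closed_Compl)
  with \<Lambda> have "compact (\<Lambda> \<inter> - ?W)" by (rule compact_Int_closed)
  moreover have "\<Lambda> \<inter> - ?W = {x \<in> \<Lambda>. P x}" using U by auto
  ultimately show ?thesis by simp
qed

text \<open>If no \<open>n\<close> served, limit points \<open>x\<close> and \<open>y\<close> of the counterexamples would agree in all \<open>g i\<close> and hence coincide;
  but near \<open>x = y\<close> there are no counterexamples to \<open>Q\<close>.\<close>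

lemma uniform_separation:
  fixes \<Lambda> :: "'m::{t2_space,first_countable_topology} set" and g :: "nat \<Rightarrow> 'm \<Rightarrow> 'b"
  assumes \<Lambda>: "compact \<Lambda>" and g: "\<And>i. locally_constant_on \<Lambda> (g i)"
    and sep: "\<forall>x\<in>\<Lambda>. \<forall>y\<in>\<Lambda>. (\<forall>i. g i x = g i y) \<longrightarrow> x = y"
    and Q: "\<forall>p\<in>\<Lambda>. \<exists>U. open U \<and> p \<in> U \<and> (\<forall>x\<in>U. \<forall>y\<in>U. Q x y)"
  shows "\<exists>n. \<forall>x\<in>\<Lambda>. \<forall>y\<in>\<Lambda>. (\<forall>i<n. g i x = g i y) \<longrightarrow> Q x y"
proof (rule ccontr)
  assume "\<not> ?thesis"
  then have "\<exists>x y. x \<in> \<Lambda> \<and> y \<in> \<Lambda> \<and> (\<forall>i<n. g i x = g i y) \<and> \<not> Q x y" for n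
    by blast
  then obtain X Y where XY: "\<And>n. X n \<in> \<Lambda>" "\<And>n. Y n \<in> \<Lambda>" "\<And>n i. i < n \<Longrightarrow> g i (X n) = g i (Y n)"
    "\<And>n. \<not> Q (X n) (Y n)" by metis
  have seq: "seq_compact \<Lambda>" using \<Lambda> by (rule compact_imp_seq_compact)
  obtain x r where x: "x \<in> \<Lambda>" "strict_mono (r :: nat \<Rightarrow> nat)" "(X \<circ> r) \<longlonglongrightarrow> x"
    using seq_compactE[OF seq, of X] XY(1) by blast
  obtain y r' where y: "y \<in> \<Lambda>" "strict_mono (r' :: nat \<Rightarrow> nat)" "((Y \<circ> r) \<circ> r') \<longlonglongrightarrow> y"
    using seq_compactE[OF seq, of "Y \<circ> r"] XY(2) by (metis comp_apply)
  define q where "q = r \<circ> r'"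
  have q: "strict_mono q" unfolding q_def using x(2) y(2) by (rule strict_mono_o)
  have Xq: "(\<lambda>n. X (q n)) \<longlonglongrightarrow> x"
    using LIMSEQ_subseq_LIMSEQ[OF x(3) y(2)] by (simp add: q_def o_def)
  have Yq: "(\<lambda>n. Y (q n)) \<longlonglongrightarrow> y" using y(3) by (simp add: q_def o_def)
  have "g i x = g i y" for i
  proof -
    obtain U where U: "open U" "x \<in> U" "\<And>z. z \<in> U \<Longrightarrow> z \<in> \<Lambda> \<Longrightarrow> g i z = g i x"
      using locally_constant_onD[OF g[of i] x(1)] by blast
    obtain V where V: "open V" "y \<in> V" "\<And>z. z \<in> V \<Longrightarrow> z \<in> \<Lambda> \<Longrightarrow> g i z = g i y"
      using locally_constant_onD[OF g[of i] y(1)] by blast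
    have "\<forall>\<^sub>F n in sequentially. X (q n) \<in> U \<and> Y (q n) \<in> V \<and> Suc i \<le> n"
      by (intro eventually_conj topological_tendstoD[OF Xq U(1,2)] topological_tendstoD[OF Yq V(1,2)]
          eventually_ge_at_top)
    then obtain n where n: "X (q n) \<in> U" "Y (q n) \<in> V" "i < n"
      by (auto dest!: eventually_happens)
    have "i < q n" using n(3) seq_suble[OF q, of n] by simp
    then show ?thesis using U(3)[OF n(1) XY(1)] V(3)[OF n(2) XY(2)] XY(3) by simp
  qed
  then have "x = y" using sep x(1) y(1) by blast
  obtain U where U: "open U" "x \<in> U" "\<And>u v. u \<in> U \<Longrightarrow> v \<in> U \<Longrightarrow> Q u v" using bspec[OF Q x(1)] by blast
  have "\<forall>\<^sub>F n in sequentially. X (q n) \<in> U \<and> Y (q n) \<in> U"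
    using topological_tendstoD[OF Xq U(1,2)] topological_tendstoD[OF Yq U(1)] U(2) \<open>x = y\<close>
    by (intro eventually_conj) auto
  then obtain n where "X (q n) \<in> U" "Y (q n) \<in> U" by (auto dest!: eventually_happens)
  then show False using U(3) XY(4) by blast
qed

text \<open>The coordinates of the Cantor space \<open>{0,1}\<^sup>\<nat>\<close>.\<close>

lemma cantor_coordinates:
  fixes \<Lambda> :: "'m::topological_space set"
  assumes "cantor_set \<Lambda>"
  obtains h :: "nat \<Rightarrow> 'm \<Rightarrow> bool" where "\<And>i. locally_constant_on \<Lambda> (h i)"
    "\<And>x y. \<lbrakk>x \<in> \<Lambda>; y \<in> \<Lambda>; \<And>i. h i x = h i y\<rbrakk> \<Longrightarrow> x = y"
proof -
  obtain F :: "'m \<Rightarrow> nat \<Rightarrow> bool" and F' where F: "homeomorphism \<Lambda> UNIV F F'"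
    using assms unfolding cantor_set_def homeomorphic_def by blast
  have "continuous_on \<Lambda> F" by (rule homeomorphism_cont1[OF F])
  then have cont: "continuous_on \<Lambda> (\<lambda>x. F x i)" for i
    by (rule continuous_on_product_then_coordinatewise)
  show thesis
  proof (rule that[of "\<lambda>i x. F x i"])
    fix i
    show "locally_constant_on \<Lambda> (\<lambda>x. F x i)" unfolding locally_constant_on_def
    proof
      fix x assume x: "x \<in> \<Lambda>"
      have "open {F x i}" by (rule open_discrete)
      then obtain U where U: "open U" "U \<inter> \<Lambda> = (\<lambda>x. F x i) -` {F x i} \<inter> \<Lambda>"
        using cont[of i, unfolded continuous_on_open_invariant] by blast
      have "x \<in> U" using U(2) x by blast
      moreover have "\<forall>y\<in>U \<inter> \<Lambda>. F y i = F x i" unfolding U(2) by blast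
      ultimately show "\<exists>U. open U \<and> x \<in> U \<and> (\<forall>y\<in>U \<inter> \<Lambda>. F y i = F x i)" using U(1) by blast
    qed
  next
    fix x y assume xy: "x \<in> \<Lambda>" "y \<in> \<Lambda>" "\<And>i. F x i = F y i"
    then have "F x = F y" by (simp add: fun_eq_iff)
    moreover have "F' (F x) = x" "F' (F y) = y" using homeomorphism_apply1[OF F] xy(1,2) by auto
    ultimately show "x = y" by metis
  qed
qed


section \<open>Two-sided iterates\<close>

definition iterate :: "('m \<Rightarrow> 'm) \<Rightarrow> int \<Rightarrow> 'm \<Rightarrow> 'm" where
  "iterate f i = (if 0 \<le> i then f ^^ nat i else inv f ^^ nat (- i))"

lemma iterate_int [simp]: "iterate f (int n) = f ^^ n"
  and iterate_minus_int: "iterate f (- int n) = inv f ^^ n"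
  by (auto simp: iterate_def)

lemma iterate_succ:
  assumes "bij f"
  shows "iterate f (i + 1) x = f (iterate f i x)"
proof (cases "0 \<le> i")
  case True
  then have "nat (i + 1) = Suc (nat i)" by simp
  then show ?thesis using True by (simp add: iterate_def)
next
  case False
  then have "nat (- i) = Suc (nat (- (i + 1)))" by simp
  then have "iterate f i x = inv f (iterate f (i + 1) x)"
    using False by (auto simp: iterate_def)
  then show ?thesis using assms by (simp add: bij_is_surj surj_f_inv_f)
qed

lemma iterate_add:
  assumes "bij f"
  shows "iterate f (i + j) x = iterate f i (iterate f j x)"
proof (induction i rule: int_induct[of _ 0])
  case base
  show ?case by (simp add: iterate_def)
next
  case (step1 i)
  have "iterate f (i + 1 + j) x = iterate f ((i + j) + 1) x" by (simp only: ac_simps)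
  also have "\<dots> = f (iterate f (i + j) x)" by (rule iterate_succ[OF assms])
  also have "\<dots> = f (iterate f i (iterate f j x))" by (simp only: step1)
  also have "\<dots> = iterate f (i + 1) (iterate f j x)" by (rule iterate_succ[OF assms, symmetric])
  finally show ?case .
next
  case (step2 i)
  have "f (iterate f (i - 1 + j) x) = iterate f ((i - 1 + j) + 1) x" by (rule iterate_succ[OF assms, symmetric])
  also have "(i - 1 + j) + 1 = i + j" by simp
  also have "iterate f (i + j) x = iterate f ((i - 1) + 1) (iterate f j x)" by (simp add: step2)
  also have "\<dots> = f (iterate f (i - 1) (iterate f j x))" by (rule iterate_succ[OF assms])
  finally show ?case using assms by (simp add: bij_is_inj inj_eq)
qed

lemma iterate_in:
  assumes "bij f" "f ` \<Lambda> = \<Lambda>" "x \<in> \<Lambda>"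
  shows "iterate f i x \<in> \<Lambda>"
proof (induction i rule: int_induct[of _ 0])
  case base
  show ?case using assms(3) by (simp add: iterate_def)
next
  case (step1 i)
  then show ?case using iterate_succ[OF assms(1), of i x] assms(2) by (metis imageI)
next
  case (step2 i)
  then obtain y where "y \<in> \<Lambda>" "iterate f i x = f y" using assms(2) by (metis imageE)
  moreover have "iterate f i x = f (iterate f (i - 1) x)" using iterate_succ[OF assms(1), of "i - 1" x] by simp
  ultimately show ?case using assms(1) by (simp add: bij_is_inj inj_eq)
qed

lemma continuous_on_iterate:
  assumes "continuous_on UNIV f" "continuous_on UNIV (inv f)"
  shows "continuous_on UNIV (iterate f i)"
proof -
  have "continuous_on UNIV (g ^^ n)" if "continuous_on UNIV g" for g :: "'a::topological_space \<Rightarrow> 'a" and n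
  proof (induction n)
    case 0
    then show ?case by (simp add: id_def)
  next
    case (Suc n)
    from continuous_on_compose[OF this continuous_on_subset[OF that]] show ?case by simp
  qed
  then show ?thesis using assms by (simp add: iterate_def)
qed


section \<open>Symbolic coding of a basic set\<close>

text \<open>What the rest of the argument uses about \<open>\<Lambda>\<close>: the code \<open>c x i\<close> is the partition element of the \<open>i\<close>-th
  iterate of \<open>x\<close>, and \<open>\<epsilon>\<^sub>0\<close> is a scale below which local stable and unstable manifolds stay within one
  partition element at all nonnegative, respectively nonpositive, times.\<close>

locale coded_basic_set =
  fixes \<A> :: "('m::{t2_space,second_countable_topology}, 'e::euclidean_space) chart set"
    and G :: "('m, 'e) metric_tensor" and f :: "'m \<Rightarrow> 'm" and \<Lambda> :: "'m set"
    and c :: "'m \<Rightarrow> int \<Rightarrow> 'a" and A :: "'a set" and \<epsilon>\<^sub>0 :: real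
  assumes compact: "compact \<Lambda>" and bij: "bij f" and invariant: "f ` \<Lambda> = \<Lambda>"
    and dist_small: "\<And>p e. 0 < e \<Longrightarrow> \<exists>U. open U \<and> p \<in> U \<and>
      (\<forall>x\<in>U. \<forall>y\<in>U. riemannian_dist \<A> G x y < ennreal e)"
    and dist_separates: "\<And>U p. open U \<Longrightarrow> p \<in> U \<Longrightarrow> \<exists>V e. open V \<and> p \<in> V \<and> 0 < e \<and>
      (\<forall>x\<in>V. \<forall>y. riemannian_dist \<A> G x y < ennreal e \<longrightarrow> y \<in> U)"
    and alphabet: "finite A" "\<And>x i. x \<in> \<Lambda> \<Longrightarrow> c x i \<in> A"
    and code_iterate: "\<And>x n i. c (iterate f n x) i = c x (i + n)"
    and code_locally_constant: "\<And>i. locally_constant_on \<Lambda> (\<lambda>x. c x i)"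
    and code_inj: "\<And>x y. \<lbrakk>x \<in> \<Lambda>; y \<in> \<Lambda>; c x = c y\<rbrakk> \<Longrightarrow> x = y"
    and \<epsilon>\<^sub>0_pos: "0 < \<epsilon>\<^sub>0"
    and code_stable: "\<And>\<epsilon> x y i. \<lbrakk>\<epsilon> < \<epsilon>\<^sub>0; x \<in> \<Lambda>; y \<in> \<Lambda>; y \<in> local_stable \<A> G f \<epsilon> x; 0 \<le> i\<rbrakk> \<Longrightarrow> c y i = c x i"
    and code_unstable: "\<And>\<epsilon> x y i. \<lbrakk>\<epsilon> < \<epsilon>\<^sub>0; x \<in> \<Lambda>; y \<in> \<Lambda>; y \<in> local_unstable \<A> G f \<epsilon> x; i \<le> 0\<rbrakk> \<Longrightarrow> c y i = c x i"
    and product: "\<And>\<epsilon>. \<lbrakk>0 < \<epsilon>; \<epsilon> < \<epsilon>\<^sub>0\<rbrakk> \<Longrightarrow> \<exists>\<eta>>0. \<forall>x\<in>\<Lambda>. \<forall>y\<in>\<Lambda>. riemannian_dist \<A> G x y < ennreal \<eta> \<longrightarrow>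
      (\<exists>z\<in>\<Lambda>. local_stable \<A> G f \<epsilon> x \<inter> local_unstable \<A> G f \<epsilon> y = {z})"
begin

lemma dist_self: "0 < e \<Longrightarrow> riemannian_dist \<A> G x x < ennreal e"
  using dist_small[of e x] by blast

lemma self_in_local: "0 < \<epsilon> \<Longrightarrow> x \<in> local_stable \<A> G f \<epsilon> x" "0 < \<epsilon> \<Longrightarrow> x \<in> local_unstable \<A> G f \<epsilon> x"
  using dist_self[of \<epsilon>] by (auto simp: local_unstable_def local_stable_def less_imp_le)

lemma code_pow: "c ((f ^^ n) x) i = c x (i + int n)" "c ((inv f ^^ n) x) i = c x (i - int n)"
  using code_iterate[of "int n" x i] code_iterate[of "- int n" x i] by (simp_all add: iterate_minus_int)

lemma pow_in: "x \<in> \<Lambda> \<Longrightarrow> (f ^^ n) x \<in> \<Lambda>" "x \<in> \<Lambda> \<Longrightarrow> (inv f ^^ n) x \<in> \<Lambda>"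
  using iterate_in[OF bij invariant, of x "int n"] iterate_in[OF bij invariant, of x "- int n"]
  by (simp_all add: iterate_minus_int)

text \<open>Cylinders shrink uniformly to points.\<close>

lemma code_close:
  assumes "0 < e"
  obtains K where "0 \<le> K"
    "\<And>x y. \<lbrakk>x \<in> \<Lambda>; y \<in> \<Lambda>; \<And>i. \<bar>i\<bar> \<le> K \<Longrightarrow> c x i = c y i\<rbrakk> \<Longrightarrow> riemannian_dist \<A> G x y < ennreal e"
proof -
  define g where "g i x = (c x (int i), c x (- int i))" for i x
  have lc: "locally_constant_on \<Lambda> (g i)" for i
    unfolding locally_constant_on_def
  proof
    fix x assume x: "x \<in> \<Lambda>"
    obtain U where U: "open U" "x \<in> U" "\<forall>y\<in>U \<inter> \<Lambda>. c y (int i) = c x (int i)"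
      using locally_constant_onD[OF code_locally_constant x] by blast
    obtain V where V: "open V" "x \<in> V" "\<forall>y\<in>V \<inter> \<Lambda>. c y (- int i) = c x (- int i)"
      using locally_constant_onD[OF code_locally_constant x] by blast
    show "\<exists>U. open U \<and> x \<in> U \<and> (\<forall>y\<in>U \<inter> \<Lambda>. g i y = g i x)"
      using U V by (intro exI[of _ "U \<inter> V"]) (auto simp: g_def)
  qed
  have sep: "\<forall>x\<in>\<Lambda>. \<forall>y\<in>\<Lambda>. (\<forall>i. g i x = g i y) \<longrightarrow> x = y"
  proof (intro ballI impI)
    fix x y assume xy: "x \<in> \<Lambda>" "y \<in> \<Lambda>" "\<forall>i. g i x = g i y"
    have "c x = c y"
    proof
      fix i
      have "c x (int (nat \<bar>i\<bar>)) = c y (int (nat \<bar>i\<bar>))" "c x (- int (nat \<bar>i\<bar>)) = c y (- int (nat \<bar>i\<bar>))"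
        using spec[OF xy(3), of "nat \<bar>i\<bar>"] by (auto simp: g_def)
      then show "c x i = c y i" by (cases "0 \<le> i") auto
    qed
    then show "x = y" by (rule code_inj[OF xy(1,2)])
  qed
  have "\<forall>p\<in>\<Lambda>. \<exists>U. open U \<and> p \<in> U \<and> (\<forall>x\<in>U. \<forall>y\<in>U. riemannian_dist \<A> G x y < ennreal e)"
    using dist_small[OF assms] by blast
  from uniform_separation[OF compact lc sep this]
  obtain n where n: "\<And>x y. \<lbrakk>x \<in> \<Lambda>; y \<in> \<Lambda>; \<forall>i<n. g i x = g i y\<rbrakk> \<Longrightarrow> riemannian_dist \<A> G x y < ennreal e"
    by blast
  show thesis
  proof (rule that[of "int n"])
    fix x y assume "x \<in> \<Lambda>" "y \<in> \<Lambda>" and eq: "\<And>i. \<bar>i\<bar> \<le> int n \<Longrightarrow> c x i = c y i"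
    then show "riemannian_dist \<A> G x y < ennreal e" by (intro n) (auto simp: g_def)
  qed simp
qed

text \<open>A partial converse to the fact that points of a local stable manifold share their future: some more
  letters have to be prescribed, in order that the points are close already at time \<open>0\<close>.\<close>

lemma code_determines_local:
  assumes "0 < \<epsilon>"
  obtains K where "0 \<le> K"
    "\<And>x y. \<lbrakk>x \<in> \<Lambda>; y \<in> \<Lambda>; \<And>i. -K \<le> i \<Longrightarrow> c y i = c x i\<rbrakk> \<Longrightarrow> y \<in> local_stable \<A> G f \<epsilon> x"
    "\<And>x y. \<lbrakk>x \<in> \<Lambda>; y \<in> \<Lambda>; \<And>i. i \<le> K \<Longrightarrow> c y i = c x i\<rbrakk> \<Longrightarrow> y \<in> local_unstable \<A> G f \<epsilon> x"
proof -
  obtain K where K: "0 \<le> K"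
    "\<And>x y. \<lbrakk>x \<in> \<Lambda>; y \<in> \<Lambda>; \<And>i. \<bar>i\<bar> \<le> K \<Longrightarrow> c x i = c y i\<rbrakk> \<Longrightarrow> riemannian_dist \<A> G x y < ennreal \<epsilon>"
    by (rule code_close[OF assms]) blast
  show thesis
  proof (rule that[OF K(1)])
    fix x y assume xy: "x \<in> \<Lambda>" "y \<in> \<Lambda>" and eq: "\<And>i. -K \<le> i \<Longrightarrow> c y i = c x i"
    have "riemannian_dist \<A> G ((f ^^ n) x) ((f ^^ n) y) < ennreal \<epsilon>" for n
      by (intro K(2) pow_in xy) (auto simp: code_pow eq)
    then show "y \<in> local_stable \<A> G f \<epsilon> x" by (simp add: local_stable_def less_imp_le)
  next
    fix x y assume xy: "x \<in> \<Lambda>" "y \<in> \<Lambda>" and eq: "\<And>i. i \<le> K \<Longrightarrow> c y i = c x i"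
    have "riemannian_dist \<A> G ((inv f ^^ n) x) ((inv f ^^ n) y) < ennreal \<epsilon>" for n
      by (intro K(2) pow_in xy) (auto simp: code_pow eq)
    then show "y \<in> local_unstable \<A> G f \<epsilon> x" by (simp add: local_unstable_def local_stable_def less_imp_le)
  qed
qed

lemma code_window_nbhd:
  assumes "x \<in> \<Lambda>"
  shows "\<exists>U. open U \<and> x \<in> U \<and> (\<forall>y\<in>U \<inter> \<Lambda>. \<forall>i. \<bar>i\<bar> \<le> k \<longrightarrow> c y i = c x i)"
proof -
  from locally_constant_on_tuple[of "{-k..k}" \<Lambda> "\<lambda>i x. c x i" x]
  have "\<exists>U. open U \<and> x \<in> U \<and> (\<forall>i\<in>{-k..k}. \<forall>y\<in>U \<inter> \<Lambda>. c y i = c x i)"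
    using assms code_locally_constant by simp
  then obtain U where U: "open U" "x \<in> U" "\<And>i y. i \<in> {-k..k} \<Longrightarrow> y \<in> U \<inter> \<Lambda> \<Longrightarrow> c y i = c x i"
    by blast
  have "c y i = c x i" if "y \<in> U \<inter> \<Lambda>" "\<bar>i\<bar> \<le> k" for y i
    using that by (intro U(3)) auto
  then show ?thesis using U(1,2) by blast
qed

lemma window_ball:
  assumes "x \<in> \<Lambda>"
  shows "\<exists>e>0. \<forall>y\<in>\<Lambda>. riemannian_dist \<A> G x y < ennreal e \<longrightarrow> (\<forall>i. \<bar>i\<bar> \<le> k \<longrightarrow> c y i = c x i)"
proof -
  obtain U where U: "open U" "x \<in> U" "\<forall>y\<in>U \<inter> \<Lambda>. \<forall>i. \<bar>i\<bar> \<le> k \<longrightarrow> c y i = c x i"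
    using code_window_nbhd[OF assms] by blast
  obtain V e where V: "open V" "x \<in> V" "0 < e" "\<And>y. riemannian_dist \<A> G x y < ennreal e \<Longrightarrow> y \<in> U"
    using dist_separates[OF U(1,2)] by blast
  show ?thesis using U(3) V(3,4) by blast
qed

text \<open>Codes that agree on a long window belong to close points. The point provided by the local product
  structure has the future of one and the past of the other. The space of codes is closed because \<open>\<Lambda>\<close> is
  compact and the letters are locally constant.\<close>

lemma glued_shift_codes:
  obtains m where "glued_shift (c ` \<Lambda>) A m"
proof -
  define \<epsilon> where "\<epsilon> = \<epsilon>\<^sub>0 / 2"
  have \<epsilon>: "0 < \<epsilon>" "\<epsilon> < \<epsilon>\<^sub>0" using \<epsilon>\<^sub>0_pos by (auto simp: \<epsilon>_def)
  obtain \<eta> where \<eta>: "0 < \<eta>" "\<And>x y. \<lbrakk>x \<in> \<Lambda>; y \<in> \<Lambda>; riemannian_dist \<A> G x y < ennreal \<eta>\<rbrakk> \<Longrightarrow>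
      \<exists>z\<in>\<Lambda>. local_stable \<A> G f \<epsilon> x \<inter> local_unstable \<A> G f \<epsilon> y = {z}"
    using product[OF \<epsilon>] by blast
  obtain m where m: "0 \<le> m"
    "\<And>x y. \<lbrakk>x \<in> \<Lambda>; y \<in> \<Lambda>; \<And>i. \<bar>i\<bar> \<le> m \<Longrightarrow> c x i = c y i\<rbrakk> \<Longrightarrow> riemannian_dist \<A> G x y < ennreal \<eta>"
    by (rule code_close[OF \<eta>(1)]) blast
  show thesis
  proof (rule that[of m], unfold_locales)
    show "finite A" by (rule alphabet)
    show "s i \<in> A" if "s \<in> c ` \<Lambda>" for s i using that alphabet(2) by blast
    show "0 \<le> m" by (rule m)
    show "(\<lambda>i. s (i + n)) \<in> c ` \<Lambda>" if "s \<in> c ` \<Lambda>" for s n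
    proof -
      obtain x where x: "x \<in> \<Lambda>" "s = c x" using \<open>s \<in> c ` \<Lambda>\<close> by blast
      have "(\<lambda>i. s (i + n)) = c (iterate f n x)" by (simp add: fun_eq_iff code_iterate x(2))
      then show ?thesis using iterate_in[OF bij invariant x(1), of n] by blast
    qed
    show "t \<in> c ` \<Lambda>" if approx: "\<And>n. \<exists>s\<in>c ` \<Lambda>. \<forall>i. \<bar>i\<bar> \<le> n \<longrightarrow> s i = t i" for t
    proof -
      have "\<exists>x. x \<in> \<Lambda> \<and> (\<forall>i. \<bar>i\<bar> \<le> int n \<longrightarrow> c x i = t i)" for n using approx[of "int n"] by blast
      then obtain X where X: "\<And>n. X n \<in> \<Lambda>" "\<And>n i. \<bar>i\<bar> \<le> int n \<Longrightarrow> c (X n) i = t i" by metis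
      obtain x r where x: "x \<in> \<Lambda>" "strict_mono (r :: nat \<Rightarrow> nat)" "(X \<circ> r) \<longlonglongrightarrow> x"
        using seq_compactE[OF compact_imp_seq_compact[OF compact], of X] X(1) by blast
      have "c x i = t i" for i
      proof -
        obtain U where U: "open U" "x \<in> U" "\<forall>y\<in>U \<inter> \<Lambda>. c y i = c x i"
          using locally_constant_onD[OF code_locally_constant x(1)] by blast
        have "\<forall>\<^sub>F n in sequentially. (X \<circ> r) n \<in> U \<and> nat \<bar>i\<bar> \<le> n"
          by (intro eventually_conj topological_tendstoD[OF x(3) U(1,2)] eventually_ge_at_top)
        then obtain n where n: "X (r n) \<in> U" "nat \<bar>i\<bar> \<le> n" by (auto dest!: eventually_happens)
        have "\<bar>i\<bar> \<le> int (r n)" using n(2) seq_suble[OF x(2), of n] by linarith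
        then show ?thesis using U(3) n(1) X by (metis IntI)
      qed
      then have "t = c x" by (simp add: fun_eq_iff)
      then show ?thesis using x(1) by blast
    qed
    show "\<exists>u\<in>c ` \<Lambda>. (\<forall>i\<le>m. u i = s i) \<and> (\<forall>i\<ge>-m. u i = t i)"
      if st: "s \<in> c ` \<Lambda>" "t \<in> c ` \<Lambda>" "\<And>i. \<bar>i\<bar> \<le> m \<Longrightarrow> s i = t i" for s t
    proof -
      obtain x y where x: "x \<in> \<Lambda>" "s = c x" and y: "y \<in> \<Lambda>" "t = c y" using st(1,2) by blast
      have "riemannian_dist \<A> G y x < ennreal \<eta>" using m(2)[OF y(1) x(1)] st(3) x(2) y(2) by simp
      then obtain z where z: "z \<in> \<Lambda>" "z \<in> local_stable \<A> G f \<epsilon> y" "z \<in> local_unstable \<A> G f \<epsilon> x"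
        using \<eta>(2)[OF y(1) x(1)] by blast
      have zs: "c z i = t i" if "0 \<le> i" for i using code_stable[OF \<epsilon>(2) y(1) z(1,2) that] y(2) by simp
      have zu: "c z i = s i" if "i \<le> 0" for i using code_unstable[OF \<epsilon>(2) x(1) z(1,3) that] x(2) by simp
      have "c z i = s i" if "i \<le> m" for i using zs[of i] zu[of i] st(3)[of i] that by (cases "0 \<le> i") auto
      moreover have "c z i = t i" if "-m \<le> i" for i
        using zs[of i] zu[of i] st(3)[of i] that by (cases "0 \<le> i") auto
      ultimately show ?thesis using z(1) by blast
    qed
  qed
qed

lemma unstable_branching:
  assumes x: "x \<in> \<Lambda>" "x islimpt (local_unstable \<A> G f \<epsilon> x \<inter> \<Lambda>)" and \<epsilon>: "\<epsilon> < \<epsilon>\<^sub>0"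
  shows "\<exists>y\<in>c ` \<Lambda>. (\<forall>i\<le>K. y i = c x i) \<and> y \<noteq> c x"
proof -
  obtain U where U: "open U" "x \<in> U" "\<And>y i. y \<in> U \<Longrightarrow> y \<in> \<Lambda> \<Longrightarrow> \<bar>i\<bar> \<le> K \<Longrightarrow> c y i = c x i"
    using code_window_nbhd[OF x(1), of K] by blast
  obtain y where y: "y \<in> local_unstable \<A> G f \<epsilon> x" "y \<in> \<Lambda>" "y \<in> U" "y \<noteq> x"
    using x(2) U(1,2) unfolding islimpt_def by blast
  have "c y i = c x i" if "i \<le> K" for i
    using U(3)[OF y(3,2), of i] code_unstable[OF \<epsilon> x(1) y(2,1), of i] that by (cases "i \<le> 0") auto
  moreover have "c y \<noteq> c x" using code_inj[OF y(2) x(1)] y(4) by blast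
  ultimately show ?thesis using y(2) by blast
qed

lemma stable_branching:
  assumes x: "x \<in> \<Lambda>" "x islimpt (local_stable \<A> G f \<epsilon> x \<inter> \<Lambda>)" and \<epsilon>: "\<epsilon> < \<epsilon>\<^sub>0"
  shows "\<exists>y\<in>c ` \<Lambda>. (\<forall>i\<ge>-K. y i = c x i) \<and> y \<noteq> c x"
proof -
  obtain U where U: "open U" "x \<in> U" "\<And>y i. y \<in> U \<Longrightarrow> y \<in> \<Lambda> \<Longrightarrow> \<bar>i\<bar> \<le> K \<Longrightarrow> c y i = c x i"
    using code_window_nbhd[OF x(1), of K] by blast
  obtain y where y: "y \<in> local_stable \<A> G f \<epsilon> x" "y \<in> \<Lambda>" "y \<in> U" "y \<noteq> x"
    using x(2) U(1,2) unfolding islimpt_def by blast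
  have "c y i = c x i" if "-K \<le> i" for i
    using U(3)[OF y(3,2), of i] code_stable[OF \<epsilon> x(1) y(2,1), of i] that by (cases "0 \<le> i") auto
  moreover have "c y \<noteq> c x" using code_inj[OF y(2) x(1)] y(4) by blast
  ultimately show ?thesis using y(2) by blast
qed

end

text \<open>A Lebesgue number for the partition into level sets.\<close>

lemma locally_constant_gap:
  fixes d :: "'m::topological_space \<Rightarrow> 'm \<Rightarrow> ennreal"
  assumes \<Lambda>: "compact \<Lambda>" and P: "locally_constant_on \<Lambda> P"
    and sep: "\<And>U p. open U \<Longrightarrow> p \<in> U \<Longrightarrow> \<exists>V e. open V \<and> p \<in> V \<and> 0 < e \<and>
      (\<forall>x\<in>V. \<forall>y. d x y < ennreal e \<longrightarrow> y \<in> U)"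
  shows "\<exists>e>0. \<forall>x\<in>\<Lambda>. \<forall>y\<in>\<Lambda>. d x y < ennreal e \<longrightarrow> P x = P y"
proof -
  have "\<forall>p\<in>\<Lambda>. \<exists>Ve. open (fst Ve) \<and> p \<in> fst Ve \<and> 0 < snd Ve \<and>
    (\<forall>x\<in>fst Ve \<inter> \<Lambda>. \<forall>y\<in>\<Lambda>. d x y < ennreal (snd Ve) \<longrightarrow> P x = P y)"
  proof
    fix p assume "p \<in> \<Lambda>"
    from locally_constant_onD[OF P this]
    obtain U where U: "open U" "p \<in> U" "\<And>y. y \<in> U \<inter> \<Lambda> \<Longrightarrow> P y = P p" by blast
    obtain V e where V: "open V" "p \<in> V" "0 < e" "\<forall>x\<in>V. \<forall>y. d x y < ennreal e \<longrightarrow> y \<in> U"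
      using sep[OF U(1,2)] by blast
    have "P x = P y" if "x \<in> (V \<inter> U) \<inter> \<Lambda>" "y \<in> \<Lambda>" "d x y < ennreal e" for x y
    proof -
      have "y \<in> U" using V(4) that by blast
      then have "P y = P p" using U(3) that(2) by blast
      moreover have "P x = P p" using U(3) that(1) by blast
      ultimately show ?thesis by simp
    qed
    then show "\<exists>Ve. open (fst Ve) \<and> p \<in> fst Ve \<and> 0 < snd Ve \<and>
        (\<forall>x\<in>fst Ve \<inter> \<Lambda>. \<forall>y\<in>\<Lambda>. d x y < ennreal (snd Ve) \<longrightarrow> P x = P y)"
      using U(1,2) V(1-3) by (intro exI[of _ "(V \<inter> U, e)"]) auto
  qed
  from bchoice[OF this] obtain w where w: "\<forall>p\<in>\<Lambda>. open (fst (w p)) \<and> p \<in> fst (w p) \<and> 0 < snd (w p) \<and>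
    (\<forall>x\<in>fst (w p) \<inter> \<Lambda>. \<forall>y\<in>\<Lambda>. d x y < ennreal (snd (w p)) \<longrightarrow> P x = P y)" ..
  have "\<And>p. p \<in> \<Lambda> \<Longrightarrow> open (fst (w p))" "\<Lambda> \<subseteq> (\<Union>p\<in>\<Lambda>. fst (w p))" using w by auto
  from compactE_image[OF \<Lambda> this] obtain F where F: "F \<subseteq> \<Lambda>" "finite F" "\<Lambda> \<subseteq> (\<Union>p\<in>F. fst (w p))"
    by blast
  define e where "e = Min (insert 1 ((\<lambda>p. snd (w p)) ` F))"
  have "0 < e" using F(1,2) w unfolding e_def by (subst Min_gr_iff) auto
  moreover have "P x = P y" if xy: "x \<in> \<Lambda>" "y \<in> \<Lambda>" "d x y < ennreal e" for x y
  proof -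
    obtain p where p: "p \<in> F" "x \<in> fst (w p)" using F(3) xy(1) by blast
    have "e \<le> snd (w p)" unfolding e_def using F(2) p(1) by (intro Min_le) auto
    then have "d x y < ennreal (snd (w p))" using xy(3) ennreal_leI order_less_le_trans by blast
    moreover have "p \<in> \<Lambda>" using F(1) p(1) by blast
    ultimately show ?thesis using w p(2) xy(1,2) by blast
  qed
  ultimately show ?thesis by blast
qed

text \<open>The partition is given by the first \<open>n\<close> coordinates of the Cantor set, with \<open>n\<close> so large that its mesh is
  below a scale \<open>e\<close> at which the product structure holds. If two points have the same code, they lie on each
  other's local stable and unstable manifold of size \<open>e\<close>, hence coincide. The scale \<open>\<gamma>\<close> is a gap between
  different partition elements.\<close>

lemma cantor_basic_set_coding:
  fixes \<A> :: "('m::{t2_space,second_countable_topology}, 'e::euclidean_space) chart set"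
  assumes atlas: "smooth_atlas \<A>" and G: "riemannian_metric \<A> G" and f: "smooth_diffeo \<A> f"
    and hyp: "hyperbolic_set \<A> G f \<Lambda>" and prod: "local_product_structure \<A> G f \<Lambda>"
    and cantor: "cantor_set \<Lambda>"
  shows "\<exists>(c :: 'm \<Rightarrow> int \<Rightarrow> bool list) A \<epsilon>\<^sub>0. coded_basic_set \<A> G f \<Lambda> c A \<epsilon>\<^sub>0"
proof -
  let ?d = "riemannian_dist \<A> G"
  have compact: "compact \<Lambda>" and inv: "f ` \<Lambda> = \<Lambda>" using hyp unfolding hyperbolic_set_def by blast+
  have bij: "bij f" and cont: "continuous_on UNIV f" "continuous_on UNIV (inv f)"
    using f by (simp_all only: smooth_diffeo_def smooth_map_def)
  have small: "\<exists>U. open U \<and> p \<in> U \<and> (\<forall>x\<in>U. \<forall>y\<in>U. ?d x y < ennreal e)" if "0 < e" for p e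
  proof (rule riemannian_dist_small[OF atlas G that, of p])
    fix U assume "open U" "p \<in> U" "\<And>x y. x \<in> U \<Longrightarrow> y \<in> U \<Longrightarrow> ?d x y < ennreal e"
    then show ?thesis by blast
  qed
  have sep: "\<exists>V e. open V \<and> p \<in> V \<and> 0 < e \<and> (\<forall>x\<in>V. \<forall>y. ?d x y < ennreal e \<longrightarrow> y \<in> U)"
    if "open U" "p \<in> U" for U p
  proof (rule riemannian_dist_separates[OF atlas G that])
    fix V e assume "open V" "p \<in> V" "0 < e" "\<And>x y. x \<in> V \<Longrightarrow> ?d x y < ennreal e \<Longrightarrow> y \<in> U"
    then show ?thesis by blast
  qed
  have self: "?d x x < ennreal e" if "0 < e" for x e using small[OF that, of x] by blast
  obtain \<epsilon>1 where \<epsilon>1: "0 < \<epsilon>1" and lps: "\<And>\<epsilon>. 0 < \<epsilon> \<and> \<epsilon> < \<epsilon>1 \<Longrightarrow>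
       (\<exists>\<eta>>0. \<forall>x\<in>\<Lambda>. \<forall>y\<in>\<Lambda>. ?d x y < ennreal \<eta> \<longrightarrow>
          (\<exists>z\<in>\<Lambda>. local_stable \<A> G f \<epsilon> x \<inter> local_unstable \<A> G f \<epsilon> y = {z}))"
    using prod unfolding local_product_structure_def by blast
  define e where "e = \<epsilon>1 / 2"
  have e: "0 < e" "e < \<epsilon>1" using \<epsilon>1 by (auto simp: e_def)
  obtain h :: "nat \<Rightarrow> 'm \<Rightarrow> bool" where h: "\<And>i. locally_constant_on \<Lambda> (h i)"
    "\<And>x y. \<lbrakk>x \<in> \<Lambda>; y \<in> \<Lambda>; \<And>i. h i x = h i y\<rbrakk> \<Longrightarrow> x = y"
    by (rule cantor_coordinates[OF cantor]) blast
  have h_sep: "\<forall>x\<in>\<Lambda>. \<forall>y\<in>\<Lambda>. (\<forall>i. h i x = h i y) \<longrightarrow> x = y" using h(2) by blast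
  have "\<forall>p\<in>\<Lambda>. \<exists>U. open U \<and> p \<in> U \<and> (\<forall>x\<in>U. \<forall>y\<in>U. ?d x y < ennreal e)" using small[OF e(1)] by blast
  from uniform_separation[OF compact h(1) h_sep this]
  obtain n where n: "\<And>x y. \<lbrakk>x \<in> \<Lambda>; y \<in> \<Lambda>; \<forall>i<n. h i x = h i y\<rbrakk> \<Longrightarrow> ?d x y < ennreal e" by blast
  define P where "P x = map (\<lambda>i. h i x) [0..<n]" for x
  have P_eq: "P x = P y \<longleftrightarrow> (\<forall>i<n. h i x = h i y)" for x y by (auto simp: P_def)
  have P_lc: "locally_constant_on \<Lambda> P" unfolding locally_constant_on_def
  proof
    fix x assume "x \<in> \<Lambda>"
    from locally_constant_on_tuple[of "{..<n}" \<Lambda> h, OF _ h(1) this]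
    obtain U where U: "open U" "x \<in> U" "\<forall>i\<in>{..<n}. \<forall>y\<in>U \<inter> \<Lambda>. h i y = h i x" by auto
    have "\<forall>y\<in>U \<inter> \<Lambda>. P y = P x" unfolding P_eq using U(3) by blast
    then show "\<exists>U. open U \<and> x \<in> U \<and> (\<forall>y\<in>U \<inter> \<Lambda>. P y = P x)" using U(1,2) by blast
  qed
  obtain \<gamma> where \<gamma>: "0 < \<gamma>" "\<And>x y. \<lbrakk>x \<in> \<Lambda>; y \<in> \<Lambda>; ?d x y < ennreal \<gamma>\<rbrakk> \<Longrightarrow> P x = P y"
    using locally_constant_gap[OF compact P_lc, of ?d, OF sep] by blast
  define c where "c x i = P (iterate f i x)" for x i
  note iter = iterate_in[OF bij inv]
  have c_iter: "c (iterate f m x) i = c x (i + m)" for x m i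
    unfolding c_def iterate_add[OF bij] ..
  have c_inj: "x = y" if xy: "x \<in> \<Lambda>" "y \<in> \<Lambda>" "c x = c y" for x y
  proof -
    have close: "?d (iterate f i x) (iterate f i y) \<le> ennreal e" for i
    proof -
      have "P (iterate f i x) = P (iterate f i y)" using fun_cong[OF xy(3), of i] by (simp add: c_def)
      then show ?thesis using n[OF iter[OF xy(1)] iter[OF xy(2)]] P_eq by (simp add: less_imp_le)
    qed
    have "y \<in> local_stable \<A> G f e x" unfolding local_stable_def
      using close[of "int j" for j] by simp
    moreover have "y \<in> local_unstable \<A> G f e x" unfolding local_unstable_def local_stable_def
      using close[of "- int j" for j] by (simp add: iterate_minus_int)
    moreover have "x \<in> local_stable \<A> G f e x \<inter> local_unstable \<A> G f e x"
      unfolding local_unstable_def local_stable_def using self[OF e(1)] by (simp add: less_imp_le)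
    moreover obtain z where "local_stable \<A> G f e x \<inter> local_unstable \<A> G f e x = {z}"
      using lps[of e] e self xy(1) by blast
    ultimately show ?thesis by (metis IntI singletonD)
  qed
  have P_close: "P x = P y" if "x \<in> \<Lambda>" "y \<in> \<Lambda>" "?d x y \<le> ennreal \<epsilon>" "\<epsilon> < \<gamma>" for x y \<epsilon>
    using that \<gamma>(1) by (intro \<gamma>(2)) (auto intro: order_le_less_trans ennreal_lessI)
  have "coded_basic_set \<A> G f \<Lambda> c {xs. length xs = n} (min \<epsilon>1 \<gamma>)"
  proof
    show "finite {xs :: bool list. length xs = n}" using finite_lists_length_eq[of "UNIV :: bool set" n] by simp
    show "c x i \<in> {xs. length xs = n}" for x i by (simp add: c_def P_def)
    show "locally_constant_on \<Lambda> (\<lambda>x. c x i)" for i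
      unfolding c_def using iter
      by (intro locally_constant_on_compose[OF P_lc continuous_on_iterate[OF cont]]) blast
    show "0 < min \<epsilon>1 \<gamma>" using \<epsilon>1 \<gamma>(1) by simp
    show "c y i = c x i" if \<epsilon>: "\<epsilon> < min \<epsilon>1 \<gamma>" and xy: "x \<in> \<Lambda>" "y \<in> \<Lambda>" "y \<in> local_stable \<A> G f \<epsilon> x" "0 \<le> i"
      for \<epsilon> x y i
    proof -
      have "?d ((f ^^ nat i) x) ((f ^^ nat i) y) \<le> ennreal \<epsilon>" using xy(3) unfolding local_stable_def by blast
      then have "?d (iterate f i x) (iterate f i y) \<le> ennreal \<epsilon>" using xy(4) by (simp add: iterate_def)
      from P_close[OF iter[OF xy(1)] iter[OF xy(2)] this] \<epsilon> show ?thesis by (simp add: c_def)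
    qed
    show "c y i = c x i" if \<epsilon>: "\<epsilon> < min \<epsilon>1 \<gamma>" and xy: "x \<in> \<Lambda>" "y \<in> \<Lambda>" "y \<in> local_unstable \<A> G f \<epsilon> x" "i \<le> 0"
      for \<epsilon> x y i
    proof -
      have "?d ((inv f ^^ nat (- i)) x) ((inv f ^^ nat (- i)) y) \<le> ennreal \<epsilon>"
        using xy(3) unfolding local_unstable_def local_stable_def by blast
      moreover have "iterate f i = inv f ^^ nat (- i)" using iterate_minus_int[of f "nat (- i)"] xy(4) by simp
      ultimately have "?d (iterate f i x) (iterate f i y) \<le> ennreal \<epsilon>" by simp
      from P_close[OF iter[OF xy(1)] iter[OF xy(2)] this] \<epsilon> show ?thesis by (simp add: c_def)
    qed
    show "\<exists>\<eta>>0. \<forall>x\<in>\<Lambda>. \<forall>y\<in>\<Lambda>. ?d x y < ennreal \<eta> \<longrightarrow>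
          (\<exists>z\<in>\<Lambda>. local_stable \<A> G f \<epsilon> x \<inter> local_unstable \<A> G f \<epsilon> y = {z})"
      if "0 < \<epsilon>" "\<epsilon> < min \<epsilon>1 \<gamma>" for \<epsilon> using lps[of \<epsilon>] that by simp
  qed (fact compact bij inv small sep c_iter c_inj)+
  then show ?thesis by blast
qed

context coded_basic_set begin

lemma code_weight_iterate:
  "word_weight L z v N (c ((f ^^ n) x)) 0 = word_weight L z v N (c x) (int n)"
  "word_weight L z v N (c ((inv f ^^ n) x)) 0 = word_weight L z v N (c x) (- int n)"
  unfolding word_weight_def occurs_at_def code_pow by (simp_all add: add.commute)

lemma Delta_word_weight:
  assumes r: "\<forall>x\<in>\<Lambda>. r x = C + word_weight L z v N (c x) 0" and xy: "x \<in> \<Lambda>" "y \<in> \<Lambda>"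
  shows "Delta_s f r x y = (\<Sum>n. word_weight L z v N (c y) (int n) - word_weight L z v N (c x) (int n))"
    and "Delta_u f r x y = (\<Sum>n. word_weight L z v N (c x) (- int (Suc n)) - word_weight L z v N (c y) (- int (Suc n)))"
proof -
  have "r ((f ^^ n) x) = C + word_weight L z v N (c x) (int n)"
    "r ((inv f ^^ n) x) = C + word_weight L z v N (c x) (- int n)" if "x \<in> \<Lambda>" for x n
    using bspec[OF r pow_in(1)[OF that]] bspec[OF r pow_in(2)[OF that]] by (simp_all only: code_weight_iterate)
  note * = this[OF xy(1)] this[OF xy(2)]
  show "Delta_s f r x y = (\<Sum>n. word_weight L z v N (c y) (int n) - word_weight L z v N (c x) (int n))"
    unfolding Delta_s_def * by simp
  show "Delta_u f r x y = (\<Sum>n. word_weight L z v N (c x) (- int (Suc n)) - word_weight L z v N (c y) (- int (Suc n)))"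
    unfolding Delta_u_def * by simp
qed

text \<open>The points whose code has a given word in the centre form a clopen subset of \<open>\<Lambda>\<close>, whose indicator
  function extends smoothly to the manifold.\<close>

lemma smooth_word_function:
  assumes atlas: "smooth_atlas \<A>"
  shows "\<exists>r C. smooth_function \<A> r \<and> (\<forall>x. 0 < r x) \<and> (\<forall>x\<in>\<Lambda>. r x = C + word_weight L z v N (c x) 0)"
proof -
  define K where "K t = {x \<in> \<Lambda>. occurs_at L (z t) (c x) 0}" for t
  have "\<exists>\<eta>. smooth_function \<A> \<eta> \<and> (\<forall>x. 0 \<le> \<eta> x \<and> \<eta> x \<le> 1) \<and>
    (\<forall>x\<in>\<Lambda>. \<eta> x = of_bool (occurs_at L (z t) (c x) 0))" for t
  proof -
    have lc: "locally_constant_on \<Lambda> (\<lambda>x. occurs_at L (z t) (c x) 0)" unfolding locally_constant_on_def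
    proof
      fix x assume "x \<in> \<Lambda>"
      from code_window_nbhd[OF this, of L] obtain U where U: "open U" "x \<in> U"
        "\<forall>y\<in>U \<inter> \<Lambda>. \<forall>i. \<bar>i\<bar> \<le> L \<longrightarrow> c y i = c x i" by blast
      have "\<forall>y\<in>U \<inter> \<Lambda>. occurs_at L (z t) (c y) 0 = occurs_at L (z t) (c x) 0"
        using U(3) by (simp add: occurs_at_def)
      then show "\<exists>U. open U \<and> x \<in> U \<and> (\<forall>y\<in>U \<inter> \<Lambda>. occurs_at L (z t) (c y) 0 = occurs_at L (z t) (c x) 0)"
        using U(1,2) by blast
    qed
    have lc': "locally_constant_on \<Lambda> (\<lambda>x. \<not> occurs_at L (z t) (c x) 0)"
      using lc unfolding locally_constant_on_def by simp
    have K: "compact (K t)" unfolding K_def by (rule compact_locally_constant_Collect[OF compact lc])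
    have K': "compact {x \<in> \<Lambda>. \<not> occurs_at L (z t) (c x) 0}"
      by (rule compact_locally_constant_Collect[OF compact lc'])
    have o: "open (- {x \<in> \<Lambda>. \<not> occurs_at L (z t) (c x) 0})"
      using compact_imp_closed[OF K'] by (rule open_Compl)
    have sub: "K t \<subseteq> - {x \<in> \<Lambda>. \<not> occurs_at L (z t) (c x) 0}" by (auto simp: K_def)
    show ?thesis
    proof (rule smooth_urysohn[OF atlas K o sub])
      fix \<eta> assume \<eta>: "smooth_function \<A> \<eta>" "\<And>x. 0 \<le> \<eta> x" "\<And>x. \<eta> x \<le> 1" "\<And>x. x \<in> K t \<Longrightarrow> \<eta> x = 1"
        "\<And>x. x \<notin> - {x \<in> \<Lambda>. \<not> occurs_at L (z t) (c x) 0} \<Longrightarrow> \<eta> x = 0"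
      have "\<eta> x = of_bool (occurs_at L (z t) (c x) 0)" if "x \<in> \<Lambda>" for x
        using \<eta>(4)[of x] \<eta>(5)[of x] that by (cases "occurs_at L (z t) (c x) 0") (auto simp: K_def)
      then show ?thesis using \<eta>(1-3) by blast
    qed
  qed
  then obtain \<eta> where \<eta>: "\<And>t. smooth_function \<A> (\<eta> t)" "\<And>t x. 0 \<le> \<eta> t x" "\<And>t x. \<eta> t x \<le> 1"
    "\<And>t x. x \<in> \<Lambda> \<Longrightarrow> \<eta> t x = of_bool (occurs_at L (z t) (c x) 0)" by metis
  define C where "C = 1 + (\<Sum>t<N. \<bar>v t\<bar>)"
  define r where "r x = C + (\<Sum>t<N. v t * \<eta> t x)" for x
  have "smooth_function \<A> r" unfolding r_def
    by (intro smooth_function_add smooth_function_const smooth_function_sum smooth_function_scale atlas \<eta>(1))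
  moreover have "0 < r x" for x
  proof -
    have "- \<bar>v t\<bar> \<le> v t * \<eta> t x" for t
    proof -
      have "\<bar>v t * \<eta> t x\<bar> \<le> \<bar>v t\<bar> * 1" using \<eta>(2)[of t x] \<eta>(3)[of t x]
        unfolding abs_mult by (intro mult_left_mono) auto
      then show ?thesis by linarith
    qed
    then have "(\<Sum>t<N. - \<bar>v t\<bar>) \<le> (\<Sum>t<N. v t * \<eta> t x)" by (intro sum_mono)
    then show ?thesis by (simp add: r_def C_def sum_negf)
  qed
  moreover have "\<forall>x\<in>\<Lambda>. r x = C + word_weight L z v N (c x) 0"
    by (simp add: r_def word_weight_def \<eta>(4))
  ultimately show ?thesis by blast
qed

end


section \<open>Roof functions with prescribed temporal range\<close>

context coded_basic_set begin

text \<open>The radius \<open>\<delta>\<^sub>0\<close> is so small that every point of the ball agrees with \<open>x0\<close> on the window of radius \<open>k\<close> and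
  that the product structure applies to any two of its points; in particular the corner is unique and
  lies in \<open>\<Lambda>\<close>. The words depend on \<open>\<delta>\<close>: they are chosen such that their corners lie in the given ball.\<close>

lemma temporal_range_prescribed:
  assumes atlas: "smooth_atlas \<A>" and \<epsilon>: "0 < \<epsilon>" "\<epsilon> < \<epsilon>\<^sub>0" and x0: "x0 \<in> \<Lambda>"
    and ws: "x0 islimpt (local_stable \<A> G f \<epsilon> x0 \<inter> \<Lambda>)"
    and wu: "x0 islimpt (local_unstable \<A> G f \<epsilon> x0 \<inter> \<Lambda>)"
  shows "\<exists>\<delta>\<^sub>0>0. \<forall>\<delta>. 0 < \<delta> \<and> \<delta> < \<delta>\<^sub>0 \<longrightarrow> (\<forall>(v :: nat \<Rightarrow> real) N. \<exists>r.
    smooth_function \<A> r \<and> (\<forall>x. 0 < r x) \<and>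
    temporal_range \<A> G f \<Lambda> r \<epsilon> \<delta> x0 = insert 0 (v ` {..<N}))"
proof (rule glued_shift_codes)
  fix m assume gs: "glued_shift (c ` \<Lambda>) A m"
  show ?thesis
  proof (rule glued_shift.isolating_words[OF gs imageI[OF x0] unstable_branching[OF x0 wu \<epsilon>(2)]
        stable_branching[OF x0 ws \<epsilon>(2)]])
    fix k assume k: "0 \<le> k" and iso: "\<And>K N. k \<le> K \<Longrightarrow> \<exists>p\<in>c ` \<Lambda>. \<exists>z L. (\<forall>i\<ge>-K. p i = c x0 i) \<and> k \<le> L \<and>
      (\<forall>t<N::nat. z t \<in> c ` \<Lambda> \<and> (\<forall>i\<le>K. z t i = p i) \<and>
        (\<exists>q\<in>c ` \<Lambda>. (\<forall>i\<le>K. q i = c x0 i) \<and> (\<forall>i\<ge>-K. z t i = q i))) \<and>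
      isolating k L (c x0) N z"
    let ?d = "riemannian_dist \<A> G"
    obtain \<eta> where \<eta>: "0 < \<eta>" "\<And>x y. \<lbrakk>x \<in> \<Lambda>; y \<in> \<Lambda>; ?d x y < ennreal \<eta>\<rbrakk> \<Longrightarrow>
      \<exists>z\<in>\<Lambda>. local_stable \<A> G f \<epsilon> x \<inter> local_unstable \<A> G f \<epsilon> y = {z}" using product[OF \<epsilon>] by blast
    obtain e1 where e1: "0 < e1" "\<And>y i. \<lbrakk>y \<in> \<Lambda>; ?d x0 y < ennreal e1; \<bar>i\<bar> \<le> k\<rbrakk> \<Longrightarrow> c y i = c x0 i"
      using window_ball[OF x0, of k] by blast
    obtain U where U: "open U" "x0 \<in> U" "\<And>x y. x \<in> U \<Longrightarrow> y \<in> U \<Longrightarrow> ?d x y < ennreal \<eta>"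
      using dist_small[OF \<eta>(1), of x0] by blast
    obtain e2 where e2: "0 < e2" "\<And>y. ?d x0 y < ennreal e2 \<Longrightarrow> y \<in> U"
      using dist_separates[OF U(1,2)] by blast
    show ?thesis
    proof (intro exI[of _ "min e1 e2"] conjI allI impI)
      show "0 < min e1 e2" using e1(1) e2(1) by simp
      fix \<delta> :: real and v :: "nat \<Rightarrow> real" and N :: nat
      assume "0 < \<delta> \<and> \<delta> < min e1 e2"
      then have \<delta>: "0 < \<delta>" "\<delta> \<le> e1" "\<delta> \<le> e2" by auto
      have near: "c y i = c x0 i" if "y \<in> \<Lambda>" "?d x0 y < ennreal \<delta>" "\<bar>i\<bar> \<le> k" for y i
        using that \<delta>(2) by (intro e1(2)) (auto intro: order_less_le_trans ennreal_leI)
      have close: "?d x y < ennreal \<eta>" if "?d x0 x < ennreal \<delta>" "?d x0 y < ennreal \<delta>" for x y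
        using that \<delta>(3) by (intro U(3) e2(2)) (auto intro: order_less_le_trans ennreal_leI)
      obtain K1 where K1: "0 \<le> K1" "\<And>x y. \<lbrakk>x \<in> \<Lambda>; y \<in> \<Lambda>; \<And>i. \<bar>i\<bar> \<le> K1 \<Longrightarrow> c x i = c y i\<rbrakk> \<Longrightarrow> ?d x y < ennreal \<delta>"
        by (rule code_close[OF \<delta>(1)]) blast
      obtain K2 where K2: "0 \<le> K2"
        "\<And>x y. \<lbrakk>x \<in> \<Lambda>; y \<in> \<Lambda>; \<And>i. -K2 \<le> i \<Longrightarrow> c y i = c x i\<rbrakk> \<Longrightarrow> y \<in> local_stable \<A> G f \<epsilon> x"
        "\<And>x y. \<lbrakk>x \<in> \<Lambda>; y \<in> \<Lambda>; \<And>i. i \<le> K2 \<Longrightarrow> c y i = c x i\<rbrakk> \<Longrightarrow> y \<in> local_unstable \<A> G f \<epsilon> x"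
        by (rule code_determines_local[OF \<epsilon>(1)]) blast
      \<comment> \<open>Agreement on the window of radius \<open>K\<close> puts a point into the ball of radius \<open>\<delta>\<close>, and
        agreement to the right (left) of \<open>-K\<close> (\<open>K\<close>) puts points on one local stable (unstable) manifold
        of size \<open>\<epsilon>\<close>.\<close>
      define K where "K = max k (max K1 K2)"
      have K: "k \<le> K" "K1 \<le> K" "K2 \<le> K" by (auto simp: K_def)
      obtain p z L where p: "p \<in> c ` \<Lambda>" "\<forall>i\<ge>-K. p i = c x0 i" and L: "k \<le> L"
        and z: "\<forall>t<N. z t \<in> c ` \<Lambda> \<and> (\<forall>i\<le>K. z t i = p i) \<and>
          (\<exists>q\<in>c ` \<Lambda>. (\<forall>i\<le>K. q i = c x0 i) \<and> (\<forall>i\<ge>-K. z t i = q i))"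
        and isol: "isolating k L (c x0) N z"
        using iso[OF K(1), of N] by (elim bexE exE conjE) (rule that)
      \<comment> \<open>An occurrence at the corner counts negatively, so the weights are \<open>- v t\<close>.\<close>
      obtain r C where r: "smooth_function \<A> r" "\<forall>x. 0 < r x"
        "\<forall>x\<in>\<Lambda>. r x = C + word_weight L z (\<lambda>t. - v t) N (c x) 0"
        using smooth_word_function[OF atlas] by blast
      note Delta = Delta_word_weight[OF r(3)]

      have corner: "\<exists>x3\<in>\<Lambda>. corner_set \<A> G f \<epsilon> \<delta> x0 x1 x2 = {x3} \<and>
          (\<forall>i\<ge>-k. c x1 i = c x0 i) \<and> (\<forall>i\<le>k. c x2 i = c x0 i) \<and>
          (\<forall>i\<le>k. c x3 i = c x1 i) \<and> (\<forall>i\<ge>-k. c x3 i = c x2 i)"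
        if dom: "(x1, x2) \<in> temporal_domain \<A> G f \<Lambda> \<epsilon> \<delta> x0" for x1 x2
      proof -
        have x1: "x1 \<in> \<Lambda>" "x1 \<in> local_stable \<A> G f \<epsilon> x0" "?d x0 x1 < ennreal \<delta>"
          and x2: "x2 \<in> \<Lambda>" "x2 \<in> local_unstable \<A> G f \<epsilon> x0" "?d x0 x2 < ennreal \<delta>"
          and ne: "corner_set \<A> G f \<epsilon> \<delta> x0 x1 x2 \<noteq> {}"
          using dom unfolding temporal_domain_def riemannian_ball_def by auto
        obtain x3 where x3: "x3 \<in> \<Lambda>" "local_stable \<A> G f \<epsilon> x2 \<inter> local_unstable \<A> G f \<epsilon> x1 = {x3}"
          using \<eta>(2)[OF x2(1) x1(1) close[OF x2(3) x1(3)]] by blast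
        have "corner_set \<A> G f \<epsilon> \<delta> x0 x1 x2 = {x3} \<inter> riemannian_ball \<A> G x0 \<delta>"
          unfolding corner_set_def x3(2)[symmetric] by (simp only: Int_commute)
        with ne have cs: "corner_set \<A> G f \<epsilon> \<delta> x0 x1 x2 = {x3}" by auto
        then have x3': "?d x0 x3 < ennreal \<delta>" unfolding corner_set_def riemannian_ball_def by blast
        have x3s: "x3 \<in> local_stable \<A> G f \<epsilon> x2" "x3 \<in> local_unstable \<A> G f \<epsilon> x1" using x3(2) by blast+
        have "c x1 i = c x0 i" if "-k \<le> i" for i
          using code_stable[OF \<epsilon>(2) x0 x1(1,2), of i] near[OF x1(1,3), of i] that by (cases "0 \<le> i") auto
        moreover have "c x2 i = c x0 i" if "i \<le> k" for i
          using code_unstable[OF \<epsilon>(2) x0 x2(1,2), of i] near[OF x2(1,3), of i] that by (cases "i \<le> 0") auto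
        moreover have "c x3 i = c x1 i" if "i \<le> k" for i
          using code_unstable[OF \<epsilon>(2) x1(1) x3(1) x3s(2), of i] near[OF x1(1,3), of i] near[OF x3(1) x3', of i] that
          by (cases "i \<le> 0") auto
        moreover have "c x3 i = c x2 i" if "-k \<le> i" for i
          using code_stable[OF \<epsilon>(2) x2(1) x3(1) x3s(1), of i] near[OF x2(1,3), of i] near[OF x3(1) x3', of i] that
          by (cases "0 \<le> i") auto
        ultimately show ?thesis using x3(1) cs by blast
      qed

      have val: "(\<forall>t<N. \<forall>n. \<bar>n\<bar> \<le> L - k \<longrightarrow> \<not> occurs_at L (z t) (c x3) n) \<Longrightarrow>
            temporal_distance \<A> G f r \<epsilon> \<delta> x0 x1 x2 = 0"
          "\<lbrakk>t < N; \<bar>n\<bar> \<le> L - k; occurs_at L (z t) (c x3) n\<rbrakk> \<Longrightarrow>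
            temporal_distance \<A> G f r \<epsilon> \<delta> x0 x1 x2 = v t"
        if dom: "(x1, x2) \<in> temporal_domain \<A> G f \<Lambda> \<epsilon> \<delta> x0"
          and x3: "corner_set \<A> G f \<epsilon> \<delta> x0 x1 x2 = {x3}" for x1 x2 x3 t n
      proof -
        have x12: "x1 \<in> \<Lambda>" "x2 \<in> \<Lambda>" using dom unfolding temporal_domain_def by auto
        obtain y where y: "y \<in> \<Lambda>" "corner_set \<A> G f \<epsilon> \<delta> x0 x1 x2 = {y}"
          "\<forall>i\<ge>-k. c x1 i = c x0 i" "\<forall>i\<le>k. c x2 i = c x0 i"
          "\<forall>i\<le>k. c y i = c x1 i" "\<forall>i\<ge>-k. c y i = c x2 i" using corner[OF dom] by blast
        have "y = x3" using y(2) x3 by simp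
        note y = y(1,3-6)[unfolded this]
        have T: "temporal_distance \<A> G f r \<epsilon> \<delta> x0 x1 x2 =
          Delta_s f r x0 x1 + Delta_u f r x1 x3 + Delta_s f r x3 x2 + Delta_u f r x2 x0"
          unfolding temporal_distance_def x3 by simp
        note D = Delta(1)[OF x0 x12(1)] Delta(2)[OF x12(1) y(1)] Delta(1)[OF y(1) x12(2)] Delta(2)[OF x12(2) x0]
        note count = alternating_word_count[where v = "\<lambda>t. - v t", OF y(2-5) isol]
        show "temporal_distance \<A> G f r \<epsilon> \<delta> x0 x1 x2 = 0"
          if "\<forall>t<N. \<forall>n. \<bar>n\<bar> \<le> L - k \<longrightarrow> \<not> occurs_at L (z t) (c x3) n"
          unfolding T D by (rule count(1)[OF that])
        show "temporal_distance \<A> G f r \<epsilon> \<delta> x0 x1 x2 = v t"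
          if "t < N" "\<bar>n\<bar> \<le> L - k" "occurs_at L (z t) (c x3) n"
          unfolding T D count(2)[OF that] by simp
      qed

      have "temporal_range \<A> G f \<Lambda> r \<epsilon> \<delta> x0 \<subseteq> insert 0 (v ` {..<N})"
        unfolding temporal_range_def
      proof (rule image_subsetI, clarify)
        fix x1 x2 assume dom: "(x1, x2) \<in> temporal_domain \<A> G f \<Lambda> \<epsilon> \<delta> x0"
          and nv: "temporal_distance \<A> G f r \<epsilon> \<delta> x0 x1 x2 \<notin> v ` {..<N}"
        obtain x3 where x3: "corner_set \<A> G f \<epsilon> \<delta> x0 x1 x2 = {x3}" using corner[OF dom] by blast
        have "\<forall>t<N. \<forall>n. \<bar>n\<bar> \<le> L - k \<longrightarrow> \<not> occurs_at L (z t) (c x3) n"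
          using val(2)[OF dom x3] nv by blast
        then show "temporal_distance \<A> G f r \<epsilon> \<delta> x0 x1 x2 = 0" by (rule val(1)[OF dom x3])
      qed
      moreover have "0 \<in> temporal_range \<A> G f \<Lambda> r \<epsilon> \<delta> x0"
      proof -
        have in_c: "x0 \<in> corner_set \<A> G f \<epsilon> \<delta> x0 x0 x0"
          unfolding corner_set_def riemannian_ball_def using self_in_local[OF \<epsilon>(1)] dist_self[OF \<delta>(1)] by blast
        have dom: "(x0, x0) \<in> temporal_domain \<A> G f \<Lambda> \<epsilon> \<delta> x0"
          unfolding temporal_domain_def using in_c x0 self_in_local[OF \<epsilon>(1)] dist_self[OF \<delta>(1)]
          by (auto simp: riemannian_ball_def)
        obtain x3 where x3: "corner_set \<A> G f \<epsilon> \<delta> x0 x0 x0 = {x3}" using corner[OF dom] by blast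
        have "x3 = x0" using in_c unfolding x3 by simp
        then have "\<forall>t<N. \<forall>n. \<bar>n\<bar> \<le> L - k \<longrightarrow> \<not> occurs_at L (z t) (c x3) n"
          using isol unfolding isolating_def by blast
        then have "temporal_distance \<A> G f r \<epsilon> \<delta> x0 x0 x0 = 0" by (rule val(1)[OF dom x3])
        then show ?thesis unfolding temporal_range_def using dom by (force simp: image_iff)
      qed
      moreover have "v t \<in> temporal_range \<A> G f \<Lambda> r \<epsilon> \<delta> x0" if t: "t < N" for t
      proof -
        obtain P where P: "P \<in> \<Lambda>" "c P = p" using p(1) by auto
        note zt = mp[OF spec[OF z] t]
        obtain Z where Z: "Z \<in> \<Lambda>" "c Z = z t" using conjunct1[OF zt] by auto
        have zp: "\<forall>i\<le>K. z t i = p i" using conjunct1[OF conjunct2[OF zt]] .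
        obtain Q where Q: "Q \<in> \<Lambda>" "\<forall>i\<le>K. c Q i = c x0 i" "\<forall>i\<ge>-K. z t i = c Q i"
          using conjunct2[OF conjunct2[OF zt]] by auto
        have dP: "?d x0 P < ennreal \<delta>" using p(2) P K by (intro K1(2)[OF x0 P(1)]) auto
        have dQ: "?d x0 Q < ennreal \<delta>" using Q K by (intro K1(2)[OF x0 Q(1)]) auto
        have dZ: "?d x0 Z < ennreal \<delta>" using Z zp p(2) K by (intro K1(2)[OF x0 Z(1)]) auto
        have "Z \<in> local_unstable \<A> G f \<epsilon> P" using zp Z P K by (intro K2(3)) auto
        moreover have "Z \<in> local_stable \<A> G f \<epsilon> Q" using Q Z K by (intro K2(2)) auto
        ultimately have in_c: "Z \<in> corner_set \<A> G f \<epsilon> \<delta> x0 P Q"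
          using dZ by (simp add: corner_set_def riemannian_ball_def)
        have "P \<in> local_stable \<A> G f \<epsilon> x0" using p(2) P x0 K by (intro K2(2)) auto
        moreover have "Q \<in> local_unstable \<A> G f \<epsilon> x0" using Q x0 K by (intro K2(3)) auto
        ultimately have dom: "(P, Q) \<in> temporal_domain \<A> G f \<Lambda> \<epsilon> \<delta> x0"
          unfolding temporal_domain_def using in_c P(1) Q(1) dP dQ by (auto simp: riemannian_ball_def)
        obtain x3 where x3: "corner_set \<A> G f \<epsilon> \<delta> x0 P Q = {x3}" using corner[OF dom] by blast
        have "x3 = Z" using in_c unfolding x3 by simp
        then have "temporal_distance \<A> G f r \<epsilon> \<delta> x0 P Q = v t"
          using val(2)[OF dom x3 t, of 0] L Z(2) by (simp add: occurs_at_def)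
        then show ?thesis unfolding temporal_range_def using dom by (force simp: image_iff)
      qed
      ultimately have "temporal_range \<A> G f \<Lambda> r \<epsilon> \<delta> x0 = insert 0 (v ` {..<N})" by blast
      then show "\<exists>r. smooth_function \<A> r \<and> (\<forall>x. 0 < r x) \<and>
          temporal_range \<A> G f \<Lambda> r \<epsilon> \<delta> x0 = insert 0 (v ` {..<N})"
        using r(1,2) by blast
    qed
  qed
qed

end

theorem theorem1p5:
  fixes \<A> :: "('m::{t2_space,second_countable_topology}, 'e::euclidean_space) chart set"
    and G :: "('m, 'e) metric_tensor"
    and f :: "'m \<Rightarrow> 'm"
    and \<Lambda> :: "'m set"
  assumes "compact (UNIV :: 'm set)"
    and "smooth_atlas \<A>"
    and "riemannian_metric \<A> G"
    and "smooth_diffeo \<A> f"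
    and "hyperbolic_set \<A> G f \<Lambda>"
    and "local_product_structure \<A> G f \<Lambda>"
    and "cantor_set \<Lambda>"
  shows "\<exists>\<epsilon>\<^sub>0>0. \<forall>\<epsilon>. 0 < \<epsilon> \<and> \<epsilon> < \<epsilon>\<^sub>0 \<longrightarrow>
    (\<forall>x0\<in>\<Lambda>.
      x0 islimpt (local_stable \<A> G f \<epsilon> x0 \<inter> \<Lambda>) \<and>
      x0 islimpt (local_unstable \<A> G f \<epsilon> x0 \<inter> \<Lambda>) \<longrightarrow>
      (\<exists>\<delta>\<^sub>0>0. \<forall>\<delta>. 0 < \<delta> \<and> \<delta> < \<delta>\<^sub>0 \<longrightarrow>
        (\<forall>\<alpha> \<beta> :: real. \<exists>r :: 'm \<Rightarrow> real.
          smooth_function \<A> r \<and> (\<forall>x. 0 < r x) \<and>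
          temporal_range \<A> G f \<Lambda> r \<epsilon> \<delta> x0 = {0, \<alpha>, - \<alpha>, \<beta>, - \<beta>})))"
proof -
  obtain c :: "'m \<Rightarrow> int \<Rightarrow> bool list" and A \<epsilon>\<^sub>0 where "coded_basic_set \<A> G f \<Lambda> c A \<epsilon>\<^sub>0"
    using cantor_basic_set_coding[OF assms(2-7)] by blast
  then interpret coded_basic_set \<A> G f \<Lambda> c A \<epsilon>\<^sub>0 .
  show ?thesis
  proof (rule exI[of _ \<epsilon>\<^sub>0], rule conjI[OF \<epsilon>\<^sub>0_pos], intro allI ballI impI)
    fix \<epsilon> x0 assume \<epsilon>: "0 < \<epsilon> \<and> \<epsilon> < \<epsilon>\<^sub>0" and x0: "x0 \<in> \<Lambda>"
      and lim: "x0 islimpt (local_stable \<A> G f \<epsilon> x0 \<inter> \<Lambda>) \<and> x0 islimpt (local_unstable \<A> G f \<epsilon> x0 \<inter> \<Lambda>)"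
    obtain \<delta>\<^sub>0 where \<delta>\<^sub>0: "0 < \<delta>\<^sub>0" and r: "\<And>\<delta> (v :: nat \<Rightarrow> real) N. 0 < \<delta> \<and> \<delta> < \<delta>\<^sub>0 \<Longrightarrow> \<exists>r. smooth_function \<A> r \<and>
        (\<forall>x. 0 < r x) \<and> temporal_range \<A> G f \<Lambda> r \<epsilon> \<delta> x0 = insert 0 (v ` {..<N})"
      using temporal_range_prescribed[OF assms(2) conjunct1[OF \<epsilon>] conjunct2[OF \<epsilon>] x0
          conjunct1[OF lim] conjunct2[OF lim]] by blast
    have "\<exists>r. smooth_function \<A> r \<and> (\<forall>x. 0 < r x) \<and>
        temporal_range \<A> G f \<Lambda> r \<epsilon> \<delta> x0 = {0, \<alpha>, - \<alpha>, \<beta>, - \<beta>}"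
      if "0 < \<delta> \<and> \<delta> < \<delta>\<^sub>0" for \<delta> \<alpha> \<beta> :: real
    proof -
      have "{..<4::nat} = {0, 1, 2, 3}" by auto
      then have "insert 0 ((!) [\<alpha>, - \<alpha>, \<beta>, - \<beta>] ` {..<4}) = {0, \<alpha>, - \<alpha>, \<beta>, - \<beta>}"
        by simp
      then show ?thesis using r[OF that, of "(!) [\<alpha>, - \<alpha>, \<beta>, - \<beta>]" 4] by simp
    qed
    then show "\<exists>\<delta>\<^sub>0>0. \<forall>\<delta>. 0 < \<delta> \<and> \<delta> < \<delta>\<^sub>0 \<longrightarrow> (\<forall>\<alpha> \<beta> :: real. \<exists>r :: 'm \<Rightarrow> real.
          smooth_function \<A> r \<and> (\<forall>x. 0 < r x) \<and>
          temporal_range \<A> G f \<Lambda> r \<epsilon> \<delta> x0 = {0, \<alpha>, - \<alpha>, \<beta>, - \<beta>})"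
      using \<delta>\<^sub>0 by blast
  qed
qed

end
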